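(* Fix generic complex numbers $\lambda_i,\mu_i$ ($i=1,2,3$) with $\sum\lambda_i=\sum\mu_i$, set $$\theta_1=\lambda_1-\mu_1,\quad\theta_2=\lambda_2-\mu_1,\quad\theta_3=\lambda_3-\mu_1,\quad\theta_4=\mu_3-\mu_2,\qquad \delta=\tfrac12\sum_{i=1}^4\theta_i=\mu_3-\mu_1,$$ let $t\in\mathbb{C}\setminus\{0,1\}$ and $(a_1,a_2,a_3)=(0,t,1)$. For generic $(x,y)\in\mathbb{C}^2$ let $z_i,u_i$ ($i=1,2,3$) be the unique solution of the six equations $$y=tu_1z_1,\quad x=\sum_{i=1}^3\frac{z_i}{y-a_i},\quad \sum_{i=1}^3 z_i=\mu_1-\mu_3,\quad \sum_{i=1}^3 u_iz_i=0,\quad \sum_{i=1}^3 w_i=0,\quad \sum_{i=1}^3(t-a_i)u_iz_i=1,$$ where $w_i=(z_i+\theta_i)/u_i$, and let $c_1,c_2,c_3$ be the solution of the three linear equations $$\sum_{i=1}^3 c_iz_i=0,\qquad \sum_{i=1}^3 c_iw_i=0,\qquad \sum_{i=1}^3 (t-a_i)c_iz_i=1.$$ Put $V=\mathbb{C}^3$, $\beta_i=(0,w_i,-z_i)\in V^*$, and let $f_i\in V$ be the column vector with entries $(c_i,u_i,1)$. Generically $f_1,f_2,f_3$ are linearly independent; let $\hat f_1,\hat f_2,\hat f_3\in V^*$ be the dual basis, and define $$B_i=f_i\otimes(\beta_i+\mu_1\hat f_i)\in\mathrm{End}(V),\qquad \hat B(z)=\sum_{i=1}^3\frac{B_i}{z-a_i},\qquad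 \tilde B(z)=z(z-1)(z-t)\hat B(z).$$ Then the following hold. (1) Each $B_i$ has rank one, $\mathrm{Tr}(B_i)=\lambda_i$, and $\sum_{i=1}^3B_i=\mathrm{diag}(\mu_1,\mu_2,\mu_3)$. Moreover, generically, any triple of rank one matrices with traces $\lambda_1,\lambda_2,\lambda_3$ and sum $\mathrm{diag}(\mu_1,\mu_2,\mu_3)$ is conjugate, by a single element of the diagonal torus of $\mathrm{GL}_3(\mathbb{C})$, to the triple $B_1,B_2,B_3$ for some values of $x$ and $y$. (2) If $y_{jk}$ denotes the value of $z$ at which the $(j,k)$ matrix entry of $\tilde B$ vanishes, then $$y_{23}=y,\qquad y_{21}=y+\frac{\mu_3-\mu_1}{x}.$$ (3) One has $$x=\frac{\mu_1-\mu_3}{\mu_3}\,\hat B_{33}\Big|_{z=y}\qquad\text{and}\qquad x=\frac{\mu_3-\mu_1}{\mu_1}\,\hat B_{11}\Big|_{z=y+\delta/x}.$$ (4) Suppose $y(t)$ solves $\mathrm{P}_{\mathrm{VI}}$ with parameters $\theta=(\theta_1,\theta_2,\theta_3,\theta_4)$ and $x(t)$ is defined by $$2x=\frac{(t-1)y'-\theta_1}{y}+\frac{y'-1-\theta_2}{y-t}-\frac{t\,y'+\theta_3}{y-1},\qquad y'=\frac{dy}{dt},$$ with $(x(t),y(t))$ generic in the sense that, for $x=x(t)$, $y=y(t)$ and each $t$ under consideration, the six equations for $z_i,u_i$ and the three linear equations for $c_i$ are uniquely solvable and $f_1,f_2,f_3$ are linearly independent. Then, with $B_i=B_i(t)=f_i\otimes(\beta_i+\mu_1\hat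 f_i)$, where $\beta_i,f_i,\hat f_i$ are formed from the solutions $z_i,u_i,c_i$ (and $w_i=(z_i+\theta_i)/u_i$) of those equations for the values $x=x(t)$, $y=y(t)$ and $t$, the family of connections $d-\left(\frac{B_1}{z}+\frac{B_2}{z-t}+\frac{B_3}{z-1}\right)dz$ is isomonodromic as $t$ varies. Moreover, if $h=\mathrm{diag}(l,k,1)$ where $l(t),k(t)\in\mathbb{C}^*$ satisfy $$\frac{d}{dt}\log k=\frac{\theta_4-1}{t(t-1)}(y-t),\qquad \frac{d}{dt}\log l=\frac{\delta-1}{t(t-1)}\left(y-t-\frac{\delta-\theta_4}{p}\right),\qquad p=x+\sum_{i=1}^3\frac{\theta_i}{y-a_i},$$ then the matrices $hB_ih^{-1}$ ($i=1,2,3$) solve Schlesinger's equations.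
   Context: The sixth Painlevé equation $\mathrm{P}_{\mathrm{VI}}$ with parameters $\theta=(\theta_1,\theta_2,\theta_3,\theta_4)$ is $$\begin{aligned}\frac{d^2y}{dt^2}=&\frac12\left(\frac1y+\frac1{y-1}+\frac1{y-t}\right)\left(\frac{dy}{dt}\right)^2-\left(\frac1t+\frac1{t-1}+\frac1{y-t}\right)\frac{dy}{dt}\\&+\frac{y(y-1)(y-t)}{2t^2(t-1)^2}\left((\theta_4-1)^2-\frac{\theta_1^2\,t}{y^2}+\frac{\theta_3^2(t-1)}{(y-1)^2}+\frac{(1-\theta_2^2)t(t-1)}{(y-t)^2}\right).\end{aligned}$$ Schlesinger's equations for matrices $C_1,C_2,C_3$ depending on $t$ are $$\frac{dC_1}{dt}=\frac{[C_2,C_1]}{t},\qquad \frac{dC_2}{dt}=\frac{[C_1,C_2]}{t}+\frac{[C_3,C_2]}{t-1},\qquad \frac{dC_3}{dt}=\frac{[C_2,C_3]}{t-1}.$$ For $f\in V$ and $\beta\in V^*$, $f\otimes\beta\in\mathrm{End}(V)$ is the map $v\mapsto\beta(v)f$. "Generic" means outside a proper Zariski closed subset of the relevant parameter space, so that the quantities in question are well defined (in particular the systems of equations for $z_i,u_i$ and for $c_i$ are uniquely solvable and the $f_i$ are linearly independent). A family of connections with poles at $0,t,1,\infty$ on $\mathbb{P}^1$ is isomonodromic if, as $t$ varies locally in $\mathbb{P}^1\setminus\{0,1,\infty\}$, the conjugacy class of its monodromy representation of $\pi_1(\mathbb{P}^1\setminus\{0,t,1,\infty\})$ is constant, where the fundamental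 groups for nearby values of $t$ are canonically identified via the family of four-punctured spheres over a disk in the $t$-plane. *)

theory Defs
  imports "HOL-Analysis.Analysis"
begin

section \<open>Zariski-generic points\<close>

text \<open>Polynomial functions are generated by a given set X of coordinate functions. A property is
  generic in S if it holds outside a proper subset of S that is Zariski closed in S.\<close>

inductive_set polynomial_functions :: "('a \<Rightarrow> complex) set \<Rightarrow> ('a \<Rightarrow> complex) set"
  for X :: "('a \<Rightarrow> complex) set" where
  const: "(\<lambda>_. c) \<in> polynomial_functions X"
| coord: "f \<in> X \<Longrightarrow> f \<in> polynomial_functions X"
| add: "f \<in> polynomial_functions X \<Longrightarrow> g \<in> polynomial_functions X \<Longrightarrow>
    (\<lambda>p. f p + g p) \<in> polynomial_functions X"
| mult: "f \<in> polynomial_functions X \<Longrightarrow> g \<in> polynomial_functions X \<Longrightarrow>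
    (\<lambda>p. f p * g p) \<in> polynomial_functions X"

definition zariski_closed_in ::
  "('a \<Rightarrow> complex) set \<Rightarrow> 'a set \<Rightarrow> 'a set \<Rightarrow> bool" where
  "zariski_closed_in X S Z \<longleftrightarrow>
     (\<exists>F \<subseteq> polynomial_functions X. Z = {p \<in> S. \<forall>f\<in>F. f p = 0})"

definition generic_in ::
  "('a \<Rightarrow> complex) set \<Rightarrow> 'a set \<Rightarrow> ('a \<Rightarrow> bool) \<Rightarrow> bool" where
  "generic_in X S P \<longleftrightarrow>
     (\<exists>Z. zariski_closed_in X S Z \<and> Z \<noteq> S \<and> (\<forall>p \<in> S - Z. P p))"

definition param_coords :: "((complex^3) \<times> (complex^3) \<Rightarrow> complex) set" where
  "param_coords = range (\<lambda>i (lam, mu). lam $ i) \<union> range (\<lambda>i (lam, mu). mu $ i)"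

definition param_space :: "((complex^3) \<times> (complex^3)) set" where
  "param_space = {(lam, mu). (\<Sum>i\<in>UNIV. lam $ i) = (\<Sum>i\<in>UNIV. mu $ i)}"

definition plane_coords :: "(complex \<times> complex \<Rightarrow> complex) set" where
  "plane_coords = {fst, snd}"

definition triple_coords :: "((3 \<Rightarrow> complex^3^3) \<Rightarrow> complex) set" where
  "triple_coords = {\<lambda>A. A i $ j $ k | i j k. True}"

section \<open>Matrices\<close>

definition diag :: "complex^3 \<Rightarrow> complex^3^3" where
  "diag d = (\<chi> j k. if j = k then d $ j else 0)"

definition conj_by :: "complex^3^3 \<Rightarrow> complex^3^3 \<Rightarrow> complex^3^3" where
  "conj_by g M = g ** M ** matrix_inv g"

definition commutator :: "complex^3^3 \<Rightarrow> complex^3^3 \<Rightarrow> complex^3^3" where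
  "commutator M N = M ** N - N ** M"

definition mat_scale :: "complex \<Rightarrow> complex^3^3 \<Rightarrow> complex^3^3" where
  "mat_scale c M = (\<chi> j k. c * M $ j $ k)"

definition has_matrix_derivative ::
  "(complex \<Rightarrow> complex^3^3) \<Rightarrow> complex^3^3 \<Rightarrow> complex \<Rightarrow> bool" where
  "has_matrix_derivative M M' t \<longleftrightarrow>
     (\<forall>j k. ((\<lambda>s. M s $ j $ k) has_field_derivative M' $ j $ k) (at t))"

text \<open>Elements of the dual space are row vectors: an element phi is the linear form
  sending v to pairing phi v (no complex conjugation).\<close>

definition pairing :: "complex^3 \<Rightarrow> complex^3 \<Rightarrow> complex" where
  "pairing phi v = (\<Sum>k\<in>UNIV. phi $ k * v $ k)"

definition tensor :: "complex^3 \<Rightarrow> complex^3 \<Rightarrow> complex^3^3" where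
  "tensor f phi = (\<chi> j k. f $ j * phi $ k)"

lemma tensor_apply: "tensor f phi *v v = pairing phi v *s f"
  by (simp add: tensor_def pairing_def matrix_vector_mult_def vec_eq_iff sum_distrib_right
      mult_ac sum_distrib_left)

definition dual_basis :: "(3 \<Rightarrow> complex^3) \<Rightarrow> 3 \<Rightarrow> complex^3" where
  "dual_basis f = (THE g. \<forall>i j. pairing (g i) (f j) = (if i = j then 1 else 0))"

section \<open>The triple of rank one matrices\<close>

definition theta :: "complex^3 \<Rightarrow> complex^3 \<Rightarrow> 3 \<Rightarrow> complex" where
  "theta lam mu i = lam $ i - mu $ 1"

definition theta4 :: "complex^3 \<Rightarrow> complex" where
  "theta4 mu = mu $ 3 - mu $ 2"

definition delta :: "complex^3 \<Rightarrow> complex^3 \<Rightarrow> complex" where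
  "delta lam mu = ((\<Sum>i\<in>UNIV. theta lam mu i) + theta4 mu) / 2"

lemma delta_eq:
  assumes "(lam, mu) \<in> param_space"
  shows "delta lam mu = mu $ 3 - mu $ 1"
proof -
  have "lam $ 3 = mu $ 1 + mu $ 2 + mu $ 3 - lam $ 1 - lam $ 2"
    using assms unfolding param_space_def sum_3 by (simp only: mem_Collect_eq case_prod_conv) algebra
  then show ?thesis
    by (simp add: delta_def theta_def theta4_def sum_3)
qed

definition pole :: "complex \<Rightarrow> 3 \<Rightarrow> complex" where
  "pole t i = vector [0, t, 1] $ i"

definition w_of :: "complex^3 \<Rightarrow> complex^3 \<Rightarrow> complex^3 \<Rightarrow> complex^3 \<Rightarrow> complex^3" where
  "w_of lam mu z u = (\<chi> i. (z $ i + theta lam mu i) / u $ i)"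

text \<open>The first two conditions say that the fractions in the equations are defined.\<close>

definition zu_system ::
  "complex^3 \<Rightarrow> complex^3 \<Rightarrow> complex \<Rightarrow> complex \<Rightarrow> complex \<Rightarrow> complex^3 \<Rightarrow> complex^3 \<Rightarrow> bool" where
  "zu_system lam mu t x y z u \<longleftrightarrow>
     (\<forall>i. y \<noteq> pole t i) \<and> (\<forall>i. u $ i \<noteq> 0) \<and>
     y = t * u $ 1 * z $ 1 \<and>
     x = (\<Sum>i\<in>UNIV. z $ i / (y - pole t i)) \<and>
     (\<Sum>i\<in>UNIV. z $ i) = mu $ 1 - mu $ 3 \<and>
     (\<Sum>i\<in>UNIV. u $ i * z $ i) = 0 \<and>
     (\<Sum>i\<in>UNIV. w_of lam mu z u $ i) = 0 \<and>
     (\<Sum>i\<in>UNIV. (t - pole t i) * u $ i * z $ i) = 1"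

definition c_system :: "complex \<Rightarrow> complex^3 \<Rightarrow> complex^3 \<Rightarrow> complex^3 \<Rightarrow> bool" where
  "c_system t z w c \<longleftrightarrow>
     (\<Sum>i\<in>UNIV. c $ i * z $ i) = 0 \<and>
     (\<Sum>i\<in>UNIV. c $ i * w $ i) = 0 \<and>
     (\<Sum>i\<in>UNIV. (t - pole t i) * c $ i * z $ i) = 1"

definition zu_sol ::
  "complex^3 \<Rightarrow> complex^3 \<Rightarrow> complex \<Rightarrow> complex \<Rightarrow> complex \<Rightarrow> (complex^3) \<times> (complex^3)" where
  "zu_sol lam mu t x y = (THE (z, u). zu_system lam mu t x y z u)"

definition z_sol :: "complex^3 \<Rightarrow> complex^3 \<Rightarrow> complex \<Rightarrow> complex \<Rightarrow> complex \<Rightarrow> complex^3" where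
  "z_sol lam mu t x y = fst (zu_sol lam mu t x y)"

definition u_sol :: "complex^3 \<Rightarrow> complex^3 \<Rightarrow> complex \<Rightarrow> complex \<Rightarrow> complex \<Rightarrow> complex^3" where
  "u_sol lam mu t x y = snd (zu_sol lam mu t x y)"

definition w_sol :: "complex^3 \<Rightarrow> complex^3 \<Rightarrow> complex \<Rightarrow> complex \<Rightarrow> complex \<Rightarrow> complex^3" where
  "w_sol lam mu t x y = w_of lam mu (z_sol lam mu t x y) (u_sol lam mu t x y)"

definition c_sol :: "complex^3 \<Rightarrow> complex^3 \<Rightarrow> complex \<Rightarrow> complex \<Rightarrow> complex \<Rightarrow> complex^3" where
  "c_sol lam mu t x y = (THE c. c_system t (z_sol lam mu t x y) (w_sol lam mu t x y) c)"

definition f_vec ::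
  "complex^3 \<Rightarrow> complex^3 \<Rightarrow> complex \<Rightarrow> complex \<Rightarrow> complex \<Rightarrow> 3 \<Rightarrow> complex^3" where
  "f_vec lam mu t x y i = vector [c_sol lam mu t x y $ i, u_sol lam mu t x y $ i, 1]"

definition beta_vec ::
  "complex^3 \<Rightarrow> complex^3 \<Rightarrow> complex \<Rightarrow> complex \<Rightarrow> complex \<Rightarrow> 3 \<Rightarrow> complex^3" where
  "beta_vec lam mu t x y i = vector [0, w_sol lam mu t x y $ i, - (z_sol lam mu t x y $ i)]"

text \<open>Well-definedness of the construction at (x, y). Linear independence is over the complex
  numbers (hence the prefix vec). The determinant of the linear system for c is a nonzero multiple
  of p = x + sum theta_i/(y - a_i), so p is nonzero at admissible points.\<close>

definition admissible ::
  "complex^3 \<Rightarrow> complex^3 \<Rightarrow> complex \<Rightarrow> complex \<Rightarrow> complex \<Rightarrow> bool" where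
  "admissible lam mu t x y \<longleftrightarrow>
     (\<exists>!(z, u). zu_system lam mu t x y z u) \<and>
     (\<exists>!c. c_system t (z_sol lam mu t x y) (w_sol lam mu t x y) c) \<and>
     inj (f_vec lam mu t x y) \<and> vec.independent (range (f_vec lam mu t x y))"

definition B_mat ::
  "complex^3 \<Rightarrow> complex^3 \<Rightarrow> complex \<Rightarrow> complex \<Rightarrow> complex \<Rightarrow> 3 \<Rightarrow> complex^3^3" where
  "B_mat lam mu t x y i =
     tensor (f_vec lam mu t x y i)
       (beta_vec lam mu t x y i + mu $ 1 *s dual_basis (f_vec lam mu t x y) i)"

definition B_hat :: "complex \<Rightarrow> (3 \<Rightarrow> complex^3^3) \<Rightarrow> complex \<Rightarrow> complex^3^3" where
  "B_hat t B z = (\<Sum>i\<in>UNIV. mat_scale (1 / (z - pole t i)) (B i))"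

text \<open>The product z(z-1)(z-t) B_hat(z), as a matrix of polynomials in z; written with the
  denominators cancelled so that the values at z = 0, t, 1 are the right ones.\<close>

definition B_tilde :: "complex \<Rightarrow> (3 \<Rightarrow> complex^3^3) \<Rightarrow> complex \<Rightarrow> complex^3^3" where
  "B_tilde t B z = (\<Sum>i\<in>UNIV. mat_scale (\<Prod>j\<in>UNIV - {i}. z - pole t j) (B i))"

lemma B_tilde_eq:
  assumes "\<forall>i. z \<noteq> pole t i"
  shows "B_tilde t B z = mat_scale (z * (z - 1) * (z - t)) (B_hat t B z)"
proof -
  have "z * (z - 1) * (z - t) = (\<Prod>j\<in>UNIV. z - pole t j)"
    unfolding UNIV_3 by (simp add: pole_def)
  also have "\<dots> = (z - pole t i) * (\<Prod>j\<in>UNIV - {i}. z - pole t j)" for i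
    by (rule prod.remove) simp_all
  finally have *: "z * (z - 1) * (z - t) = (z - pole t i) * (\<Prod>j\<in>UNIV - {i}. z - pole t j)" for i .
  have "(\<Prod>j\<in>UNIV - {i}. z - pole t j) = z * (z - 1) * (z - t) / (z - pole t i)" for i
    unfolding * [of i] using assms by simp
  then show ?thesis
    by (simp add: B_tilde_def B_hat_def mat_scale_def vec_eq_iff sum_distrib_left)
qed

definition rank_one_triples :: "complex^3 \<Rightarrow> complex^3 \<Rightarrow> (3 \<Rightarrow> complex^3^3) set" where
  "rank_one_triples lam mu =
     {A. (\<forall>i. rank (A i) = 1 \<and> trace (A i) = lam $ i) \<and> (\<Sum>i\<in>UNIV. A i) = diag mu}"

section \<open>Painleve VI and Schlesinger's equations\<close>

definition solves_PVI ::
  "complex \<Rightarrow> complex \<Rightarrow> complex \<Rightarrow> complex \<Rightarrow> complex set \<Rightarrow> (complex \<Rightarrow> complex) \<Rightarrow> bool" where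
  "solves_PVI th1 th2 th3 th4 U y \<longleftrightarrow>
     y holomorphic_on U \<and>
     (\<forall>t\<in>U. y t \<noteq> 0 \<and> y t \<noteq> 1 \<and> y t \<noteq> t \<and>
       deriv (deriv y) t =
         1 / 2 * (1 / y t + 1 / (y t - 1) + 1 / (y t - t)) * (deriv y t)\<^sup>2
         - (1 / t + 1 / (t - 1) + 1 / (y t - t)) * deriv y t
         + y t * (y t - 1) * (y t - t) / (2 * t\<^sup>2 * (t - 1)\<^sup>2) *
           ((th4 - 1)\<^sup>2 - th1\<^sup>2 * t / (y t)\<^sup>2 + th3\<^sup>2 * (t - 1) / (y t - 1)\<^sup>2
             + (1 - th2\<^sup>2) * t * (t - 1) / (y t - t)\<^sup>2))"

definition solves_Schlesinger :: "complex set \<Rightarrow> (3 \<Rightarrow> complex \<Rightarrow> complex^3^3) \<Rightarrow> bool" where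
  "solves_Schlesinger U C \<longleftrightarrow>
     (\<forall>t\<in>U.
       has_matrix_derivative (C 1) (mat_scale (1 / t) (commutator (C 2 t) (C 1 t))) t \<and>
       has_matrix_derivative (C 2)
         (mat_scale (1 / t) (commutator (C 1 t) (C 2 t))
          + mat_scale (1 / (t - 1)) (commutator (C 3 t) (C 2 t))) t \<and>
       has_matrix_derivative (C 3) (mat_scale (1 / (t - 1)) (commutator (C 2 t) (C 3 t))) t)"

section \<open>Monodromy and isomonodromy\<close>

text \<open>Horizontal frames of the connection d - A(z) dz, their analytic continuation along a path
  (the values along the path locally come from a horizontal frame near each point), and the
  resulting parallel transport around loops.\<close>

definition horizontal_on ::
  "(complex \<Rightarrow> complex^3^3) \<Rightarrow> complex set \<Rightarrow> (complex \<Rightarrow> complex^3^3) \<Rightarrow> bool" where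
  "horizontal_on A S Phi \<longleftrightarrow> (\<forall>z\<in>S. has_matrix_derivative Phi (A z ** Phi z) z)"

definition continuation_along ::
  "(complex \<Rightarrow> complex^3^3) \<Rightarrow> (real \<Rightarrow> complex) \<Rightarrow> (real \<Rightarrow> complex^3^3) \<Rightarrow> bool" where
  "continuation_along A g Y \<longleftrightarrow>
     (\<forall>s\<in>{0..1}. \<exists>e>0. \<exists>Phi. horizontal_on A (ball (g s) e) Phi \<and>
       (\<exists>d>0. \<forall>r\<in>{0..1}. \<bar>r - s\<bar> < d \<longrightarrow> g r \<in> ball (g s) e \<and> Y r = Phi (g r)))"

definition has_monodromy ::
  "(complex \<Rightarrow> complex^3^3) \<Rightarrow> (real \<Rightarrow> complex) \<Rightarrow> complex^3^3 \<Rightarrow> bool" where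
  "has_monodromy A g M \<longleftrightarrow> (\<exists>Y. continuation_along A g Y \<and> Y 0 = mat 1 \<and> Y 1 = M)"

text \<open>The family of four-punctured spheres has fibre complex plane minus {0, t, 1} over t. Let tau
  be a path in the base and b a path of base points over it. A loop g in the fibre over tau 0 and a
  loop g' in the fibre over tau 1 are identified if they are the ends of a family of loops h(s, _)
  in the fibres over tau s, based at b s. If tau runs in a disk, this induces the canonical
  identification (up to inner automorphisms) of the fundamental groups of the two fibres.\<close>

definition identified_loops ::
  "(real \<Rightarrow> complex) \<Rightarrow> (real \<Rightarrow> complex) \<Rightarrow> (real \<Rightarrow> complex) \<Rightarrow> (real \<Rightarrow> complex) \<Rightarrow> bool" where
  "identified_loops tau b g g' \<longleftrightarrow>
     (\<exists>h :: real \<times> real \<Rightarrow> complex.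
       continuous_on ({0..1} \<times> {0..1}) h \<and>
       (\<forall>s\<in>{0..1}. \<forall>r\<in>{0..1}. h (s, r) \<notin> {0, tau s, 1}) \<and>
       (\<forall>s\<in>{0..1}. h (s, 0) = b s \<and> h (s, 1) = b s) \<and>
       (\<forall>r\<in>{0..1}. h (0, r) = g r \<and> h (1, r) = g' r))"

text \<open>A t is the matrix of a connection d - A t z dz with poles at 0, t, 1 and infinity. The
  conjugating matrix P is the same for all loops, so that it is the monodromy representations
  that are conjugate.\<close>

definition isomonodromic :: "complex set \<Rightarrow> (complex \<Rightarrow> complex \<Rightarrow> complex^3^3) \<Rightarrow> bool" where
  "isomonodromic U A \<longleftrightarrow>
     (\<forall>t0 r tau b. ball t0 r \<subseteq> U \<and> path tau \<and> path_image tau \<subseteq> ball t0 r \<and>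
        path b \<and> (\<forall>s\<in>{0..1}. b s \<notin> {0, tau s, 1}) \<longrightarrow>
        (\<exists>P. invertible P \<and>
          (\<forall>g g'. identified_loops tau b g g' \<longrightarrow>
            (\<exists>M. has_monodromy (A (tau 0)) g M \<and>
                 has_monodromy (A (tau 1)) g' (conj_by P M)))))"

end

theory Submission
  imports Defs "HOL-Complex_Analysis.Cauchy_Integral_Formula"
begin

text \<open>Write P(z) = z(z - 1)(z - t), let a_i be the poles 0, t, 1 and e_i = P'(a_i). Everything
  rests on the matrix F whose i-th column is z_i f_i and on its inverse G. The rows of F are q_i = c_i
  z_i, p_i = u_i z_i and z_i, and the defining equations say that q and p are values of linear
  polynomials, p_i = (y - a_i)/e_i and q_i = (Y - a_i)/e_i, with Y = y - (mu_2 - mu_1)/p. So z is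
  confined to a line by two linear equations, and the quadratic terms of the equation for w cancel on
  this line; this solves the system in closed form (zu_system_iff, c_system_iff). The matrix G is
  explicit as well (Fmat_Gmat), and since the B_i add up to diag mu, B_i is the product of the i-th
  column of F, the i-th row of G and diag mu (B_mat_eq). The statements about traces, entries and their
  zeros become partial fraction identities. Conversely, from a triple of rank one matrices the same F
  and G can be read off up to the torus action, and the prescribed traces are what makes z, u, c satisfy
  their equations (triple_normal_form).

  Schlesinger's equations for h B_i h^-1 follow if (hF)' = (hF) K, where K is the tridiagonal matrix
  with vanishing column sums and off-diagonal entries N_12/t, N_21/t, N_23/(t - 1), N_32/(t - 1) for N =
  G (diag mu) F: then (h B_i h^-1)' is hF [K, E_ii] G h^-1 (diag mu), with E_ii the i-th diagonal matrix
  unit, and [K, E_ii] is the combination of the E_jj N E_ii - E_ii N E_jj that appears on the right hand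
  sides (flow_mat_commutator, schlesinger). Off the diagonal, N_ij = r_i p_j - z_j with r_i = w_i / z_i.
  The three rows of hF are checked separately: the row p gives the definition of x and the equation for
  k (p_der), the row q is the unique solution of its linear system and produces the equation for l
  (q_der), and the row z is the place where Painleve VI is used, through the derivative of x
  (second_derivative_identity, z_der).

  For isomonodromy, choose l and k on a disk. Schlesinger's equations say that the connection with
  components B_hat in the direction of z and - C_2/(z - t) in the direction of t is flat
  (schlesinger_flat_connection). Flat frames exist locally (flat_frame_exists), continue along any
  square of loops (section_on_square), and parallel transport along the path of base points conjugates
  the monodromies at its two ends (monodromy_conjugate).\<close>

section \<open>Interpolation at the poles and the system for z and u\<close>

text \<open>The value at the i-th pole of the derivative of the cubic with zeros 0, t, 1, that is, the
  product of the differences of this pole with the other two.\<close>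

definition pole_diff :: "complex \<Rightarrow> 3 \<Rightarrow> complex" where
  "pole_diff t i = vector [t, t * (t - 1), 1 - t] $ i"

definition cubic :: "complex \<Rightarrow> complex \<Rightarrow> complex" where
  "cubic t y = y * (y - 1) * (y - t)"

lemma pole_values [simp]: "pole t 1 = 0" "pole t 2 = t" "pole t 3 = 1"
  by (simp_all add: pole_def)

lemma pole_diff_values [simp]: "pole_diff t 1 = t" "pole_diff t 2 = t * (t - 1)" "pole_diff t 3 = 1 - t"
  by (simp_all add: pole_diff_def)

lemma pole_diff_nonzero [simp]: "t \<noteq> 0 \<Longrightarrow> t \<noteq> 1 \<Longrightarrow>
    pole_diff t i \<noteq> 0"
  using exhaust_3 [of i] by auto

lemma not_pole_iff: "(\<forall>i. y \<noteq> pole t i) \<longleftrightarrow> y \<noteq> 0 \<and>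
    y \<noteq> t \<and> y \<noteq> 1"
  by (simp add: forall_3)

lemma cubic_nonzero: "\<forall>i. y \<noteq> pole t i \<Longrightarrow> cubic t y \<noteq> 0"
  by (simp add: not_pole_iff cubic_def)

text \<open>The sum of f(a_i)/P'(a_i) over the poles is the coefficient of degree two of f modulo P.
  This and the following sums are the cases needed of this residue formula.\<close>

lemma sum_inverse_pole_diff:
  assumes "t \<noteq> 0" "t \<noteq> 1"
  shows "(\<Sum>i\<in>UNIV. 1 / pole_diff t i) = 0"
  unfolding sum_3 using assms by (simp add: divide_simps)

lemma sum_lin_pole_diff:
  assumes "t \<noteq> 0" "t \<noteq> 1"
  shows "(\<Sum>i\<in>UNIV. (y - pole t i) / pole_diff t i) = 0"
  unfolding sum_3 using assms by (simp add: divide_simps) algebra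

lemma sum_square_pole_diff:
  assumes "t \<noteq> 0" "t \<noteq> 1"
  shows "(\<Sum>i\<in>UNIV. (y - pole t i)^2 / pole_diff t i) = 1"
  unfolding sum_3 using assms by (simp add: divide_simps) algebra

lemma sum_cube_pole_diff:
  assumes "t \<noteq> 0" "t \<noteq> 1"
  shows "(\<Sum>i\<in>UNIV. (y - pole t i)^3 / pole_diff t i) = 3 * y - 1 - t"
  unfolding sum_3 using assms by (simp add: divide_simps) algebra

lemma partial_fractions:
  assumes "t \<noteq> 0" "t \<noteq> 1" "\<forall>i. z \<noteq> pole t i"
  shows "(\<Sum>i\<in>UNIV. (y - pole t i) / (pole_diff t i * (z - pole t i))) = (y - z) / cubic t z"
proof -
  have "z \<noteq> 0" "z \<noteq> t" "z \<noteq> 1" using assms by (simp_all add: not_pole_iff)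
  then show ?thesis
    unfolding sum_3 cubic_def using assms(1,2) by (simp add: divide_simps) algebra
qed

lemma partial_fractions_one:
  assumes "t \<noteq> 0" "t \<noteq> 1" "\<forall>i. z \<noteq> pole t i"
  shows "(\<Sum>i\<in>UNIV. 1 / (pole_diff t i * (z - pole t i))) = 1 / cubic t z"
proof -
  have "z \<noteq> 0" "z \<noteq> t" "z \<noteq> 1" using assms by (simp_all add: not_pole_iff)
  then show ?thesis
    unfolding sum_3 cubic_def using assms(1,2) by (simp add: divide_simps) algebra
qed

lemma partial_fractions_square:
  assumes "t \<noteq> 0" "t \<noteq> 1" "\<forall>i. z \<noteq> pole t i"
  shows "(\<Sum>i\<in>UNIV. 1 / (pole_diff t i * (z - pole t i)^2)) =
     ((z - 1) * (z - t) + z * (z - t) + z * (z - 1)) / (cubic t z)^2"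
proof -
  have "z \<noteq> 0" "z \<noteq> t" "z \<noteq> 1" using assms by (simp_all add: not_pole_iff)
  then show ?thesis
    unfolding sum_3 cubic_def using assms(1,2) by (simp add: divide_simps) algebra
qed

text \<open>The numbers d_i P'(a_i) are the values at the poles of a polynomial of degree at most two;
  the two sums force it to be Y - a with Y = t d_1.\<close>

lemma interpolation_line:
  fixes d :: "3 \<Rightarrow> complex"
  assumes t: "t \<noteq> 0" "t \<noteq> 1"
    and "(\<Sum>i\<in>UNIV. d i) = 0" "(\<Sum>i\<in>UNIV. (t - pole t i) * d i) = 1"
  shows "d i = (t * d 1 - pole t i) / pole_diff t i"
proof -
  have 1: "d 3 * (1 - t) = t * d 1 - 1" and 2: "d 2 * (t * (t - 1)) = t * d 1 - t"
    using assms(3,4) unfolding sum_3 by (simp_all, algebra+)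
  have "\<forall>i. d i * pole_diff t i = t * d 1 - pole t i"
    unfolding forall_3 using 1 2 by simp
  then show ?thesis using t by (simp add: eq_divide_eq)
qed

lemma interpolation_line_sums:
  assumes t: "t \<noteq> 0" "t \<noteq> 1"
  shows "(\<Sum>i\<in>UNIV. (y - pole t i) / pole_diff t i) = 0"
    "(\<Sum>i\<in>UNIV. (t - pole t i) * ((y - pole t i) / pole_diff t i)) = 1"
  unfolding sum_3 using assms by (simp_all add: divide_simps, algebra+)

text \<open>The two linear forms are independent because the points y - a_i are distinct, so their
  common kernel is spanned by the vector with entries (y - a_i)/P'(a_i).\<close>

lemma kernel_line:
  fixes v :: "3 \<Rightarrow> complex"
  assumes t: "t \<noteq> 0" "t \<noteq> 1" and y: "\<forall>i. y \<noteq> pole t i"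
    and "(\<Sum>i\<in>UNIV. v i) = 0" "(\<Sum>i\<in>UNIV. v i / (y - pole t i)) = 0"
  obtains s where "\<And>i. v i = s * ((y - pole t i) / pole_diff t i)"
proof -
  have y': "y \<noteq> 0" "y - t \<noteq> 0" "y - 1 \<noteq> 0" using y by (simp_all add: not_pole_iff)
  have a: "v 1 + v 2 + v 3 = 0" using assms(4) by (simp add: sum_3)
  have "v 1 / y + v 2 / (y - t) + v 3 / (y - 1) = 0" using assms(5) by (simp add: sum_3)
  then have b: "v 1 * (y - t) * (y - 1) + v 2 * y * (y - 1) + v 3 * y * (y - t) = 0"
    using y' by (simp add: divide_simps) algebra
  have c: "v 1 * t * (y - 1) = v 3 * (1 - t) * y" using a b by algebra
  have d: "v 1 * t * (y - t) = v 2 * (t * (t - 1)) * y" using a b by algebra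
  let ?s = "v 1 * t / y"
  have "\<forall>i. v i = ?s * ((y - pole t i) / pole_diff t i)"
    unfolding forall_3 using c d y' t by (simp add: divide_simps)
  then show ?thesis using that by blast
qed

text \<open>As the mu_i are distinct, theta_4, delta and delta - theta_4 are nonzero and the systems for
  z, u and c are solvable. As the mu_i are nonzero, the first and third columns of B do not vanish and
  diag mu is invertible.\<close>

locale generic_params =
  fixes lam mu :: "complex^3"
  assumes params: "(lam, mu) \<in> param_space"
    and mu_nonzero: "mu $ 1 \<noteq> 0" "mu $ 2 \<noteq> 0" "mu $ 3 \<noteq> 0"
    and mu_distinct: "mu $ 1 \<noteq> mu $ 2" "mu $ 1 \<noteq> mu $ 3" "mu $ 2 \<noteq> mu $ 3"
begin

abbreviation th :: "3 \<Rightarrow> complex" where "th \<equiv> theta lam mu"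
abbreviation th4 :: complex where "th4 \<equiv> theta4 mu"
abbreviation dl :: complex where "dl \<equiv> delta lam mu"

lemma dl_eq: "dl = mu $ 3 - mu $ 1"
  using params by (rule delta_eq)

lemma dl_nonzero: "dl \<noteq> 0"
  using mu_distinct by (simp add: dl_eq)

lemma th4_nonzero: "th4 \<noteq> 0"
  using mu_distinct by (simp add: theta4_def)

lemma sum_th: "(\<Sum>i\<in>UNIV. th i) = 2 * dl - th4"
  by (simp add: delta_def field_simps)

lemma mu21: "dl - th4 = mu $ 2 - mu $ 1"
  by (simp add: dl_eq theta4_def)

lemma mu21_nonzero: "dl - th4 \<noteq> 0"
  using mu_distinct by (simp add: mu21)

text \<open>The number p of the theorem.\<close>

definition pp :: "complex \<Rightarrow> complex \<Rightarrow> complex \<Rightarrow> complex" where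
  "pp t x y = x + (\<Sum>i\<in>UNIV. th i / (y - pole t i))"

text \<open>Coordinate of z on the line cut out by the two linear equations. The quadratic equation has
  no term of degree two in it, because p_i adds up to 0, and its linear coefficient is -
  theta_4.\<close>

definition shift :: "complex \<Rightarrow> complex \<Rightarrow> complex \<Rightarrow> complex" where
  "shift t x y = (x^2 * cubic t y + dl^2 * (3 * y - 1 - t)
     + x * cubic t y * (\<Sum>i\<in>UNIV. th i / (y - pole t i))
     - dl * (\<Sum>i\<in>UNIV. th i * (y - pole t i))) / th4"

text \<open>The solution z_i of the system.\<close>

definition zz :: "complex \<Rightarrow> complex \<Rightarrow> complex \<Rightarrow> 3 \<Rightarrow>
    complex" where
  "zz t x y i = (x * cubic t y - dl * (y - pole t i)^2 + shift t x y * (y - pole t i)) / pole_diff t i"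

text \<open>The products u_i z_i.\<close>

definition pr :: "complex \<Rightarrow> complex \<Rightarrow> 3 \<Rightarrow> complex" where
  "pr t y i = (y - pole t i) / pole_diff t i"

text \<open>The quotients w_i / z_i.\<close>

definition rr :: "complex \<Rightarrow> complex \<Rightarrow> complex \<Rightarrow> 3 \<Rightarrow>
    complex" where
  "rr t x y i = (zz t x y i + th i) / pr t y i"

lemma pr_nonzero: "t \<noteq> 0 \<Longrightarrow> t \<noteq> 1 \<Longrightarrow>
    \<forall>i. y \<noteq> pole t i \<Longrightarrow> pr t y i \<noteq> 0"
  by (simp add: pr_def)

lemma sum_pr: "t \<noteq> 0 \<Longrightarrow> t \<noteq> 1 \<Longrightarrow> (\<Sum>i\<in>UNIV. pr t y i) = 0"
  using sum_lin_pole_diff by (simp add: pr_def)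

context
  fixes t x y :: complex
  assumes t: "t \<noteq> 0" "t \<noteq> 1" and y: "\<forall>i. y \<noteq> pole t i"
begin

lemma b_nonzero: "y - pole t i \<noteq> 0" using y by simp

lemma sum_zz: "(\<Sum>i\<in>UNIV. zz t x y i) = - dl"
proof -
  have "(\<Sum>i\<in>UNIV. zz t x y i) = x * cubic t y * (\<Sum>i\<in>UNIV. 1 / pole_diff t i)
      - dl * (\<Sum>i\<in>UNIV. (y - pole t i)^2 / pole_diff t i)
      + shift t x y * (\<Sum>i\<in>UNIV. (y - pole t i) / pole_diff t i)"
    by (simp add: zz_def sum_3 add_divide_distrib diff_divide_distrib algebra_simps del: pole_diff_values
        pole_values)
  then show ?thesis
    by (simp only: sum_inverse_pole_diff [OF t] sum_square_pole_diff [OF t] sum_lin_pole_diff [OF t]) simp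
qed

lemma sum_zz_div: "(\<Sum>i\<in>UNIV. zz t x y i / (y - pole t i)) = x"
proof -
  have "zz t x y i / (y - pole t i) = x * cubic t y * (1 / (pole_diff t i * (y - pole t i)))
      - dl * ((y - pole t i) / pole_diff t i) + shift t x y * (1 / pole_diff t i)" for i
  proof -
    define b e where "b = y - pole t i" and "e = pole_diff t i"
    have "b \<noteq> 0" "e \<noteq> 0" using b_nonzero [of i] pole_diff_nonzero [OF t, of i]
        by (simp_all add: b_def e_def)
    then show ?thesis unfolding zz_def b_def [symmetric] e_def [symmetric]
      by (simp add: field_simps power2_eq_square)
  qed
  then have "(\<Sum>i\<in>UNIV. zz t x y i / (y - pole t i)) =
     x * cubic t y * (\<Sum>i\<in>UNIV. 1 / (pole_diff t i * (y - pole t i)))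
      - dl * (\<Sum>i\<in>UNIV. (y - pole t i) / pole_diff t i)
      + shift t x y * (\<Sum>i\<in>UNIV. 1 / pole_diff t i)"
    by (simp add: sum.distrib sum_subtractf sum_distrib_left)
  then show ?thesis
    using cubic_nonzero [OF y]
    by (simp only: sum_inverse_pole_diff [OF t] partial_fractions_one [OF t y] sum_lin_pole_diff [OF t]) simp
qed

text \<open>This is the equation that w adds up to 0. It fixes the coordinate of z on its line.\<close>

lemma sum_zz_rr: "(\<Sum>i\<in>UNIV. zz t x y i * rr t x y i) = 0"
proof -
  let ?P = "cubic t y" let ?s = "shift t x y"
  have "zz t x y i * rr t x y i = x^2 * ?P^2 * (1 / (pole_diff t i * (y - pole t i)))
      - 2 * x * ?P * dl * ((y - pole t i) / pole_diff t i)
      + dl^2 * ((y - pole t i)^3 / pole_diff t i) + 2 * ?s * x * ?P * (1 / pole_diff t i)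
      - 2 * ?s * dl * ((y - pole t i)^2 / pole_diff t i)
      + ?s^2 * ((y - pole t i) / pole_diff t i)
      + x * ?P * (th i / (y - pole t i)) - dl * (th i * (y - pole t i)) + ?s * th i" for i
  proof -
    define b e where "b = y - pole t i" and "e = pole_diff t i"
    have "b \<noteq> 0" "e \<noteq> 0" using b_nonzero [of i] pole_diff_nonzero [OF t, of i]
        by (simp_all add: b_def e_def)
    then show ?thesis unfolding zz_def rr_def pr_def b_def [symmetric] e_def [symmetric]
      by (simp add: field_simps power2_eq_square power3_eq_cube)
  qed
  then have "(\<Sum>i\<in>UNIV. zz t x y i * rr t x y i) =
      x^2 * ?P^2 * (\<Sum>i\<in>UNIV. 1 / (pole_diff t i * (y - pole t i)))
      - 2 * x * ?P * dl * (\<Sum>i\<in>UNIV. (y - pole t i) / pole_diff t i)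
      + dl^2 * (\<Sum>i\<in>UNIV. (y - pole t i)^3 / pole_diff t i)
      + 2 * ?s * x * ?P * (\<Sum>i\<in>UNIV. 1 / pole_diff t i)
      - 2 * ?s * dl * (\<Sum>i\<in>UNIV. (y - pole t i)^2 / pole_diff t i)
      + ?s^2 * (\<Sum>i\<in>UNIV. (y - pole t i) / pole_diff t i)
      + x * ?P * (\<Sum>i\<in>UNIV. th i / (y - pole t i))
      - dl * (\<Sum>i\<in>UNIV. th i * (y - pole t i)) + ?s * (\<Sum>i\<in>UNIV. th i)"
    by (simp add: sum.distrib sum_subtractf sum_distrib_left)
  also have "\<dots> = x^2 * ?P + dl^2 * (3 * y - 1 - t)
      + x * ?P * (\<Sum>i\<in>UNIV. th i / (y - pole t i))
      - dl * (\<Sum>i\<in>UNIV. th i * (y - pole t i)) - ?s * th4"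
    using cubic_nonzero [OF y]
    by (simp only: sum_inverse_pole_diff [OF t] partial_fractions_one [OF t y] sum_lin_pole_diff [OF t]
       sum_square_pole_diff [OF t] sum_cube_pole_diff [OF t] sum_th)
      (simp add: power2_eq_square algebra_simps)
  also have "\<dots> = 0"
    using th4_nonzero by (simp add: shift_def)
  finally show ?thesis .
qed

lemma sum_zz_th: "(\<Sum>i\<in>UNIV. 2 * zz t x y i + th i) = - th4"
  by (simp add: sum.distrib sum_distrib_left [symmetric] sum_zz sum_th)

text \<open>Two solutions of the linear equations differ by a multiple of p, and along this direction
  the quadratic equation is affine with slope - theta_4.\<close>

lemma zz_unique:
  assumes "(\<Sum>i\<in>UNIV. z i) = - dl" "(\<Sum>i\<in>UNIV. z i / (y - pole t i)) = x"
    "(\<Sum>i\<in>UNIV. z i * ((z i + th i) / pr t y i)) = 0"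
  shows "z i = zz t x y i"
proof -
  define v where "v i = z i - zz t x y i" for i
  have "(\<Sum>i\<in>UNIV. v i) = 0" "(\<Sum>i\<in>UNIV. v i / (y - pole t i)) = 0"
    using assms(1,2) sum_zz sum_zz_div
    by (simp_all add: v_def sum_subtractf diff_divide_distrib)
  then obtain s where s: "\<And>i. v i = s * pr t y i"
    using kernel_line [OF t y] unfolding pr_def by blast
  have "z i * ((z i + th i) / pr t y i) = zz t x y i * rr t x y i
     + s * (2 * zz t x y i + th i) + s^2 * pr t y i" for i
  proof -
    have "z i = zz t x y i + s * pr t y i" using s [of i] by (simp add: v_def algebra_simps)
    then show ?thesis using pr_nonzero [OF t y, of i]
      by (simp add: rr_def field_simps power2_eq_square)
  qed
  then have "(\<Sum>i\<in>UNIV. z i * ((z i + th i) / pr t y i)) =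
     (\<Sum>i\<in>UNIV. zz t x y i * rr t x y i) + s * (\<Sum>i\<in>UNIV. 2 * zz t x y i + th i)
     + s^2 * (\<Sum>i\<in>UNIV. pr t y i)"
    unfolding sum_distrib_left sum.distrib [symmetric] by (intro sum.cong) simp_all
  then have "s = 0" 
    unfolding assms(3) sum_zz_rr sum_zz_th sum_pr [OF t] using th4_nonzero by simp
  then show ?thesis using s [of i] by (simp add: v_def)
qed

lemma sum_pr_rr: "(\<Sum>i\<in>UNIV. pr t y i * rr t x y i) = dl - th4"
proof -
  have "(\<Sum>i\<in>UNIV. pr t y i * rr t x y i) = (\<Sum>i\<in>UNIV. zz t x y i + th i)"
    using pr_nonzero [OF t y] by (simp add: rr_def)
  then show ?thesis by (simp add: sum.distrib sum_zz sum_th)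
qed

end

end

section \<open>The system for c, the dual basis and the matrices B\<close>

lemma rank_tensor:
  assumes "f \<noteq> 0" "phi \<noteq> 0"
  shows "rank (tensor f phi) = 1"
proof -
  obtain j where j: "f $ j \<noteq> 0" using assms(1) by (auto simp: vec_eq_iff)
  have row: "row i (tensor f phi) = f $ i *s phi" for i
    by (simp add: row_def tensor_def vec_eq_iff)
  have "phi = (1 / f $ j) *s row j (tensor f phi)"
    using j unfolding row by (simp add: vec_eq_iff)
  then have "phi \<in> vec.span (rows (tensor f phi))"
    by (metis (mono_tags, lifting) rows_def vec.span_base vec.span_scale mem_Collect_eq UNIV_I)
  moreover have "rows (tensor f phi) \<subseteq> vec.span {phi}"
    by (auto simp: rows_def row vec.span_singleton)
  ultimately have "vec.span (rows (tensor f phi)) = vec.span {phi}"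
    by (intro antisym vec.span_minimal) (auto simp: vec.subspace_span)
  then have "vec.dim (rows (tensor f phi)) = vec.dim {phi}"
    by (metis vec.dim_span)
  then show ?thesis
    using assms(2) by (simp add: row_rank_def_gen)
qed

text \<open>In a matrix of rank one, a nonzero row spans all rows.\<close>

lemma rank_one_proportional:
  fixes A :: "complex^3^3"
  assumes "rank A = 1" "A $ r $ s \<noteq> 0"
  shows "A $ j $ k = A $ j $ s / A $ r $ s * A $ r $ k"
proof -
  have "row r A \<noteq> 0" using assms(2) by (auto simp: row_def vec_eq_iff)
  moreover have sub: "{row r A} \<subseteq> rows A" by (auto simp: rows_def)
  ultimately have "rows A \<subseteq> vec.span {row r A}"
    using assms(1)
    by (intro vec.card_ge_dim_independent) (auto simp: row_rank_def_gen vec.dependent_single)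
  moreover have "row j A \<in> rows A" by (auto simp: rows_def)
  ultimately obtain c where "row j A = c *s row r A"
    by (auto simp: vec.span_singleton)
  then have "A $ j $ k' = c * A $ r $ k'" for k' by (simp add: row_def vec_eq_iff)
  then show ?thesis using assms(2) by simp
qed

lemma pairing_matrix:
  "pairing (G $ i) (column j F) = (G ** F) $ i $ j"
  by (simp add: pairing_def matrix_matrix_mult_def column_def)

lemma dual_basis_eq:
  assumes "\<And>i j. pairing (g i) (f j) = (if i = j then 1 else 0)"
  shows "dual_basis f = g"
  unfolding dual_basis_def
proof (rule the_equality)
  show "\<forall>i j. pairing (g i) (f j) = (if i = j then 1 else 0)" using assms by blast
next
  fix h assume h: "\<forall>i j. pairing (h i) (f j) = (if i = j then 1 else 0)"
  define F :: "complex^3^3" where "F = (\<chi> k j. f j $ k)"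
  have F: "column j F = f j" for j by (simp add: F_def column_def vec_eq_iff)
  have "(\<chi> i. g i) ** F = mat 1" "(\<chi> i. h i) ** F = mat 1"
    using assms h by (simp_all add: vec_eq_iff pairing_matrix [symmetric] F mat_def)
  then have "(\<chi> i. g i) = (\<chi> i. h i)"
    by (metis matrix_left_right_inverse matrix_mul_assoc matrix_mul_lid matrix_mul_rid)
  then show "h = g" by (metis (no_types, lifting) ext vec_lambda_beta)
qed

lemma pairing_scale: "pairing (a *s phi) (b *s v) = a * b * pairing phi v"
  by (simp add: pairing_def sum_3 algebra_simps)

lemma pairing_sum_right: "finite S \<Longrightarrow> pairing phi (\<Sum>v\<in>S. u v *s v)
    = (\<Sum>v\<in>S. u v * pairing phi v)"
  by (induction rule: finite_induct)
    (simp_all add: pairing_def sum_3 algebra_simps)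

lemma independent_if_dual:
  fixes f :: "3 \<Rightarrow> complex^3"
  assumes "\<And>i j. pairing (g i) (f j) = (if i = j then 1 else 0)"
  shows "inj f" "vec.independent (range f)"
proof -
  show "inj f"
    by (metis (no_types, lifting) assms injI zero_neq_one)
  have "u (f i) = 0" if "(\<Sum>v\<in>range f. u v *s v) = 0" for u i
  proof -
    have fin: "finite (range f)" by (intro finite_imageI finite_class.finite_UNIV)
    have "0 = pairing (g i) (\<Sum>v\<in>range f. u v *s v)" using that by (simp add: pairing_def)
    also have "\<dots> = (\<Sum>v\<in>range f. u v * pairing (g i) v)" by (rule pairing_sum_right [OF fin])
    also have "\<dots> = (\<Sum>j\<in>UNIV. u (f j) * (if i = j then 1 else 0))"
      by (simp add: sum.reindex [OF \<open>inj f\<close>] assms)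
    also have "\<dots> = u (f i)" by (simp add: if_distrib cong: if_cong)
    finally show ?thesis by simp
  qed
  then show "vec.independent (range f)"
    by (auto simp: vec.dependent_finite [OF finite_imageI])
qed

lemma B_tilde_entry:
  "B_tilde t B z $ j $ k =
     (z - t) * (z - 1) * B 1 $ j $ k + z * (z - 1) * B 2 $ j $ k + z * (z - t) * B 3 $ j $ k"
proof -
  have "UNIV - {1::3} = {2, 3}" "UNIV - {2::3} = {1, 3}" "UNIV - {3::3} = {1, 2}"
    unfolding UNIV_3 by auto
  then show ?thesis by (simp add: B_tilde_def sum_3 mat_scale_def)
qed

text \<open>If an entry of the residues is proportional to (y - a_i)/P'(a_i), then its rational function
  is proportional to (y - z)/P(z) by Lagrange interpolation, so that y is the zero of this
  entry.\<close>

lemma B_tilde_tensor_entry: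
  assumes "t \<noteq> 0" "t \<noteq> 1" "\<And>i. B i $ j $ k = c * ((y - pole t i) / pole_diff t i)"
  shows "B_tilde t B z $ j $ k = c * (y - z)"
  unfolding B_tilde_entry assms(3) using assms(1,2) by (simp add: divide_simps) algebra

context generic_params
begin

text \<open>The zero of the entry (1,3) of B_tilde; it parametrizes the solutions of the first and third
  equations for c.\<close>

definition yy :: "complex \<Rightarrow> complex \<Rightarrow> complex \<Rightarrow> complex" where
  "yy t x y = y - (dl - th4) / pp t x y"

text \<open>The products c_i z_i.\<close>

definition qq :: "complex \<Rightarrow> complex \<Rightarrow> complex \<Rightarrow> 3 \<Rightarrow>
    complex" where
  "qq t x y i = (yy t x y - pole t i) / pole_diff t i"

text \<open>The first column of the inverse of F. It has to be orthogonal to the rows p and z; the first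
  condition holds for 1/(y - a_i) and for constants, the second one selects their combination.\<close>

definition g1 :: "complex \<Rightarrow> complex \<Rightarrow> complex \<Rightarrow> 3 \<Rightarrow>
    complex" where
  "g1 t x y i = - (cubic t y * pp t x y / (dl - th4)) * (1 / (y - pole t i) + x / dl)"

text \<open>The columns are z_i f_i.\<close>

definition Fmat :: "complex \<Rightarrow> complex \<Rightarrow> complex \<Rightarrow> complex^3^3" where
  "Fmat t x y = (\<chi> j i. vector [qq t x y i, pr t y i, zz t x y i] $ j)"

text \<open>The rows are the dual basis of f divided by z_i.\<close>

definition Gmat :: "complex \<Rightarrow> complex \<Rightarrow> complex \<Rightarrow> complex^3^3" where
  "Gmat t x y = (\<chi> i. vector [g1 t x y i, rr t x y i / (dl - th4), - 1 / dl])"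

text \<open>Admissibility in terms of the closed formulas.\<close>

definition regular :: "complex \<Rightarrow> complex \<Rightarrow> complex \<Rightarrow> bool" where
  "regular t x y \<longleftrightarrow> (\<forall>i. y \<noteq> pole t i) \<and>
      (\<forall>i. zz t x y i \<noteq> 0) \<and> pp t x y \<noteq> 0"

context
  fixes t x y :: complex
  assumes t: "t \<noteq> 0" "t \<noteq> 1"
begin

lemma zu_system_iff:
  "zu_system lam mu t x y z u \<longleftrightarrow>
    (\<forall>i. y \<noteq> pole t i) \<and> (\<forall>i. zz t x y i \<noteq> 0) \<and>
    z = (\<chi> i. zz t x y i) \<and> u = (\<chi> i. pr t y i / zz t x y i)" (is "?L \<longleftrightarrow> ?R")
proof
  assume L: ?L
  then have y: "\<forall>i. y \<noteq> pole t i" and u: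
      "\<And>i. u $ i \<noteq> 0" by (auto simp: zu_system_def)
  have "u $ i * z $ i = (t * (u $ 1 * z $ 1) - pole t i) / pole_diff t i" for i
    by (rule interpolation_line [OF t, of "\<lambda>i. u $ i * z $ i"])
      (use L in \<open>simp_all add: zu_system_def mult.assoc\<close>)
  moreover have "t * (u $ 1 * z $ 1) = y" using L by (simp add: zu_system_def)
  ultimately have uz: "u $ i * z $ i = pr t y i" for i by (simp add: pr_def)
  have z: "z $ i \<noteq> 0" for i using uz [of i] pr_nonzero [OF t y, of i] by auto
  have u_eq: "u $ i = pr t y i / z $ i" for i using uz [of i] z [of i] by (simp add: field_simps)
  have zz: "z $ i = zz t x y i" for i
  proof (rule zz_unique [OF t y])
    show "(\<Sum>i\<in>UNIV. z $ i) = - dl" using L by (simp add: zu_system_def dl_eq)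
    show "(\<Sum>i\<in>UNIV. z $ i / (y - pole t i)) = x" using L by (simp add: zu_system_def)
    have "w_of lam mu z u $ i = z $ i * ((z $ i + th i) / pr t y i)" for i
      using z [of i] by (simp add: w_of_def u_eq)
    moreover have "(\<Sum>i\<in>UNIV. w_of lam mu z u $ i) = 0" using L unfolding zu_system_def by blast
    ultimately show "(\<Sum>i\<in>UNIV. z $ i * ((z $ i + th i) / pr t y i)) = 0" by simp
  qed
  show ?R using y z u_eq by (auto simp: zz vec_eq_iff)
next
  assume R: ?R
  then have y: "\<forall>i. y \<noteq> pole t i" and z: "\<And>i. zz t x y i \<noteq> 0" by auto
  have uz: "u $ i * z $ i = pr t y i" for i using R z by simp
  have "w_of lam mu z u $ i = zz t x y i * rr t x y i" for i
    using R z by (simp add: w_of_def rr_def)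
  then have "(\<Sum>i\<in>UNIV. w_of lam mu z u $ i) = 0" "(\<Sum>i\<in>UNIV. u $ i * z $ i) = 0"
    by (simp_all only: uz sum_zz_rr [OF t y] sum_pr [OF t])
  moreover have "u $ i \<noteq> 0" "y \<noteq> pole t i" for i using R z pr_nonzero [OF t y] y by simp_all
  moreover have "(\<Sum>i\<in>UNIV. (t - pole t i) * u $ i * z $ i) = 1"
    using interpolation_line_sums(2) [OF t] by (simp add: mult.assoc uz pr_def)
  moreover have "y = t * u $ 1 * z $ 1" using t by (simp add: mult.assoc uz pr_def)
  moreover have "(\<Sum>i\<in>UNIV. z $ i) = mu $ 1 - mu $ 3" "x = (\<Sum>i\<in>UNIV. z $ i / (y - pole t i))"
    using R sum_zz [OF t y] sum_zz_div [OF t y] by (simp_all add: dl_eq)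
  ultimately show ?L
    unfolding zu_system_def by (intro conjI allI)
qed

text \<open>On the line of solutions of the first and third equations, the second one is affine in Y
  with slope p. As its constant term mu_2 - mu_1 is nonzero, it has a solution exactly if p is
  nonzero.\<close>

lemma c_system_iff:
  assumes y: "\<forall>i. y \<noteq> pole t i" and z: "\<And>i. zz t x y i \<noteq> 0"
  shows "c_system t (\<chi> i. zz t x y i) (\<chi> i. zz t x y i * rr t x y i) c \<longleftrightarrow>
    pp t x y \<noteq> 0 \<and> c = (\<chi> i. qq t x y i / zz t x y i)" (is "?L \<longleftrightarrow> ?R")
proof -
  have rr_pole_diff: "rr t x y i / pole_diff t i = zz t x y i / (y - pole t i) + th i / (y - pole t i)" for i
    using pole_diff_nonzero [OF t, of i] by (simp add: rr_def pr_def add_divide_distrib)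
  have *: "(\<Sum>i\<in>UNIV. (Y - pole t i) / pole_diff t i * rr t x y i)
      = dl - th4 + (Y - y) * pp t x y" for Y
  proof -
    have "(Y - pole t i) / pole_diff t i * rr t x y i =
       pr t y i * rr t x y i + (Y - y) * (rr t x y i / pole_diff t i)" for i
      by (simp add: pr_def diff_divide_distrib algebra_simps)
    then have "(\<Sum>i\<in>UNIV. (Y - pole t i) / pole_diff t i * rr t x y i) =
       (\<Sum>i\<in>UNIV. pr t y i * rr t x y i) + (Y - y) * (\<Sum>i\<in>UNIV. rr t x y i / pole_diff t i)"
      by (simp add: sum.distrib sum_distrib_left)
    also have "(\<Sum>i\<in>UNIV. rr t x y i / pole_diff t i) = pp t x y"
      by (simp add: rr_pole_diff sum.distrib sum_zz_div [OF t y] pp_def)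
    finally show ?thesis by (simp add: sum_pr_rr [OF t y])
  qed
  show ?thesis
  proof
    assume L: ?L
    define Y where "Y = t * (c $ 1 * zz t x y 1)"
    have cz: "c $ i * zz t x y i = (Y - pole t i) / pole_diff t i" for i
      unfolding Y_def
      by (rule interpolation_line [OF t, of "\<lambda>i. c $ i * zz t x y i"])
        (use L in \<open>simp_all add: c_system_def mult.assoc\<close>)
    have "(\<Sum>i\<in>UNIV. (Y - pole t i) / pole_diff t i * rr t x y i) = 0"
      using L by (simp add: c_system_def cz [symmetric] mult.assoc)
    then have Y: "dl - th4 + (Y - y) * pp t x y = 0" unfolding * .
    then have p: "pp t x y \<noteq> 0" using mu21_nonzero by auto
    then have "Y = yy t x y" using Y by (simp add: yy_def field_simps)
    then have "c $ i = qq t x y i / zz t x y i" for i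
      by (simp only: qq_def nonzero_eq_divide_eq [OF z] cz)
    then show ?R using p by (simp add: vec_eq_iff)
  next
    assume R: ?R
    then have "c $ i = qq t x y i / zz t x y i" for i by simp
    then have cz: "c $ i * zz t x y i = (yy t x y - pole t i) / pole_diff t i" for i
      using z [of i] by (simp only: qq_def nonzero_eq_divide_eq [OF z])
    have "dl - th4 + (yy t x y - y) * pp t x y = 0"
      using R by (simp add: yy_def)
    moreover have "c $ i * (zz t x y i * r) = (yy t x y - pole t i) / pole_diff t i * r"
      "s * c $ i * zz t x y i = s * ((yy t x y - pole t i) / pole_diff t i)" for i r s
      by (simp_all only: cz [symmetric] mult.assoc)
    ultimately show ?L
      using interpolation_line_sums [OF t, of "yy t x y"]
      by (simp only: c_system_def vec_lambda_beta cz *)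
  qed
qed

lemma sols:
  assumes y: "\<forall>i. y \<noteq> pole t i" and z: "\<And>i. zz t x y i \<noteq> 0"
  shows "z_sol lam mu t x y = (\<chi> i. zz t x y i)"
    "u_sol lam mu t x y = (\<chi> i. pr t y i / zz t x y i)"
    "w_sol lam mu t x y = (\<chi> i. zz t x y i * rr t x y i)"
proof -
  have "zu_sol lam mu t x y = (\<chi> i. zz t x y i, \<chi> i. pr t y i / zz t x y i)"
    unfolding zu_sol_def
  proof (rule the_equality)
    show "case (\<chi> i. zz t x y i, \<chi> i. pr t y i / zz t x y i) of
        (z, u) \<Rightarrow> zu_system lam mu t x y z u"
      unfolding prod.case zu_system_iff using y z by blast
    fix zu assume "case zu of (z, u) \<Rightarrow> zu_system lam mu t x y z u"
    then show "zu = (\<chi> i. zz t x y i, \<chi> i. pr t y i / zz t x y i)"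
      by (cases zu) (simp only: prod.case zu_system_iff prod.inject)
  qed
  then show *: "z_sol lam mu t x y = (\<chi> i. zz t x y i)"
    "u_sol lam mu t x y = (\<chi> i. pr t y i / zz t x y i)"
    by (simp_all add: z_sol_def u_sol_def)
  show "w_sol lam mu t x y = (\<chi> i. zz t x y i * rr t x y i)"
    unfolding w_sol_def * using z by (simp add: w_of_def rr_def vec_eq_iff)
qed

context
  assumes regular: "regular t x y"
begin

lemma y_not_pole: "\<forall>i. y \<noteq> pole t i" and zz_nonzero:
    "zz t x y i \<noteq> 0" and pp_nonzero: "pp t x y \<noteq> 0"
  using regular by (auto simp: regular_def)

lemma f_vec_eq: "f_vec lam mu t x y i = (1 / zz t x y i) *s column i (Fmat t x y)"
proof -
  have "c_sol lam mu t x y = (\<chi> i. qq t x y i / zz t x y i)"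
    unfolding c_sol_def sols [OF y_not_pole zz_nonzero]
    by (rule the_equality) (use pp_nonzero in \<open>auto simp: c_system_iff [OF y_not_pole zz_nonzero]\<close>)
  then show ?thesis
    using zz_nonzero [of i]
    by (simp add: f_vec_def sols [OF y_not_pole zz_nonzero] Fmat_def column_def vec_eq_iff [of
        "vector _"] forall_3)
qed

text \<open>By partial fractions. The row p is orthogonal to the first column of G because Y = y is the
  zero of the corresponding sum, and the value 1 in the corner is the definition of Y.\<close>

lemma Fmat_Gmat: "Fmat t x y ** Gmat t x y = mat 1"
proof -
  note y = y_not_pole
  let ?k = "- (cubic t y * pp t x y / (dl - th4))"
  have pz: "(\<Sum>i\<in>UNIV. pr t y i / (y - pole t i)) = 0"
    using partial_fractions [OF t y, of y] by (simp only: pr_def divide_divide_eq_left diff_self div_0)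
  have qz: "(\<Sum>i\<in>UNIV. qq t x y i / (y - pole t i)) = (yy t x y - y) / cubic t y"
    using partial_fractions [OF t y, of "yy t x y"] by (simp only: qq_def divide_divide_eq_left)
  have q0: "(\<Sum>i\<in>UNIV. qq t x y i) = 0"
    using sum_lin_pole_diff [OF t, of "yy t x y"] by (simp add: qq_def)
  have g1: "(\<Sum>i\<in>UNIV. v i * g1 t x y i) =
      ?k * ((\<Sum>i\<in>UNIV. v i / (y - pole t i)) + x / dl * (\<Sum>i\<in>UNIV. v i))" for v
    unfolding sum_distrib_left sum.distrib [symmetric] g1_def
    by (rule sum.cong) (simp_all add: algebra_simps)
  have 1: "(\<Sum>i\<in>UNIV. qq t x y i * g1 t x y i) = 1"
    unfolding g1 qz q0 using cubic_nonzero [OF y] mu21_nonzero pp_nonzero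
    by (simp add: yy_def)
  have 2: "(\<Sum>i\<in>UNIV. pr t y i * g1 t x y i) = 0"
    unfolding g1 pz sum_pr [OF t] by simp
  have 3: "(\<Sum>i\<in>UNIV. zz t x y i * g1 t x y i) = 0"
    unfolding g1 sum_zz [OF t y] sum_zz_div [OF t y] using dl_nonzero by simp
  have "c_system t (\<chi> i. zz t x y i) (\<chi> i. zz t x y i * rr t x y i)
      (\<chi> i. qq t x y i / zz t x y i)"
    using c_system_iff [OF y_not_pole zz_nonzero] pp_nonzero by blast
  then have 4: "(\<Sum>i\<in>UNIV. qq t x y i * rr t x y i) = 0"
    using zz_nonzero by (simp add: c_system_def)
  note sums = 1 2 3 4 q0 sum_pr [OF t] sum_pr_rr [OF t y] sum_zz [OF t y] sum_zz_rr [OF t y]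
  have "(\<Sum>i\<in>UNIV. v i * (a i / b)) = (\<Sum>i\<in>UNIV. v i * a i) / b" for v a ::
      "3 \<Rightarrow> complex" and b
    by (simp add: sum_divide_distrib)
  then show ?thesis
    using sums mu21_nonzero dl_nonzero
    by (simp add: vec_eq_iff forall_3 Fmat_def Gmat_def matrix_matrix_mult_def mat_def
      sum_divide_distrib [symmetric] sum_negf)
qed

lemma Gmat_Fmat: "Gmat t x y ** Fmat t x y = mat 1"
  using Fmat_Gmat matrix_left_right_inverse by blast

lemma f_vec_dual:
  "pairing (zz t x y i *s Gmat t x y $ i) (f_vec lam mu t x y j) = (if i = j then 1 else 0)"
proof -
  have "pairing (Gmat t x y $ i) (column j (Fmat t x y)) = (if i = j then 1 else 0)"
    by (simp add: pairing_matrix Gmat_Fmat mat_def)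
  then show ?thesis
    using zz_nonzero [of j] by (simp add: f_vec_eq pairing_scale)
qed

text \<open>The vector beta_i is the i-th row of G, times z_i, times diag mu - mu_1: this is visible in
  the second and third entries of the row, with mu_2 - mu_1 = delta - theta_4 and mu_3 - mu_1 =
  delta.\<close>

lemma B_mat_eq:
  "B_mat lam mu t x y i = tensor (column i (Fmat t x y)) (\<chi> k. Gmat t x y $ i $ k * mu $ k)"
proof -
  have "dual_basis (f_vec lam mu t x y) = (\<lambda>i. zz t x y i *s Gmat t x y $ i)"
    by (rule dual_basis_eq) (rule f_vec_dual)
  moreover have "z * r + mu $ 1 * (z * (r / (dl - th4))) = z * (r / (dl - th4) * mu $ 2)" for z r
    using mu21_nonzero unfolding mu21 by (simp add: field_simps)
  moreover have "- z + mu $ 1 * (z * (- 1 / dl)) = z * (- 1 / dl * mu $ 3)" for z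
    using dl_nonzero unfolding dl_eq by (simp add: field_simps)
  ultimately have "beta_vec lam mu t x y i + mu $ 1 *s dual_basis (f_vec lam mu t x y) i
     = zz t x y i *s (\<chi> k. Gmat t x y $ i $ k * mu $ k)"
    by (simp add: beta_vec_def sols [OF y_not_pole zz_nonzero] vec_eq_iff forall_3 Gmat_def mult.assoc
        del: times_divide_eq_left times_divide_eq_right)
  then show ?thesis
    using zz_nonzero [of i]
    by (simp add: B_mat_def f_vec_eq tensor_def vec_eq_iff)
qed

lemma regular_imp_admissible: "admissible lam mu t x y"
  unfolding admissible_def
proof (intro conjI)
  have "zu_system lam mu t x y z u \<longleftrightarrow> (z, u)
      = (\<chi> i. zz t x y i, \<chi> i. pr t y i / zz t x y i)" for z u
    using y_not_pole zz_nonzero unfolding zu_system_iff prod.inject by blast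
  then show "\<exists>!(z, u). zu_system lam mu t x y z u"
    by (simp only: case_prod_unfold prod.collapse) blast
  show "\<exists>!c. c_system t (z_sol lam mu t x y) (w_sol lam mu t x y) c"
    using pp_nonzero by (simp add: sols [OF y_not_pole zz_nonzero] c_system_iff [OF y_not_pole zz_nonzero])
  show "inj (f_vec lam mu t x y)" "vec.independent (range (f_vec lam mu t x y))"
    using f_vec_dual by (rule independent_if_dual)+
qed

end

lemma admissible_iff: "admissible lam mu t x y \<longleftrightarrow> regular t x y"
proof
  assume L: "admissible lam mu t x y"
  then have "\<exists>p. case p of (z, u) \<Rightarrow> zu_system lam mu t x y z u"
    unfolding admissible_def by (blast dest: ex1_implies_ex)
  then obtain z u where "zu_system lam mu t x y z u" by auto
  then have y: "\<forall>i. y \<noteq> pole t i" and z: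
      "\<And>i. zz t x y i \<noteq> 0" unfolding zu_system_iff by auto
  moreover obtain c where "c_system t (z_sol lam mu t x y) (w_sol lam mu t x y) c"
    using L unfolding admissible_def by (blast dest: ex1_implies_ex)
  then have "pp t x y \<noteq> 0" unfolding sols [OF y z] c_system_iff [OF y z] by simp
  ultimately show "regular t x y" by (simp add: regular_def)
qed (rule regular_imp_admissible)

end

end

section \<open>Entries of B and generic points of the plane\<close>

lemma sum_tensor_columns:
  fixes F G :: "complex^3^3"
  shows "(\<Sum>i\<in>UNIV. tensor (column i F) (\<chi> k. G $ i $ k * d $ k)) = F ** G ** diag d"
proof -
  have "(F ** G ** diag d) $ j $ k = (F ** G) $ j $ k * d $ k" for j k
    unfolding matrix_matrix_mult_def [of "F ** G"] diag_def
    by (simp add: if_distrib cong: if_cong)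
  then show ?thesis
    by (simp add: vec_eq_iff tensor_def column_def matrix_matrix_mult_def sum_3 algebra_simps)
qed

context generic_params
begin

context
  fixes t x y :: complex
  assumes t: "t \<noteq> 0" "t \<noteq> 1" and regular: "regular t x y"
begin

lemma B_entry: "B_mat lam mu t x y i $ j $ k = Fmat t x y $ j $ i * Gmat t x y $ i $ k * mu $ k"
  by (simp add: B_mat_eq [OF t regular] tensor_def column_def)

lemma B_entry_3:
  "B_mat lam mu t x y i $ 1 $ 3 = - (mu $ 3 / dl) * qq t x y i"
  "B_mat lam mu t x y i $ 2 $ 3 = - (mu $ 3 / dl) * pr t y i"
  "B_mat lam mu t x y i $ 3 $ 3 = - (mu $ 3 / dl) * zz t x y i"
  by (simp_all add: B_entry Fmat_def Gmat_def)

lemma B_sum: "(\<Sum>i\<in>UNIV. B_mat lam mu t x y i) = diag mu"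
  unfolding B_mat_eq [OF t regular] sum_tensor_columns Fmat_Gmat [OF t regular]
  by (simp add: matrix_mul_lid)

lemma B_rank: "rank (B_mat lam mu t x y i) = 1"
  unfolding B_mat_eq [OF t regular]
proof (rule rank_tensor)
  show "column i (Fmat t x y) \<noteq> 0"
    using zz_nonzero [OF t regular, of i]
    by (auto simp: vec_eq_iff column_def Fmat_def forall_3)
  show "(\<chi> k. Gmat t x y $ i $ k * mu $ k) \<noteq> 0"
    using mu_nonzero dl_nonzero by (auto simp: vec_eq_iff Gmat_def forall_3)
qed

text \<open>The diagonal of G F = 1 eliminates the entry of index 1 from the trace.\<close>

lemma B_trace: "trace (B_mat lam mu t x y i) = lam $ i"
proof -
  note y = y_not_pole [OF t regular]
  have "(Gmat t x y ** Fmat t x y) $ i $ i = 1"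
    by (simp add: Gmat_Fmat [OF t regular] mat_def)
  then have 1: "Gmat t x y $ i $ 1 * Fmat t x y $ 1 $ i + rr t x y i / (dl - th4) * pr t y i
      - zz t x y i / dl = 1"
    by (simp add: matrix_matrix_mult_def sum_3 Gmat_def Fmat_def)
  have 2: "rr t x y i * pr t y i = zz t x y i + th i"
    using pr_nonzero [OF t y, of i] by (simp add: rr_def)
  have "trace (B_mat lam mu t x y i) = mu $ 1 * (Gmat t x y $ i $ 1 * Fmat t x y $ 1 $ i)
      + mu $ 2 * (rr t x y i / (dl - th4) * pr t y i) - mu $ 3 * (zz t x y i / dl)"
    by (simp add: trace_def sum_3 B_entry Fmat_def Gmat_def algebra_simps)
  also have "\<dots> = mu $ 1 + (mu $ 2 - mu $ 1) * (rr t x y i / (dl - th4) * pr t y i)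
      - (mu $ 3 - mu $ 1) * (zz t x y i / dl)"
    using 1 by algebra
  also have "\<dots> = mu $ 1 + rr t x y i * pr t y i - zz t x y i"
    using mu21_nonzero dl_nonzero by (simp add: mu21 [symmetric] dl_eq [symmetric])
  finally show ?thesis by (simp add: 2 theta_def)
qed

lemma B_tilde_23: "B_tilde t (B_mat lam mu t x y) z $ 2 $ 3 = - (mu $ 3 / dl) * (y - z)"
  by (rule B_tilde_tensor_entry [OF t]) (simp add: B_entry_3 pr_def)

context
  assumes x: "x \<noteq> 0"
begin

text \<open>This exhibits y + delta/x: multiplication by p_i cancels the denominator and leaves a linear
  polynomial in a_i with this zero.\<close>

lemma g1_factored:
  "g1 t x y i = - (cubic t y * pp t x y * x / (dl * (dl - th4)))
     * ((y + dl / x - pole t i) / (y - pole t i))"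
proof -
  have "y - pole t i \<noteq> 0" using y_not_pole [OF t regular] by simp
  then have "1 / (y - pole t i) + x / dl = x / dl * ((y + dl / x - pole t i) / (y - pole t i))"
    using x dl_nonzero by (simp add: field_simps)
  then show ?thesis by (simp add: g1_def mult_ac)
qed

lemma B_tilde_21:
  "B_tilde t (B_mat lam mu t x y) z $ 2 $ 1 =
     - (mu $ 1 * cubic t y * pp t x y * x / (dl * (dl - th4))) * (y + dl / x - z)"
proof (rule B_tilde_tensor_entry [OF t])
  fix i
  have "y - pole t i \<noteq> 0" using y_not_pole [OF t regular] by simp
  then show "B_mat lam mu t x y i $ 2 $ 1 =
      - (mu $ 1 * cubic t y * pp t x y * x / (dl * (dl - th4))) * ((y + dl / x - pole t i) / pole_diff t i)"
    by (simp add: B_entry Fmat_def Gmat_def g1_factored pr_def mult_ac)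
qed

lemma B_hat_33: "B_hat t (B_mat lam mu t x y) y $ 3 $ 3 = - (mu $ 3 / dl) * x"
proof -
  have "B_hat t (B_mat lam mu t x y) y $ 3 $ 3 = - (mu $ 3 / dl) * (\<Sum>i\<in>UNIV. zz t x y i / (y
      - pole t i))"
    unfolding B_hat_def sum_distrib_left by (simp add: mat_scale_def B_entry_3)
  then show ?thesis by (simp add: sum_zz_div [OF t y_not_pole [OF t regular]])
qed

lemma B_hat_11:
  assumes "\<And>i. y + dl / x \<noteq> pole t i"
  shows "B_hat t (B_mat lam mu t x y) (y + dl / x) $ 1 $ 1 = mu $ 1 * x / dl"
proof -
  note y = y_not_pole [OF t regular]
  let ?k = "- (mu $ 1 * cubic t y * pp t x y * x / (dl * (dl - th4)))"
  have "1 / (y + dl / x - pole t i) * B_mat lam mu t x y i $ 1 $ 1 = ?k * (qq t x y i / (y - pole t i))" for i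
  proof -
    have "y + dl / x - pole t i \<noteq> 0" using assms [of i] by simp
    then show ?thesis by (simp add: B_entry Fmat_def Gmat_def g1_factored)
  qed
  then have "B_hat t (B_mat lam mu t x y) (y + dl / x) $ 1 $ 1
      = ?k * (\<Sum>i\<in>UNIV. qq t x y i / (y - pole t i))"
    unfolding B_hat_def sum_distrib_left by (simp add: mat_scale_def)
  also have "(\<Sum>i\<in>UNIV. qq t x y i / (y - pole t i)) = (yy t x y - y) / cubic t y"
    using partial_fractions [OF t y, of "yy t x y"] by (simp only: qq_def divide_divide_eq_left)
  finally show ?thesis
    using cubic_nonzero [OF y] pp_nonzero [OF t regular] mu21_nonzero by (simp add: yy_def)
qed

end

end

text \<open>This and the next three functions are shift, z_i, p and the product of all conditions on (x,
  y), with denominators cleared.\<close>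

definition shift_poly :: "complex \<Rightarrow> complex \<Rightarrow> complex \<Rightarrow> complex" where
  "shift_poly t x y = x^2 * cubic t y + dl^2 * (3 * y - 1 - t)
     + x * (th 1 * ((y - t) * (y - 1)) + th 2 * (y * (y - 1)) + th 3 * (y * (y - t)))
     - dl * (\<Sum>i\<in>UNIV. th i * (y - pole t i))"

definition zz_poly :: "complex \<Rightarrow> 3 \<Rightarrow> complex \<Rightarrow> complex \<Rightarrow>
    complex" where
  "zz_poly t i x y = th4 * (x * cubic t y - dl * (y - pole t i)^2) + shift_poly t x y * (y - pole t i)"

definition pp_poly :: "complex \<Rightarrow> complex \<Rightarrow> complex \<Rightarrow> complex" where
  "pp_poly t x y = x * cubic t y
     + (th 1 * ((y - t) * (y - 1)) + th 2 * (y * (y - 1)) + th 3 * (y * (y - t)))"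

definition plane_poly :: "complex \<Rightarrow> complex \<times> complex \<Rightarrow> complex" where
  "plane_poly t = (\<lambda>p. (fst p * cubic t (snd p) * pp_poly t (fst p) (snd p))
     * (zz_poly t 1 (fst p) (snd p) * (zz_poly t 2 (fst p) (snd p) * zz_poly t 3 (fst p) (snd p)))
     * ((fst p * (snd p - pole t 1) + dl) * ((fst p * (snd p - pole t 2)
         + dl) * (fst p * (snd p - pole t 3) + dl))))"

lemma cubic_th_sum:
  assumes "\<forall>i. y \<noteq> pole t i"
  shows "cubic t y * (\<Sum>i\<in>UNIV. th i / (y - pole t i)) =
    th 1 * ((y - t) * (y - 1)) + th 2 * (y * (y - 1)) + th 3 * (y * (y - t))"
  using assms unfolding not_pole_iff sum_3 cubic_def
  by (simp add: distrib_left)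

lemma plane_poly_nonzero_iff:
  assumes t: "t \<noteq> 0" "t \<noteq> 1"
  shows "plane_poly t (x, y) \<noteq> 0 \<longleftrightarrow> regular t x y \<and> x \<noteq> 0 \<and>
      (\<forall>i. y + dl / x \<noteq> pole t i)"
proof (cases "x \<noteq> 0 \<and> (\<forall>i. y \<noteq> pole t i)")
  case True
  then have x: "x \<noteq> 0" and y: "\<forall>i. y \<noteq> pole t i" by auto
  note P = cubic_nonzero [OF y]
  have "pp_poly t x y = cubic t y * pp t x y"
    using cubic_th_sum [OF y] by (simp add: pp_poly_def pp_def algebra_simps)
  then have 1: "pp_poly t x y = 0 \<longleftrightarrow> pp t x y = 0" using P by simp
  have "shift_poly t x y = th4 * shift t x y"
    using th4_nonzero by (simp add: shift_poly_def shift_def cubic_th_sum [OF y, symmetric])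
  moreover have "pole_diff t i * zz t x y i =
      x * cubic t y - dl * (y - pole t i)^2 + shift t x y * (y - pole t i)" for i
    using pole_diff_nonzero [OF t, of i] by (simp add: zz_def)
  ultimately have "zz_poly t i x y = th4 * (pole_diff t i * zz t x y i)" for i
    by (simp only: zz_poly_def distrib_left mult.assoc)
  then have 2: "zz_poly t i x y = 0 \<longleftrightarrow> zz t x y i = 0" for i
    using th4_nonzero pole_diff_nonzero [OF t, of i] by simp
  have 3: "x * (y - pole t i) + dl = 0 \<longleftrightarrow> y + dl / x = pole t i" for i
    using x by (auto simp: field_simps)
  show ?thesis
    unfolding plane_poly_def fst_conv snd_conv mult_eq_0_iff de_Morgan_disj 1 2 3 regular_def forall_3
    using x y [unfolded forall_3] P by auto
next
  case False
  then have "x = 0 \<or> cubic t y = 0" by (auto simp: cubic_def not_pole_iff)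
  then have "plane_poly t (x, y) = 0" by (auto simp: plane_poly_def)
  then show ?thesis using False by (auto simp: regular_def)
qed

text \<open>For fixed y different from the poles, every factor is a nonzero polynomial in x.\<close>

lemma plane_poly_nontrivial:
  assumes t: "t \<noteq> 0" "t \<noteq> 1"
  shows "\<exists>x y. plane_poly t (x, y) \<noteq> 0"
proof -
  have "finite (insert t {0, 1})" by simp
  then obtain y where "y \<notin> {0, 1, t}"
    by (metis ex_new_if_finite infinite_UNIV_char_0 insert_commute)
  then have y: "\<forall>i. y \<noteq> pole t i" by (auto simp: not_pole_iff)
  note P = cubic_nonzero [OF y]
  have b: "y - pole t i \<noteq> 0" for i using y by simp
  define c where "c = th 1 * ((y - t) * (y - 1)) + th 2 * (y * (y - 1)) + th 3 * (y * (y - t))"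
  define e where "e = dl^2 * (3 * y - 1 - t) - dl * (\<Sum>i\<in>UNIV. th i * (y - pole t i))"
  let ?z = "\<lambda>i. [: e * (y - pole t i) - th4 * dl * (y - pole t i)^2,
      th4 * cubic t y + c * (y - pole t i), cubic t y * (y - pole t i) :]"
  let ?l = "\<lambda>i. [: dl, y - pole t i :]"
  define p where "p = ([: 0, cubic t y :] * [: c, cubic t y :]) * (?z 1 * (?z 2 * ?z 3)) * (?l 1 *
      (?l 2 * ?l 3))"
  have "p \<noteq> 0"
    using P b unfolding p_def by (simp only: mult_eq_0_iff pCons_eq_0_iff de_Morgan_disj) auto
  then obtain x where "poly p x \<noteq> 0"
    using poly_all_0_iff_0 by blast
  moreover have "poly p x = plane_poly t (x, y)"
    unfolding p_def plane_poly_def poly_mult fst_conv snd_conv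
    by (intro arg_cong2 [where f = "(*)"])
      (simp_all add: pp_poly_def zz_poly_def shift_poly_def c_def [symmetric] e_def, algebra+)
  ultimately show ?thesis by metis
qed

end

section \<open>Normal form of a generic triple of rank one matrices\<close>

lemma polynomial_uminus: "f \<in> polynomial_functions X \<Longrightarrow>
    (\<lambda>p. - f p) \<in> polynomial_functions X"
  using polynomial_functions.mult [OF polynomial_functions.const, of f X "-1"] by simp

lemma polynomial_diff:
  "f \<in> polynomial_functions X \<Longrightarrow> g \<in> polynomial_functions X \<Longrightarrow>
      (\<lambda>p. f p - g p) \<in> polynomial_functions X"
  using polynomial_functions.add [OF _ polynomial_uminus, of f X g] by simp

lemma polynomial_square:
  "f \<in> polynomial_functions X \<Longrightarrow> (\<lambda>p. (f p)^2) \<in> polynomial_functions X"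
  unfolding power2_eq_square by (rule polynomial_functions.mult)

lemma polynomial_sum:
  "(\<And>i. f i \<in> polynomial_functions X) \<Longrightarrow>
      (\<lambda>p. \<Sum>i\<in>(UNIV::3 set). f i p) \<in> polynomial_functions X"
  unfolding sum_3 by (intro polynomial_functions.add)

lemmas polynomial_intros =
  polynomial_functions.const polynomial_functions.add polynomial_functions.mult
  polynomial_uminus polynomial_diff polynomial_square polynomial_sum

text \<open>A single polynomial witnesses genericity: its zero locus is closed, and it is proper if the
  polynomial is nonzero somewhere.\<close>

lemma generic_inI:
  assumes "f \<in> polynomial_functions X" "s \<in> S" "f s \<noteq> 0"
      "\<And>p. p \<in> S \<Longrightarrow> f p \<noteq> 0 \<Longrightarrow> P p"
  shows "generic_in X S P"
  unfolding generic_in_def zariski_closed_in_def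
  by (rule exI [of _ "{p \<in> S. f p = 0}"], intro conjI exI [of _ "{f}"]) (use assms in auto)

lemma polynomial_fst: "fst \<in> polynomial_functions plane_coords"
  and polynomial_snd: "snd \<in> polynomial_functions plane_coords"
  by (simp_all add: plane_coords_def polynomial_functions.coord)

lemma polynomial_entry: "(\<lambda>A. A i $ j $ k) \<in> polynomial_functions triple_coords"
  by (rule polynomial_functions.coord) (auto simp: triple_coords_def)

lemma diag_mult: "(diag d ** M) $ j $ k = d $ j * M $ j $ k" "(M ** diag d) $ j $ k = M $ j $ k * d $ k"
  by (simp_all add: matrix_matrix_mult_def diag_def mult_delta_left mult_delta_right)

lemma matrix_inv_diag:
  assumes "\<And>i. d $ i \<noteq> 0"
  shows "matrix_inv (diag d) = diag (\<chi> i. 1 / d $ i)"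
proof -
  have 1: "diag d ** diag (\<chi> i. 1 / d $ i) = mat 1" "diag (\<chi> i. 1 / d $ i) ** diag d = mat 1"
    using assms by (simp_all add: vec_eq_iff diag_mult) (simp_all add: diag_def mat_def)
  then have "diag d ** matrix_inv (diag d) = mat 1"
    unfolding matrix_inv_def by (metis (mono_tags, lifting) someI_ex)
  then show ?thesis
    by (metis 1(2) matrix_mul_assoc matrix_mul_lid matrix_mul_rid)
qed

lemma conj_by_diag:
  assumes "\<And>i. d $ i \<noteq> 0"
  shows "conj_by (diag d) M $ j $ k = d $ j * M $ j $ k / d $ k"
  unfolding conj_by_def matrix_inv_diag [OF assms]
  by (simp add: diag_mult)

context generic_params
begin

text \<open>The entries of the third column of A_i become -(mu_3/delta)(q_i, p_i, z_i) in the normal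
  form. The first two factors say that z_i and p_i are nonzero, the others that the rows p and q can be
  normalized by the torus.\<close>

definition triple_poly :: "complex \<Rightarrow> (3 \<Rightarrow> complex^3^3) \<Rightarrow> complex" where
  "triple_poly t A =
     (A 1 $ 3 $ 3 * (A 2 $ 3 $ 3 * A 3 $ 3 $ 3)) * (A 1 $ 2 $ 3 * (A 2 $ 2 $ 3 * A 3 $ 2 $ 3))
     * ((\<Sum>i\<in>UNIV. (t - pole t i) * A i $ 2 $ 3) * (\<Sum>i\<in>UNIV. (t - pole t i) * A i $ 1 $ 3))"

lemma triple_poly_polynomial: "triple_poly t \<in> polynomial_functions triple_coords"
  unfolding triple_poly_def [abs_def] by (intro polynomial_intros polynomial_entry)

lemma plane_poly_polynomial: "plane_poly t \<in> polynomial_functions plane_coords"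
  unfolding plane_poly_def pp_poly_def zz_poly_def shift_poly_def cubic_def
  by (intro polynomial_intros polynomial_fst polynomial_snd)

lemma triple_poly_B:
  assumes t: "t \<noteq> 0" "t \<noteq> 1" and regular: "regular t x y"
  shows "triple_poly t (B_mat lam mu t x y) \<noteq> 0"
proof -
  let ?k = "- (mu $ 3 / dl)"
  have k: "?k \<noteq> 0" using mu_nonzero dl_nonzero by simp
  have s: "(\<Sum>i\<in>UNIV. (t - pole t i) * (?k * ((Y - pole t i) / pole_diff t i))) = ?k" for Y
    using interpolation_line_sums(2) [OF t, of Y]
    unfolding mult.left_commute [of _ ?k] sum_distrib_left [symmetric] by simp
  have "\<And>i. B_mat lam mu t x y i $ 3 $ 3 \<noteq> 0" "\<And>i. B_mat lam mu t x y i $ 2 $ 3 \<noteq> 0"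
    unfolding B_entry_3 [OF t regular] mult_eq_0_iff
    using k zz_nonzero [OF t regular] pr_nonzero [OF t y_not_pole [OF t regular]] by blast+
  moreover have "(\<Sum>i\<in>UNIV. (t - pole t i) * B_mat lam mu t x y i $ 2 $ 3) \<noteq> 0"
    "(\<Sum>i\<in>UNIV. (t - pole t i) * B_mat lam mu t x y i $ 1 $ 3) \<noteq> 0"
    unfolding B_entry_3 [OF t regular] pr_def qq_def s using k by blast+
  ultimately show ?thesis unfolding triple_poly_def by simp
qed

text \<open>Read off z, p, q from the third columns. The sum of the third columns and the normalization
  by the torus give the linear equations. With F and H the matrices of the third columns and of the
  third rows, F H = diag mu, so the diagonal of H (diag mu)^-1 F is 1; combined with the trace this
  expresses z_i + theta_i by A_i22, and the equations for w say that the entries (3,2) and (1,2) of the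
  A_i add up to 0.\<close>

lemma triple_normal_form:
  assumes t: "t \<noteq> 0" "t \<noteq> 1" and A: "A \<in> rank_one_triples lam mu" and nz:
      "triple_poly t A \<noteq> 0"
  shows "\<exists>x y d. regular t x y \<and> (\<forall>i. d $ i \<noteq> 0) \<and>
    (\<forall>i. A i = conj_by (diag d) (B_mat lam mu t x y i))"
proof -
  define S2 where "S2 = (\<Sum>i\<in>UNIV. (t - pole t i) * A i $ 2 $ 3)"
  define S1 where "S1 = (\<Sum>i\<in>UNIV. (t - pole t i) * A i $ 1 $ 3)"
  have S: "S1 \<noteq> 0" "S2 \<noteq> 0" using nz by (auto simp: triple_poly_def S1_def S2_def)
  have "\<forall>i. A i $ 3 $ 3 \<noteq> 0" "\<forall>i. A i $ 2 $ 3 \<noteq> 0"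
    unfolding forall_3 using nz by (auto simp: triple_poly_def)
  then have A33: "\<And>i. A i $ 3 $ 3 \<noteq> 0" and A23: "\<And>i. A i $ 2 $ 3 \<noteq> 0" by auto
  have rank1: "A i $ j $ k = A i $ j $ 3 / A i $ 3 $ 3 * A i $ 3 $ k" for i j k
    using A A33 by (intro rank_one_proportional) (auto simp: rank_one_triples_def)
  have "(\<Sum>i\<in>UNIV. A i) $ j $ k = diag mu $ j $ k" for j k
    using A by (simp add: rank_one_triples_def)
  then have Asum: "(\<Sum>i\<in>UNIV. A i $ j $ k) = (if j = k then mu $ j else 0)" for j k
    by (simp add: diag_def)

  define F :: "complex^3^3" where "F = (\<chi> j i. A i $ j $ 3)"
  define H :: "complex^3^3" where "H = (\<chi> i k. A i $ 3 $ k / A i $ 3 $ 3)"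
  have FHe: "F $ j $ i * H $ i $ k = A i $ j $ k" for i j k
    unfolding F_def H_def vec_lambda_beta by (subst rank1 [of i j k]) simp
  have FH: "F ** H = diag mu"
    by (simp add: vec_eq_iff matrix_matrix_mult_def FHe Asum diag_def)
  let ?M = "diag (\<chi> i. 1 / mu $ i)"
  have M: "(\<chi> i. 1 / mu $ i) $ i = 1 / mu $ i" for i by simp
  have mu_nz: "mu $ i \<noteq> 0" for i using mu_nonzero exhaust_3 [of i] by auto
  have "diag mu ** ?M = mat 1"
    using mu_nz by (simp add: vec_eq_iff diag_mult) (simp add: diag_def mat_def)
  then have "F ** (H ** ?M) = mat 1" by (simp add: matrix_mul_assoc FH)
  then have HF: "H ** ?M ** F = mat 1" using matrix_left_right_inverse by blast
  have 1: "A i $ 1 $ 1 / mu $ 1 + A i $ 2 $ 2 / mu $ 2 + A i $ 3 $ 3 / mu $ 3 = 1" for i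
  proof -
    have "(H ** ?M) $ i $ k = H $ i $ k / mu $ k" for k
      by (simp add: diag_mult)
    then have "(H ** ?M ** F) $ i $ i = (\<Sum>k\<in>UNIV. H $ i $ k / mu $ k * F $ k $ i)"
      by (simp add: matrix_matrix_mult_def [of "H ** ?M"])
    also have "\<dots> = (\<Sum>k\<in>UNIV. A i $ k $ k / mu $ k)"
      by (simp add: FHe [symmetric] mult.commute)
    finally show ?thesis by (simp add: HF mat_def sum_3)
  qed
  have tr: "A i $ 1 $ 1 + A i $ 2 $ 2 + A i $ 3 $ 3 = lam $ i" for i
    using A by (simp add: rank_one_triples_def trace_def sum_3)
  have "th i = A i $ 2 $ 2 + A i $ 3 $ 3 - mu $ 1 * (A i $ 2 $ 2 / mu $ 2 + A i $ 3 $ 3 / mu $ 3)" for i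
  proof -
    have "A i $ 1 $ 1 = mu $ 1 * (A i $ 1 $ 1 / mu $ 1)" using mu_nz [of 1] by simp
    also have "A i $ 1 $ 1 / mu $ 1 = 1 - (A i $ 2 $ 2 / mu $ 2 + A i $ 3 $ 3 / mu $ 3)"
      using 1 [of i] by (simp add: algebra_simps)
    finally show ?thesis unfolding theta_def tr [of i, symmetric] by (simp add: algebra_simps)
  qed
  then have A22: "- (dl / mu $ 3) * A i $ 3 $ 3 + th i = (dl - th4) / mu $ 2 * A i $ 2 $ 2" for i
    using mu_nonzero by (simp add: mu21) (simp add: dl_eq field_simps)

  define z :: "complex^3" where "z = (\<chi> i. - (dl / mu $ 3) * A i $ 3 $ 3)"
  define p where "p i = A i $ 2 $ 3 / S2" for i
  define q where "q i = A i $ 1 $ 3 / S1" for i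
  define y where "y = t * p 1"
  define x where "x = (\<Sum>i\<in>UNIV. z $ i / (y - pole t i))"
  define u :: "complex^3" where "u = (\<chi> i. p i / z $ i)"
  define c :: "complex^3" where "c = (\<chi> i. q i / z $ i)"
  have z_nz: "z $ i \<noteq> 0" for i using A33 mu_nonzero dl_nonzero by (simp add: z_def)
  have p_nz: "p i \<noteq> 0" for i using A23 S by (simp add: p_def)
  have zth: "z $ i + th i = (dl - th4) / mu $ 2 * A i $ 2 $ 2" for i
    unfolding A22 [symmetric] by (simp add: z_def)
  have psum: "(\<Sum>i\<in>UNIV. p i) = 0" "(\<Sum>i\<in>UNIV. (t - pole t i) * p i) = 1"
    using S by (simp_all add: p_def sum_divide_distrib [symmetric] Asum S2_def [symmetric])
  have qsum: "(\<Sum>i\<in>UNIV. q i) = 0" "(\<Sum>i\<in>UNIV. (t - pole t i) * q i) = 1"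
    using S by (simp_all add: q_def sum_divide_distrib [symmetric] Asum S1_def [symmetric])
  have p: "p i = (y - pole t i) / pole_diff t i" for i
    unfolding y_def by (rule interpolation_line [OF t psum])
  have y: "\<forall>i. y \<noteq> pole t i" using p p_nz by force
  have up: "u $ i * z $ i = p i" "c $ i * z $ i = q i" for i using z_nz by (simp_all add: u_def c_def)
  have w: "w_of lam mu z u $ i = - (dl / mu $ 3) * ((dl - th4) / mu $ 2) * S2 * A i $ 3 $ 2"
    and cw: "c $ i * w_of lam mu z u $ i = (dl - th4) / mu $ 2 * S2 / S1 * A i $ 1 $ 2" for i
  proof -
    have "w_of lam mu z u $ i = z $ i * (z $ i + th i) / p i"
      by (simp add: w_of_def u_def)
    then show w: "w_of lam mu z u $ i = - (dl / mu $ 3) * ((dl - th4) / mu $ 2) * S2 * A i $ 3 $ 2"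
      using A33 [of i] A23 [of i] S unfolding zth p_def rank1 [of i 2 2] by (simp add: z_def)
    show "c $ i * w_of lam mu z u $ i = (dl - th4) / mu $ 2 * S2 / S1 * A i $ 1 $ 2"
      using A33 [of i] S dl_nonzero mu_nonzero unfolding w rank1 [of i 1 2]
      by (simp add: c_def q_def z_def mult_ac)
  qed
  have "zu_system lam mu t x y z u"
    unfolding zu_system_def
  proof (intro conjI)
    show "\<forall>i. u $ i \<noteq> 0" using z_nz p_nz by (simp add: u_def)
    show "y = t * u $ 1 * z $ 1" by (simp only: mult.assoc up y_def)
    show "(\<Sum>i\<in>UNIV. z $ i) = mu $ 1 - mu $ 3"
      unfolding z_def vec_lambda_beta sum_distrib_left [symmetric] Asum
      using mu_nonzero by (simp add: dl_eq)
    show "(\<Sum>i\<in>UNIV. w_of lam mu z u $ i) = 0"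
      unfolding w sum_distrib_left [symmetric] Asum by simp
    show "(\<Sum>i\<in>UNIV. u $ i * z $ i) = 0" by (simp only: up psum)
    show "(\<Sum>i\<in>UNIV. (t - pole t i) * u $ i * z $ i) = 1"
      unfolding mult.assoc up by (rule psum)
  qed (rule y, rule x_def)
  then have zz: "\<And>i. zz t x y i \<noteq> 0" and z: "z = (\<chi> i. zz t x y i)" and u:
      "u = (\<chi> i. pr t y i / zz t x y i)"
    unfolding zu_system_iff [OF t] by blast+
  have "c_system t z (w_of lam mu z u) c"
    unfolding c_system_def
  proof (intro conjI)
    show "(\<Sum>i\<in>UNIV. c $ i * w_of lam mu z u $ i) = 0"
      unfolding cw sum_distrib_left [symmetric] Asum by simp
    show "(\<Sum>i\<in>UNIV. (t - pole t i) * c $ i * z $ i) = 1"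
      unfolding mult.assoc up by (rule qsum)
  qed (simp only: up qsum)
  moreover have "w_of lam mu z u = (\<chi> i. zz t x y i * rr t x y i)"
    unfolding z u using zz by (simp add: w_of_def rr_def vec_eq_iff)
  ultimately have "pp t x y \<noteq> 0" and c: "c = (\<chi> i. qq t x y i / zz t x y i)"
    unfolding z using c_system_iff [OF t y zz] by auto
  then have regular: "regular t x y" using y zz by (simp add: regular_def)
  have "q i = qq t x y i" for i using up(2) [of i] zz [of i] unfolding c z by simp
  then have Fmat: "Fmat t x y $ 1 $ i = A i $ 1 $ 3 / S1" "Fmat t x y $ 2 $ i = A i $ 2 $ 3 / S2"
     "Fmat t x y $ 3 $ i = - (dl / mu $ 3) * A i $ 3 $ 3" for i
    using p [of i] arg_cong [OF z, of "\<lambda>z. z $ i"] by (simp_all add: Fmat_def q_def p_def pr_def z_def)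

  define d :: "complex^3" where "d = vector [- (dl / mu $ 3) * S1, - (dl / mu $ 3) * S2, 1]"
  have "\<forall>i. d $ i \<noteq> 0" unfolding forall_3 using S dl_nonzero mu_nonzero by (simp add: d_def)
  then have d: "d $ i \<noteq> 0" for i by simp
  have "\<forall>j. F $ j $ i = - (mu $ 3 / dl) * d $ j * Fmat t x y $ j $ i" for i
    unfolding forall_3 using S dl_nonzero mu_nonzero by (simp add: Fmat d_def F_def)
  then have F: "F $ j $ i = - (mu $ 3 / dl) * d $ j * Fmat t x y $ j $ i" for i j by blast
  define H' :: "complex^3^3" where "H' = (\<chi> i k. - (dl / mu $ 3) * Gmat t x y $ i $ k * mu $ k / d $ k)"
  have "(F ** H') $ j $ k = diag mu $ j $ k" for j k
  proof -
    have "(F ** H') $ j $ k = (\<Sum>i\<in>UNIV. d $ j * mu $ k / d $ k *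
        (Fmat t x y $ j $ i * Gmat t x y $ i $ k))"
      using dl_nonzero mu_nonzero by (simp add: matrix_matrix_mult_def F H'_def) (simp add: mult_ac)
    also have "\<dots> = d $ j * mu $ k / d $ k * (Fmat t x y ** Gmat t x y) $ j $ k"
      by (simp add: sum_distrib_left matrix_matrix_mult_def)
    finally show ?thesis
      using d by (simp add: Fmat_Gmat [OF t regular] mat_def diag_def)
  qed
  then have "F ** H' = F ** H" by (simp add: FH vec_eq_iff)
  then have "H ** ?M ** F ** H' = H ** ?M ** F ** H" by (simp add: matrix_mul_assoc [symmetric])
  then have "H' = H" by (simp add: HF)
  then have "A i $ j $ k = F $ j $ i * H' $ i $ k" for i j k
    by (simp add: FHe)
  then have "A i $ j $ k = conj_by (diag d) (B_mat lam mu t x y i) $ j $ k" for i j k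
    using dl_nonzero mu_nonzero
    by (simp add: F H'_def conj_by_diag [OF d] B_entry [OF t regular])
  then have "A i = conj_by (diag d) (B_mat lam mu t x y i)" for i by (simp add: vec_eq_iff)
  then show ?thesis using regular d by blast
qed

end

section \<open>The second order equation in terms of x\<close>

text \<open>The three fractions in y' on the right hand side add up to t(t - 1)y'/P(y).\<close>

lemma first_derivative_from_momentum:
  fixes t y x d :: complex
  assumes t: "t \<noteq> 0" "t \<noteq> 1" and y: "y \<noteq> 0" "y \<noteq> 1" "y \<noteq> t"
    and x: "2 * x = ((t - 1) * d - th1) / y + (d - 1 - th2) / (y - t) - (t * d + th3) / (y - 1)"
  shows "t * (t - 1) * d = y * (y - 1) * (y - t) * (2 * x + (th1 / y + th2 / (y - t) + th3 / (y - 1))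
      + 1 / (y - t))"
proof -
  have y': "y - 1 \<noteq> 0" "y - t \<noteq> 0" using y by auto
  show ?thesis unfolding x using y(1) y' by (simp add: divide_simps) algebra
qed

text \<open>For (a, b, c) = (theta_1, theta_3, theta_2 + 1), the left hand side is the part of t(t -
  1)x' that is quadratic in the parameters, and the right hand side is the corresponding part of
  Painleve VI.\<close>

lemma quadratic_residue_identity:
  fixes t y a b c :: complex
  assumes y: "y \<noteq> 0" "y - 1 \<noteq> 0" "y - t \<noteq> 0"
  shows "(1 / y + 1 / (y - 1) + 1 / (y - t)) * (y * (y - 1) * (y - t)) * (a / y + b / (y - 1) + c / (y - t))^2
      - 2 * (y * (y - 1) * (y - t)) * (a / y + b / (y - 1) + c / (y - t))
          * (a / y^2 + b / (y - 1)^2 + c / (y - t)^2) - (a + b + c)^2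
    = b^2 * (t - 1) / (y - 1)^2 - a^2 * t / y^2 - c^2 * (t * (t - 1)) / (y - t)^2"
  using y by (simp add: divide_simps) algebra

text \<open>With E = t(t - 1)y'/P(y), the term of Painleve VI quadratic in y' and the derivative of
  P(y)E combine, so that t(t - 1)x' depends on E through one square and one linear term. Completing the
  square in 2x = E - S leaves an identity that does not involve E.\<close>

lemma second_derivative_identity:
  fixes t y x d dd :: complex
  assumes t: "t \<noteq> 0" "t - 1 \<noteq> 0" and y: "y \<noteq> 0" "y - 1 \<noteq> 0" "y - t \<noteq> 0"
    and E: "d = y * (y - 1) * (y - t) * E / (t * (t - 1))"
    and x: "x = (E - (th1 / y + th2 / (y - t) + th3 / (y - 1)) - 1 / (y - t)) / 2"
    and dd: "dd = 1 / 2 * (1 / y + 1 / (y - 1) + 1 / (y - t)) * d\<^sup>2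
         - (1 / t + 1 / (t - 1) + 1 / (y - t)) * d
         + y * (y - 1) * (y - t) / (2 * t\<^sup>2 * (t - 1)\<^sup>2) *
           ((th4 - 1)\<^sup>2 - th1\<^sup>2 * t / y\<^sup>2 + th3\<^sup>2 * (t - 1) / (y - 1)\<^sup>2
             + (1 - th2\<^sup>2) * t * (t - 1) / (y - t)\<^sup>2)"
    and dx: "2 * dx = (d + (t - 1) * dd) / y - ((t - 1) * d - th1) * d / y^2
       + dd / (y - t) - (d - 1 - th2) * (d - 1) / (y - t)^2
       - (d + t * dd) / (y - 1) + (t * d + th3) * d / (y - 1)^2"
    and dl: "2 * dl = th1 + th2 + th3 + th4"
  shows "t * (t - 1) * dx = dl * (th4 - dl - 1) - x^2 * ((y - 1) * (y - t) + y * (y - t) + y * (y - 1))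
     + x * (y * (y - 1) * (y - t)) * (th1 / y^2 + th2 / (y - t)^2 + th3 / (y - 1)^2)
     - x * ((y - 1) * (y - t) + y * (y - t) + y * (y - 1)) * (th1 / y + th2 / (y - t) + th3 / (y - 1)
         + 1 / (y - t))
     + x * (y * (y - 1) * (y - t)) / (y - t)^2"
proof -
  define A B C where "A = 1 / y" and "B = 1 / (y - 1)" and "C = 1 / (y - t)"
  define L P Q k where "L = A + B + C" and "P = y * (y - 1) * (y - t)" and "Q = A * B * C" and "k = t * (t - 1)"
  define W where "W = (th4 - 1)\<^sup>2 - th1\<^sup>2 * t / y\<^sup>2 + th3\<^sup>2 * (t - 1) / (y - 1)\<^sup>2
             + (1 - th2\<^sup>2) * t * (t - 1) / (y - t)\<^sup>2"
  \<comment> \<open>theta_2 enters as theta_2 + 1 because of the term 1/(y - t) of E and of its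
    derivative\<close>
  define T where "T = th1 * A^2 + th3 * B^2 + (th2 + 1) * C^2"
  define M where "M = 2 * t - 1 + k * C"
  have k: "k \<noteq> 0" using t by (simp add: k_def)
  have PQ: "P * Q = 1" using y by (simp add: P_def Q_def A_def B_def C_def)
  have kd: "k * d = P * E" using t by (simp add: E k_def P_def)
  have i1: "(t - 1) * A + C - t * B = k * Q"
    unfolding A_def B_def C_def Q_def k_def using y by (simp add: divide_simps) algebra
  have i2: "A - B + C^2 = M * Q"
    unfolding A_def B_def C_def Q_def k_def M_def using y by (simp add: divide_simps) algebra
  have i3: "t * B^2 - (t - 1) * A^2 - C^2 = - k * L * Q"
    unfolding A_def B_def C_def Q_def k_def L_def using y by (simp add: divide_simps) algebra
  have "2 * dx = (d + (t - 1) * dd) * A - ((t - 1) * d - th1) * d * A^2 + dd * C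
     - (d - 1 - th2) * (d - 1) * C^2 - (d + t * dd) * B + (t * d + th3) * d * B^2"
    unfolding dx A_def B_def C_def by (simp add: power_divide)
  then have "2 * dx = dd * ((t - 1) * A + C - t * B) + d * (A - B + C^2)
     + d^2 * (t * B^2 - (t - 1) * A^2 - C^2) + d * T - (1 + th2) * C^2"
    unfolding T_def by algebra
  then have "2 * dx = dd * (k * Q) + d * (M * Q) + d^2 * (- k * L * Q) + d * T - (1 + th2) * C^2"
    unfolding i1 i2 i3 .
  then have 1: "2 * k * dx = k^2 * dd * Q + (k * d) * (M * Q) - (k * d)^2 * L * Q + (k * d) * T - k * (1
      + th2) * C^2"
    by algebra
  have "dd = 1 / 2 * L * d^2 - (1 / t + 1 / (t - 1) + C) * d + P / (2 * k^2) * W"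
    unfolding dd L_def P_def W_def A_def B_def C_def k_def by (simp add: power_mult_distrib mult_ac)
  moreover have "k * (1 / t + 1 / (t - 1) + C) = M"
    using t by (simp add: M_def k_def divide_simps)
  ultimately have "k^2 * dd = 1 / 2 * L * (k * d)^2 - M * (k * d) + P / 2 * W"
    using k by (simp add: divide_simps) algebra
  then have "2 * k * dx = 1 / 2 * L * (P * E)^2 * Q - M * (P * E) * Q + P / 2 * W * Q + (P * E) * (M * Q)
     - (P * E)^2 * L * Q + (P * E) * T - k * (1 + th2) * C^2"
    unfolding 1 kd by algebra
  also have "\<dots> = P * E * T - 1 / 2 * L * P * E^2 + W / 2 - k * (1 + th2) * C^2"
    using PQ by algebra
  finally have 2: "2 * k * dx = P * E * T - 1 / 2 * L * P * E^2 + W / 2 - k * (1 + th2) * C^2" .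
  define S where "S = th1 * A + th3 * B + (th2 + 1) * C"
  have "L * P * S^2 - 2 * P * S * T - (th1 + th3 + (th2 + 1))^2
     = th3^2 * (t - 1) / (y - 1)^2 - th1^2 * t / y^2 - (th2 + 1)^2 * (t * (t - 1)) / (y - t)^2"
    using quadratic_residue_identity [OF y, of th1 th3 "th2 + 1"]
    by (simp add: L_def P_def S_def T_def A_def B_def C_def power_divide)
  also have "\<dots> = W - (th4 - 1)^2 - 2 * k * (1 + th2) * C^2"
    using y by (simp add: W_def k_def C_def divide_simps) algebra
  finally have 3: "L * P * S^2 - 2 * P * S * T - (th1 + th3 + (th2 + 1))^2
     = W - (th4 - 1)^2 - 2 * k * (1 + th2) * C^2" .
  have "x = (E - S) / 2"
    by (simp add: x S_def A_def B_def C_def algebra_simps add_divide_distrib diff_divide_distrib)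
  then have "x * 2 = E - S" by simp
  then have E': "E = 2 * x + S" by algebra
  have dl': "2 * (2 * dl * (th4 - dl - 1)) = (th4 - 1)^2 - (th1 + th3 + (th2 + 1))^2"
    using dl by algebra
  have "2 * (2 * (dl * (th4 - dl - 1) - x^2 * (L * P) + x * P * T - x * (L * P) * S)) = 2 * (2 * k * dx)"
    unfolding 2 E' using 3 dl' by (simp add: field_simps power2_eq_square) algebra
  then have "k * dx = dl * (th4 - dl - 1) - x^2 * (L * P) + x * P * T - x * (L * P) * S" by algebra
  then have "k * dx = dl * (th4 - dl - 1) - x^2 * (L * P) + x * P * (T - C^2) - x * (L * P) * (S - C + C)
      + x * P * C^2"
    by algebra
  moreover have "L * P = (y - 1) * (y - t) + y * (y - t) + y * (y - 1)"
    using y by (simp add: L_def P_def A_def B_def C_def distrib_left distrib_right)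
  moreover have "T - C^2 = th1 / y^2 + th2 / (y - t)^2 + th3 / (y - 1)^2"
    "S - C = th1 / y + th2 / (y - t) + th3 / (y - 1)"
    by (simp_all add: T_def S_def A_def B_def C_def power_divide distrib_right add_divide_distrib)
  moreover have "x * P * C^2 = x * P / (y - t)^2" by (simp add: C_def power_divide)
  ultimately show ?thesis by (simp only: k_def P_def C_def)
qed

section \<open>Linear differential equations for matrices\<close>

text \<open>The sum of the moduli of the entries: submultiplicative, and convenient for entrywise
  estimates.\<close>

definition mnorm :: "complex^3^3 \<Rightarrow> real" where
  "mnorm M = (\<Sum>j\<in>UNIV. \<Sum>k\<in>UNIV. norm (M $ j $ k))"

lemma mnorm_nonneg [simp]: "0 \<le> mnorm M"
  by (simp add: mnorm_def sum_nonneg)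

lemma mnorm_zero [simp]: "mnorm 0 = 0"
  by (simp add: mnorm_def)

lemma mnorm_one: "mnorm (mat 1) = 3"
  by (simp add: mnorm_def mat_def sum_3)

lemma norm_entry_le: "norm (M $ j $ k) \<le> mnorm M"
proof -
  have "norm (M $ j $ k) \<le> (\<Sum>k\<in>UNIV. norm (M $ j $ k))"
    by (rule member_le_sum) auto
  also have "\<dots> \<le> mnorm M"
    unfolding mnorm_def by (rule member_le_sum) (auto simp: sum_nonneg)
  finally show ?thesis .
qed

lemma mnorm_le: "(\<And>j k. norm (M $ j $ k) \<le> c) \<Longrightarrow> mnorm M \<le> 9 * c"
  unfolding mnorm_def sum_3 by (smt (verit) distrib_right)

lemma mnorm_eq_0: "mnorm M = 0 \<Longrightarrow> M = 0"
  using norm_entry_le [of M] by (simp add: vec_eq_iff)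

lemma mnorm_add: "mnorm (M + N) \<le> mnorm M + mnorm N"
  unfolding mnorm_def sum.distrib [symmetric]
  by (intro sum_mono) (simp add: norm_triangle_ineq)

lemma mnorm_scale: "mnorm (mat_scale c M) = norm c * mnorm M"
  by (simp add: mnorm_def mat_scale_def norm_mult sum_distrib_left)

lemma mnorm_mult: "mnorm (M ** N) \<le> mnorm M * mnorm N"
proof -
  have "mnorm (M ** N) \<le> (\<Sum>j\<in>UNIV. \<Sum>k\<in>UNIV. \<Sum>l\<in>UNIV. norm
      (M $ j $ l) * norm (N $ l $ k))"
    unfolding mnorm_def matrix_matrix_mult_def
    by (intro sum_mono) (simp add: norm_mult [symmetric] norm_sum)
  also have "\<dots> = (\<Sum>j\<in>UNIV. \<Sum>l\<in>UNIV. norm (M $ j $ l) * (\<Sum>k\<in>UNIV. norm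
      (N $ l $ k)))"
    unfolding sum_distrib_left by (intro sum.cong refl sum.swap)
  also have "\<dots> \<le> (\<Sum>j\<in>UNIV. \<Sum>l\<in>UNIV. norm (M $ j $ l) * mnorm N)"
    unfolding mnorm_def [of N]
    by (intro sum_mono mult_left_mono norm_ge_zero member_le_sum [of _ UNIV
        "\<lambda>l. \<Sum>k\<in>UNIV. norm (N $ l $ k)"])
      (auto simp: sum_nonneg)
  also have "\<dots> = mnorm M * mnorm N"
    by (simp add: mnorm_def [of M] sum_distrib_right)
  finally show ?thesis .
qed

text \<open>A vector v in the kernel of M satisfies v = (1 - M)v, which is shorter than v.\<close>

lemma invertible_near_one:
  assumes "mnorm (M - mat 1) < 1"
  shows "invertible M"
proof -
  have "x = 0" if "M *v x = 0" for x :: "complex^3"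
  proof (rule ccontr)
    assume "x \<noteq> 0"
    then obtain k where "x $ k \<noteq> 0" by (auto simp: vec_eq_iff)
    then have pos: "0 < (\<Sum>k\<in>UNIV. norm (x $ k))"
      by (intro sum_pos2 [of _ k]) auto
    have x: "- x $ j = (\<Sum>k\<in>UNIV. (M - mat 1) $ j $ k * x $ k)" for j
    proof -
      have "(\<Sum>k\<in>UNIV. (M - mat 1) $ j $ k * x $ k) = (M *v x) $ j - (mat 1 *v x) $ j"
        by (simp add: matrix_vector_mult_def sum_subtractf left_diff_distrib)
      then show ?thesis by (simp add: that matrix_vector_mul_lid)
    qed
    have "(\<Sum>j\<in>UNIV. norm (x $ j)) \<le> (\<Sum>j\<in>UNIV. \<Sum>k\<in>UNIV. norm ((M
        - mat 1) $ j $ k) * norm (x $ k))"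
    proof (intro sum_mono)
      fix j
      have "norm (x $ j) = norm (\<Sum>k\<in>UNIV. (M - mat 1) $ j $ k * x $ k)"
        unfolding x [symmetric] by simp
      also have "\<dots> \<le> (\<Sum>k\<in>UNIV. norm ((M - mat 1) $ j $ k * x $ k))" by (rule norm_sum)
      finally show "norm (x $ j) \<le> (\<Sum>k\<in>UNIV. norm ((M - mat 1) $ j $ k) * norm (x $ k))"
        by (simp only: norm_mult)
    qed
    also have "\<dots> \<le> (\<Sum>j\<in>UNIV. \<Sum>k\<in>UNIV. norm ((M
        - mat 1) $ j $ k) * (\<Sum>k\<in>UNIV. norm (x $ k)))"
      by (intro sum_mono mult_left_mono member_le_sum [of _ UNIV "\<lambda>k. norm (x $ k)"]) auto
    also have "\<dots> = mnorm (M - mat 1) * (\<Sum>k\<in>UNIV. norm (x $ k))"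
      by (simp only: mnorm_def sum_distrib_right)
    also have "\<dots> < 1 * (\<Sum>k\<in>UNIV. norm (x $ k))"
      using assms pos by (intro mult_strict_right_mono)
    finally show False by simp
  qed
  then have "\<exists>B. B ** M = mat 1"
    by (simp add: matrix_left_invertible_ker)
  then show ?thesis
    by (simp add: invertible_left_inverse)
qed

lemma hmd_entry: "has_matrix_derivative M M' t \<Longrightarrow>
    ((\<lambda>s. M s $ j $ k) has_field_derivative M' $ j $ k) (at t)"
  by (simp add: has_matrix_derivative_def)

lemma hmd_const: "has_matrix_derivative (\<lambda>_. M) 0 t"
  by (simp add: has_matrix_derivative_def)

lemma hmd_add:
  "has_matrix_derivative M M' t \<Longrightarrow> has_matrix_derivative N N' t \<Longrightarrow>
    has_matrix_derivative (\<lambda>s. M s + N s) (M' + N') t"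
  by (simp add: has_matrix_derivative_def DERIV_add)

lemma hmd_diff:
  "has_matrix_derivative M M' t \<Longrightarrow> has_matrix_derivative N N' t \<Longrightarrow>
    has_matrix_derivative (\<lambda>s. M s - N s) (M' - N') t"
  by (simp add: has_matrix_derivative_def DERIV_diff)

lemma hmd_scale:
  "has_matrix_derivative M M' t \<Longrightarrow> has_matrix_derivative (\<lambda>s. mat_scale c (M s))
      (mat_scale c M') t"
  by (simp add: has_matrix_derivative_def mat_scale_def DERIV_cmult)

lemma hmd_scale_fun:
  "(f has_field_derivative f') (at t) \<Longrightarrow> has_matrix_derivative M M' t \<Longrightarrow>
    has_matrix_derivative (\<lambda>s. mat_scale (f s) (M s)) (mat_scale f' (M t) + mat_scale (f t) M') t"
  by (auto simp: has_matrix_derivative_def mat_scale_def intro!: derivative_eq_intros)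

lemma hmd_mult:
  assumes "has_matrix_derivative M M' t" "has_matrix_derivative N N' t"
  shows "has_matrix_derivative (\<lambda>s. M s ** N s) (M' ** N t + M t ** N') t"
  unfolding has_matrix_derivative_def
proof (intro allI)
  fix j k
  have "((\<lambda>s. \<Sum>l\<in>UNIV. M s $ j $ l * N s $ l $ k) has_field_derivative
     (\<Sum>l\<in>UNIV. M' $ j $ l * N t $ l $ k + N' $ l $ k * M t $ j $ l)) (at t)"
    by (intro DERIV_sum DERIV_mult hmd_entry assms)
  then show "((\<lambda>s. (M s ** N s) $ j $ k) has_field_derivative (M' ** N t + M t ** N') $ j $ k) (at t)"
    by (simp add: matrix_matrix_mult_def sum.distrib mult.commute [of "N' $ _ $ _"])
qed

lemma hmd_mult_const:
  assumes "has_matrix_derivative M M' t"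
  shows "has_matrix_derivative (\<lambda>s. M s ** N) (M' ** N) t"
  using hmd_mult [OF assms hmd_const [of N]] by (simp add: matrix_matrix_mult_def [of _ 0] vec_eq_iff)

lemma hmd_unique:
  "has_matrix_derivative M M' t \<Longrightarrow> has_matrix_derivative M M'' t \<Longrightarrow> M' = M''"
  by (simp add: has_matrix_derivative_def vec_eq_iff) (blast intro: DERIV_unique)

lemma hmd_cong:
  assumes "has_matrix_derivative M M' t" "open S" "t \<in> S" "\<And>s. s \<in> S \<Longrightarrow> M s = N s"
  shows "has_matrix_derivative N M' t"
  unfolding has_matrix_derivative_def
proof (intro allI)
  fix j k
  show "((\<lambda>s. N s $ j $ k) has_field_derivative M' $ j $ k) (at t)"
    by (rule DERIV_cong_ev [THEN iffD1, OF refl _ refl hmd_entry [OF assms(1), of j k]])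
      (use assms in \<open>auto simp: eventually_nhds\<close>)
qed

lemma hmd_continuous: "has_matrix_derivative M M' t \<Longrightarrow> isCont (\<lambda>s. mnorm (M s)) t"
  unfolding mnorm_def by (intro continuous_sum continuous_norm DERIV_isCont [OF hmd_entry])

text \<open>The factor 9 is the number of entries.\<close>

lemma mean_value_bound:
  assumes "\<And>z. z \<in> cball z0 r \<Longrightarrow> has_matrix_derivative R (R' z) z"
    and "\<And>z. z \<in> cball z0 r \<Longrightarrow> mnorm (R' z) \<le> C" and "z \<in> cball z0 r" and
        "0 \<le> C"
  shows "mnorm (R z - R z0) \<le> 9 * (C * r)"
proof (rule mnorm_le)
  fix j k
  have r: "0 \<le> r" using order_trans [OF zero_le_dist assms(3) [unfolded mem_cball]] .
  have "norm (R z $ j $ k - R z0 $ j $ k) \<le> C * norm (z - z0)"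
  proof (rule field_differentiable_bound [where S = "cball z0 r" and f =
      "\<lambda>z. R z $ j $ k" and f' = "\<lambda>z. R' z $ j $ k"])
    show "((\<lambda>z. R z $ j $ k) has_field_derivative R' w $ j $ k) (at w within cball z0 r)"
      if "w \<in> cball z0 r" for w
      by (rule has_field_derivative_at_within [OF hmd_entry [OF assms(1) [OF that]]])
    show "norm (R' w $ j $ k) \<le> C" if "w \<in> cball z0 r" for w
      using assms(2) [OF that] norm_entry_le [of "R' w" j k] by simp
  qed (use assms(3) r in auto)
  also have "\<dots> \<le> C * r"
    using assms(3,4) by (intro mult_left_mono) (auto simp: dist_norm norm_minus_commute)
  finally show "norm ((R z - R z0) $ j $ k) \<le> C * r" by simp
qed

text \<open>At the point where the norm of R is largest on the closed disk, the mean value bound gives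
  max |R| <= |R(z0)| + (max |R|)/2 + 9 e s.\<close>

lemma linear_ode_bound:
  assumes der: "\<And>z. z \<in> ball z0 e \<Longrightarrow> has_matrix_derivative R (A z ** R z + S z) z"
    and A: "\<And>z. z \<in> ball z0 e \<Longrightarrow> mnorm (A z) \<le> K"
    and S: "\<And>z. z \<in> ball z0 e \<Longrightarrow> mnorm (S z) \<le> s"
    and e: "9 * K * e \<le> 1 / 2" and z: "z \<in> ball z0 e"
  shows "mnorm (R z) \<le> 2 * (mnorm (R z0) + 9 * e * s)"
proof -
  define r where "r = dist z0 z"
  have r: "0 \<le> r" "r < e" using z by (simp_all add: r_def)
  have K: "0 \<le> K" using A [OF z] mnorm_nonneg order_trans by blast
  have s: "0 \<le> s" using S [OF z] mnorm_nonneg order_trans by blast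
  have sub: "cball z0 r \<subseteq> ball z0 e" using r by auto
  have cont: "continuous_on (cball z0 r) (\<lambda>z. mnorm (R z))"
    using der sub hmd_continuous by (intro continuous_at_imp_continuous_on) blast
  have "cball z0 r \<noteq> {}" using r by auto
  then obtain w where w: "w \<in> cball z0 r" and max:
      "\<And>v. v \<in> cball z0 r \<Longrightarrow> mnorm (R v) \<le> mnorm (R w)"
    using continuous_attains_sup [OF compact_cball _ cont] by blast
  let ?m = "mnorm (R w)"
  have "mnorm (R w - R z0) \<le> 9 * ((K * ?m + s) * r)"
  proof (rule mean_value_bound [OF _ _ w])
    show "has_matrix_derivative R (A v ** R v + S v) v" if "v \<in> cball z0 r" for v
      using der sub that by blast
    show "mnorm (A v ** R v + S v) \<le> K * ?m + s" if v: "v \<in> cball z0 r" for v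
    proof -
      have "mnorm (A v ** R v) \<le> K * ?m"
        using mnorm_mult [of "A v" "R v"] A [of v] max [OF v] v sub K
        by (meson mult_mono mnorm_nonneg order_trans subsetD)
      then show ?thesis using mnorm_add [of "A v ** R v" "S v"] S [of v] v sub by fastforce
    qed
  qed (use K s in auto)
  also have "\<dots> \<le> 9 * ((K * ?m + s) * e)"
    using r K s by (intro mult_left_mono) auto
  also have "\<dots> = (9 * K * e) * ?m + 9 * e * s"
    by (simp add: algebra_simps)
  also have "\<dots> \<le> 1 / 2 * ?m + 9 * e * s"
    by (intro add_right_mono mult_right_mono e mnorm_nonneg)
  finally have "mnorm (R w - R z0) \<le> 1 / 2 * ?m + 9 * e * s" .
  moreover have "?m \<le> mnorm (R z0) + mnorm (R w - R z0)"
    using mnorm_add [of "R z0" "R w - R z0"] by simp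
  moreover have "m \<le> 2 * (m0 + c)" if "d \<le> 1 / 2 * m + c" "m \<le> m0 + d" for m m0 d c :: real
    using that by (simp add: algebra_simps)
  ultimately have "?m \<le> 2 * (mnorm (R z0) + 9 * e * s)" by blast
  moreover have "mnorm (R z) \<le> ?m" by (rule max) (simp add: r_def)
  ultimately show ?thesis by (rule order_trans [rotated])
qed

lemma matrix_primitive:
  assumes "\<And>j k. (\<lambda>z. M z $ j $ k) holomorphic_on ball z0 e"
  shows "\<exists>N. N z0 = 0 \<and> (\<forall>z\<in>ball z0 e. has_matrix_derivative N (M z) z)"
proof -
  have "\<exists>g. \<forall>z\<in>ball z0 e. (g has_field_derivative M z $ j $ k) (at z)" for j k
    using holomorphic_convex_primitive' [OF convex_ball open_ball assms, of j k]
    by (metis at_within_open open_ball)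
  then obtain g where g: "\<And>j k z. z \<in> ball z0 e \<Longrightarrow>
      (g j k has_field_derivative M z $ j $ k) (at z)"
    by metis
  show ?thesis
  proof (intro exI [of _ "\<lambda>z. \<chi> j k. g j k z - g j k z0"] conjI ballI)
    show "has_matrix_derivative (\<lambda>z. \<chi> j k. g j k z - g j k z0) (M z) z" if
        "z \<in> ball z0 e" for z
      unfolding has_matrix_derivative_def using g [OF that] by (auto intro!: derivative_eq_intros)
  qed (simp add: vec_eq_iff)
qed

lemma hmd_holomorphic:
  "(\<And>z. z \<in> ball z0 e \<Longrightarrow> has_matrix_derivative M (M' z) z) \<Longrightarrow>
      (\<lambda>z. M z $ j $ k) holomorphic_on ball z0 e"
  unfolding holomorphic_on_open [OF open_ball] using hmd_entry by blast

lemma holomorphic_matrix_mult: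
  assumes "\<And>j k. (\<lambda>z. M z $ j $ k) holomorphic_on S"
      "\<And>j k. (\<lambda>z. N z $ j $ k) holomorphic_on S"
  shows "(\<lambda>z. (M z ** N z) $ j $ k) holomorphic_on S"
  unfolding matrix_matrix_mult_def by (simp add: assms holomorphic_intros)

text \<open>Picard iteration, written as the series of the increments D_n, where D_(n+1) is the
  primitive of A D_n that vanishes at z0. On a small disk the bound of the increments is halved in every
  step.\<close>

lemma linear_ode_exists:
  assumes hol: "\<And>j k. (\<lambda>z. A z $ j $ k) holomorphic_on ball z0 e"
    and A: "\<And>z. z \<in> ball z0 e \<Longrightarrow> mnorm (A z) \<le> K" and e: "0 < e"
        "9 * K * e \<le> 1 / 2"
  shows "\<exists>X. X z0 = mat 1 \<and> (\<forall>z\<in>ball z0 e. has_matrix_derivative X (A z ** X z) z)"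
proof -
  have K: "0 \<le> K" using order_trans [OF mnorm_nonneg A [of z0]] e(1) by simp
  define step where "step M = (SOME N. N z0 = 0 \<and> (\<forall>z\<in>ball z0 e. has_matrix_derivative N
      (A z ** M z) z))" for M
  have step: "step M z0 = 0" "\<And>z. z \<in> ball z0 e \<Longrightarrow>
      has_matrix_derivative (step M) (A z ** M z) z"
    if "\<And>j k. (\<lambda>z. M z $ j $ k) holomorphic_on ball z0 e" for M
    using someI_ex [OF matrix_primitive [OF holomorphic_matrix_mult [OF hol that]]]
    unfolding step_def by blast+
  define D where "D n = (step ^^ n) (\<lambda>_. mat 1)" for n
  have hD: "(\<lambda>z. D n z $ j $ k) holomorphic_on ball z0 e" for n j k
  proof (induction n arbitrary: j k)
    case (Suc n)
    then show ?case
      using hmd_holomorphic [OF step(2) [of "D n"]] by (simp add: D_def)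
  qed (simp add: D_def)
  have D0: "D 0 z = mat 1" and Dz0: "D (Suc n) z0 = 0"
    and dD: "z \<in> ball z0 e \<Longrightarrow> has_matrix_derivative (D (Suc n)) (A z ** D n z) z" for n z
    using step [OF hD] by (simp_all add: D_def)
  have bound: "mnorm (D n z) \<le> 3 * (1 / 2) ^ n" if "z \<in> ball z0 e" for n z
    using that
  proof (induction n arbitrary: z)
    case (Suc n)
    define r where "r = dist z0 z"
    have r: "0 \<le> r" "r < e" using Suc.prems by (simp_all add: r_def)
    have "mnorm (D (Suc n) z - D (Suc n) z0) \<le> 9 * (K * (3 * (1 / 2) ^ n) * r)"
    proof (rule mean_value_bound)
      fix w assume "w \<in> cball z0 r"
      then have w: "w \<in> ball z0 e" using r by auto
      then show "has_matrix_derivative (D (Suc n)) (A w ** D n w) w" by (rule dD)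
      show "mnorm (A w ** D n w) \<le> K * (3 * (1 / 2) ^ n)"
        using mnorm_mult [of "A w" "D n w"] A [OF w] Suc.IH [OF w] K
        by (meson mult_mono mnorm_nonneg order_trans)
    qed (use K in \<open>auto simp: r_def\<close>)
    also have "\<dots> \<le> 9 * (K * (3 * (1 / 2) ^ n) * e)"
      using r K by (intro mult_left_mono) auto
    also have "\<dots> = 9 * K * e * (3 * (1 / 2) ^ n)" by simp
    also have "\<dots> \<le> 1 / 2 * (3 * (1 / 2) ^ n)" using e by (intro mult_right_mono) auto
    finally show ?case by (simp add: Dz0)
  qed (simp add: D0 mnorm_one)
  define D' where "D' n z = (case n of 0 \<Rightarrow> 0 | Suc m \<Rightarrow> A z ** D m z)" for n z
  have dD': "has_matrix_derivative (D n) (D' n z) z" if "z \<in> ball z0 e" for n z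
    using that hmd_const [of "mat 1"] D0 [abs_def] by (cases n) (auto simp: D'_def dD fun_eq_iff)
  have "\<exists>g g'. \<forall>z\<in>ball z0 e. (\<lambda>n. D n z $ j $ k) sums g z \<and>
      (\<lambda>n. D' n z $ j $ k) sums g' z
      \<and> (g has_field_derivative g' z) (at z)" for j k
  proof -
    have 1: "summable (\<lambda>n. 3 * (1 / 2 :: real) ^ n)" by (intro summable_mult summable_geometric) simp
    have "norm (D n z $ j $ k) \<le> 3 * (1 / 2) ^ n" if "z \<in> ball z0 e" for n z
      using norm_entry_le bound [OF that] order_trans by blast
    then have 2: "\<forall>\<^sub>F n in sequentially. \<forall>z\<in>ball z0 e. norm (D n z $ j $ k)
        \<le> 3 * (1 / 2) ^ n"
      by simp
    have 3: "((\<lambda>z. D n z $ j $ k) has_field_derivative D' n z $ j $ k) (at z)" if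
        "z \<in> ball z0 e" for n z
      by (rule hmd_entry [OF dD' [OF that]])
    show ?thesis
      by (rule series_and_derivative_comparison [OF open_ball 1 3 2]) blast+
  qed
  then obtain g g' where g: "\<And>j k z. z \<in> ball z0 e \<Longrightarrow>
      (\<lambda>n. D n z $ j $ k) sums g j k z"
    "\<And>j k z. z \<in> ball z0 e \<Longrightarrow> (\<lambda>n. D' n z $ j $ k) sums g' j k z"
    "\<And>j k z. z \<in> ball z0 e \<Longrightarrow> (g j k has_field_derivative g' j k z) (at z)"
    by metis
  define X where "X z = (\<chi> j k. g j k z)" for z
  have "g' j k z = (A z ** X z) $ j $ k" if z: "z \<in> ball z0 e" for j k z
  proof -
    have "(\<lambda>n. \<Sum>l\<in>UNIV. A z $ j $ l * D n z $ l $ k) sums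
        (\<Sum>l\<in>UNIV. A z $ j $ l * g l k z)"
      by (intro sums_sum sums_mult g z)
    then have "(\<lambda>n. D' (Suc n) z $ j $ k) sums (A z ** X z) $ j $ k"
      by (simp add: D'_def matrix_matrix_mult_def X_def)
    then have "(\<lambda>n. D' n z $ j $ k) sums ((A z ** X z) $ j $ k + D' 0 z $ j $ k)"
      by (rule sums_Suc)
    then show ?thesis using g(2) [OF z, of j k] sums_unique2 by (fastforce simp: D'_def)
  qed
  moreover have "g j k z0 = mat 1 $ j $ k" for j k
  proof -
    have "(\<lambda>n. D n z0 $ j $ k) sums (\<Sum>n\<in>{0}. D n z0 $ j $ k)"
      using Dz0 by (intro sums_finite) (auto simp: gr0_conv_Suc)
    then show ?thesis using g(1) [of z0 j k] e(1) sums_unique2 by (fastforce simp: D0)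
  qed
  ultimately show ?thesis
    using g(3) by (intro exI [of _ X]) (simp add: has_matrix_derivative_def X_def vec_eq_iff)
qed

section \<open>Flat frames in two variables\<close>

lemma mat_scale_mult: "mat_scale c M ** N = mat_scale c (M ** N)" "M ** mat_scale c N = mat_scale c (M ** N)"
  by (simp_all add: vec_eq_iff mat_scale_def matrix_matrix_mult_def sum_distrib_left mult_ac)

lemma mat_scale_add: "mat_scale c (M + N) = mat_scale c M + mat_scale c N"
  "mat_scale c (M - N) = mat_scale c M - mat_scale c N"
  by (simp_all add: vec_eq_iff mat_scale_def algebra_simps)

lemma matrix_diff_distrib:
  fixes M N L :: "complex^3^3"
  shows "(M - N) ** L = M ** L - N ** L" "L ** (M - N) = L ** M - L ** N"
  by (simp_all add: vec_eq_iff matrix_matrix_mult_def left_diff_distrib right_diff_distrib sum_subtractf)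

lemma matrix_add_distrib:
  fixes M N L :: "complex^3^3"
  shows "(M + N) ** L = M ** L + N ** L" "L ** (M + N) = L ** M + L ** N"
  by (simp_all add: vec_eq_iff matrix_matrix_mult_def algebra_simps sum.distrib)

text \<open>Cauchy's estimates for the first two derivatives on the smaller disk.\<close>

lemma taylor_bounds:
  assumes hol: "f holomorphic_on ball t1 (3 * r)" and r: "0 < r"
    and K: "\<And>t. t \<in> ball t1 (3 * r) \<Longrightarrow> norm (f t) \<le> K" and t: "t \<in> cball t1 r"
  shows "norm (f t - f t1) \<le> K / r * norm (t - t1)"
    "norm (f t - f t1 - (t - t1) * deriv f t1) \<le> 2 * K / r^2 * norm (t - t1)^2"
proof -
  have sub: "cball x r \<subseteq> ball t1 (3 * r)" if "x \<in> cball t1 r" for x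
  proof
    fix w assume "w \<in> cball x r"
    then have "dist t1 w \<le> 2 * r" using that dist_triangle [of t1 w x] by (simp add: dist_commute)
    then show "w \<in> ball t1 (3 * r)" using r by simp
  qed
  have bound: "norm ((deriv ^^ n) f x) \<le> fact n * K / r ^ n" if "x \<in> cball t1 r" for n x
  proof (rule Cauchy_inequality)
    show "f holomorphic_on ball x r" "continuous_on (cball x r) f"
      using hol sub [OF that] ball_subset_cball
      by (meson holomorphic_on_subset subset_trans, meson holomorphic_on_imp_continuous_on continuous_on_subset)
    show "norm (f w) \<le> K" if "norm (x - w) = r" for w
      using K sub [OF \<open>x \<in> cball t1 r\<close>] that by (auto simp: dist_norm)
  qed (rule r)
  have der: "((deriv ^^ n) f has_field_derivative (deriv ^^ Suc n) f x) (at x within cball t1 r)"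
    if "x \<in> cball t1 r" for x n
  proof -
    have "x \<in> ball t1 (3 * r)" using that r by auto
    then have "((deriv ^^ n) f has_field_derivative deriv ((deriv ^^ n) f) x) (at x)"
      by (rule holomorphic_derivI [OF holomorphic_higher_deriv [OF hol open_ball] open_ball])
    then show ?thesis by (simp add: has_field_derivative_at_within)
  qed
  have t1: "t1 \<in> cball t1 r" using r by simp
  show "norm (f t - f t1) \<le> K / r * norm (t - t1)"
    using complex_Taylor [of "cball t1 r" 0 "\<lambda>n. (deriv ^^ n) f"
        "K / r" t1 t, OF convex_cball der _ t1 t]
      bound [where n = 1] by simp
  show "norm (f t - f t1 - (t - t1) * deriv f t1) \<le> 2 * K / r^2 * norm (t - t1)^2"
    using complex_Taylor [of "cball t1 r" 1 "\<lambda>n. (deriv ^^ n) f"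
        "2 * K / r^2" t1 t, OF convex_cball der _ t1 t]
      bound [where n = 2] by (simp add: numeral_2_eq_2 algebra_simps)
qed

text \<open>Solve the equation in t at z = z0, and then, for every t, the equation in z. To see that the
  result Phi also satisfies the equation in t for z different from z0, let R(z) = Phi(z, t) - Phi(z, t1)
  - (t - t1) D(z, t1) Phi(z, t1). By flatness R satisfies the linear equation in z up to an error of
  order (t - t1)^2, and R(z0) is of smaller order than t - t1; hence so is R(z).\<close>

lemma flat_frame_exists:
  fixes A D :: "complex \<Rightarrow> complex \<Rightarrow> complex^3^3"
  assumes e: "0 < e" "9 * K * e \<le> 1 / 20"
    and A: "\<And>z t. z \<in> ball z0 e \<Longrightarrow> t \<in> ball t0 e \<Longrightarrow>
        mnorm (A z t) \<le> K"
    and D: "\<And>z t. z \<in> ball z0 e \<Longrightarrow> t \<in> ball t0 e \<Longrightarrow>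
        mnorm (D z t) \<le> K"
    and Az: "\<And>t j k. t \<in> ball t0 e \<Longrightarrow>
        (\<lambda>z. A z t $ j $ k) holomorphic_on ball z0 e"
    and dA: "\<And>z t. z \<in> ball z0 e \<Longrightarrow> t \<in> ball t0 e \<Longrightarrow>
        has_matrix_derivative (\<lambda>t. A z t) (At z t) t"
    and dD: "\<And>z t. z \<in> ball z0 e \<Longrightarrow> t \<in> ball t0 e \<Longrightarrow>
        has_matrix_derivative (\<lambda>z. D z t) (Dz z t) z"
    and Dt: "\<And>j k. (\<lambda>t. D z0 t $ j $ k) holomorphic_on ball t0 e"
    and flat: "\<And>z t. z \<in> ball z0 e \<Longrightarrow> t \<in> ball t0 e \<Longrightarrow>
       At z t + A z t ** D z t = Dz z t + D z t ** A z t"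
  shows "\<exists>Phi. Phi z0 t0 = mat 1 \<and> (\<forall>z\<in>ball z0 e. \<forall>t\<in>ball t0 e.
      invertible (Phi z t) \<and>
     has_matrix_derivative (\<lambda>z. Phi z t) (A z t ** Phi z t) z \<and>
     has_matrix_derivative (\<lambda>t. Phi z t) (D z t ** Phi z t) t)"
proof -
  have z0: "z0 \<in> ball z0 e" and t0: "t0 \<in> ball t0 e" using e by auto
  have K: "0 \<le> K" using order_trans [OF mnorm_nonneg A [OF z0 t0]] .
  have e2: "9 * K * e \<le> 1 / 2" using e(2) by simp
  obtain P where P0: "P t0 = mat 1"
    and dP: "\<And>t. t \<in> ball t0 e \<Longrightarrow> has_matrix_derivative P (D z0 t ** P t) t"
    using linear_ode_exists [OF Dt D [OF z0] e(1) e2] by blast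
  have "\<exists>X. X z0 = mat 1 \<and> (\<forall>z\<in>ball z0 e. has_matrix_derivative X
      (A z t ** X z) z)" if "t \<in> ball t0 e" for t
    using linear_ode_exists [OF Az A e(1) e2] that by blast
  then obtain X where X0: "\<And>t. t \<in> ball t0 e \<Longrightarrow> X t z0 = mat 1"
    and dX: "\<And>t z. t \<in> ball t0 e \<Longrightarrow> z \<in> ball z0 e \<Longrightarrow>
        has_matrix_derivative (X t) (A z t ** X t z) z"
    by metis
  define Phi where "Phi z t = X t z ** P t" for z t
  have Phi0: "Phi z0 t = P t" if "t \<in> ball t0 e" for t
    by (simp add: Phi_def X0 [OF that])
  have dPhi: "has_matrix_derivative (\<lambda>z. Phi z t) (A z t ** Phi z t) z"
    if "z \<in> ball z0 e" "t \<in> ball t0 e" for z t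
    unfolding Phi_def using hmd_mult_const [OF dX [OF that(2,1)], of "P t"] by (simp add: matrix_mul_assoc)
  have Pbound: "mnorm (P t) \<le> 6" if t: "t \<in> ball t0 e" for t
  proof -
    have "mnorm (P t) \<le> 2 * (mnorm (P t0) + 9 * e * 0)"
      by (rule linear_ode_bound [where A = "D z0" and S = "\<lambda>_. 0", OF _ D [OF z0] _ e2 t])
        (simp_all add: dP)
    then show ?thesis by (simp add: P0 mnorm_one)
  qed
  have Phibound: "mnorm (Phi z t) \<le> 12" if z: "z \<in> ball z0 e" and t: "t \<in> ball t0 e" for z t
  proof -
    have "mnorm (Phi z t) \<le> 2 * (mnorm (Phi z0 t) + 9 * e * 0)"
      by (rule linear_ode_bound [where R = "\<lambda>z. Phi z t" and A = "\<lambda>z. A z t" and S =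
          "\<lambda>_. 0", OF _ A [OF _ t] _ e2 z])
        (simp only: add_0_right, rule dPhi [OF _ t], simp_all)
    then show ?thesis using Pbound [OF t] by (simp add: Phi0 [OF t])
  qed
  \<comment> \<open>on the polydisc Phi differs from 1 by at most (6 + 12) 9 K e, hence by at most
    18/20\<close>
  have inv: "invertible (Phi z t)" if z: "z \<in> ball z0 e" and t: "t \<in> ball t0 e" for z t
  proof (rule invertible_near_one)
    have "mnorm (P t - P t0) \<le> 9 * (K * 6 * dist t0 t)"
    proof (rule mean_value_bound)
      fix w assume "w \<in> cball t0 (dist t0 t)"
      then have w: "w \<in> ball t0 e" using t by auto
      then show "has_matrix_derivative P (D z0 w ** P w) w" by (rule dP)
      show "mnorm (D z0 w ** P w) \<le> K * 6"
        by (rule order_trans [OF mnorm_mult mult_mono [OF D [OF z0 w] Pbound [OF w] K mnorm_nonneg]])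
    qed (use K in auto)
    also have "\<dots> \<le> 9 * (K * 6 * e)" using t K by (intro mult_left_mono) auto
    finally have 1: "mnorm (P t - mat 1) \<le> 6 * (9 * K * e)" by (simp add: P0)
    have "mnorm (Phi z t - Phi z0 t) \<le> 9 * (K * 12 * dist z0 z)"
    proof (rule mean_value_bound)
      fix w assume "w \<in> cball z0 (dist z0 z)"
      then have w: "w \<in> ball z0 e" using z by auto
      then show "has_matrix_derivative (\<lambda>z. Phi z t) (A w t ** Phi w t) w" by (rule dPhi [OF _ t])
      show "mnorm (A w t ** Phi w t) \<le> K * 12"
        by (rule order_trans [OF mnorm_mult mult_mono [OF A [OF w t] Phibound [OF w t] K mnorm_nonneg]])
    qed (use K in auto)
    also have "\<dots> \<le> 9 * (K * 12 * e)" using z K by (intro mult_left_mono) auto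
    finally have 2: "mnorm (Phi z t - P t) \<le> 12 * (9 * K * e)" by (simp add: Phi0 [OF t])
    have "Phi z t - mat 1 = (Phi z t - P t) + (P t - mat 1)" by simp
    then have "mnorm (Phi z t - mat 1) \<le> mnorm (Phi z t - P t) + mnorm (P t - mat 1)"
      by (metis mnorm_add)
    also have "\<dots> \<le> 12 * (9 * K * e) + 6 * (9 * K * e)" by (rule add_mono [OF 2 1])
    also have "\<dots> = 18 * (9 * K * e)" by simp
    also have "\<dots> \<le> 18 * (1 / 20)" using e(2) by (rule mult_left_mono) simp
    finally show "mnorm (Phi z t - mat 1) < 1" by simp
  qed
  have dt: "has_matrix_derivative (\<lambda>t. Phi z t) (D z t1 ** Phi z t1) t1"
    if z: "z \<in> ball z0 e" and t1: "t1 \<in> ball t0 e" for z t1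
    unfolding has_matrix_derivative_def
  proof (intro allI)
    fix j k
    define r where "r = (e - dist t0 t1) / 3"
    have r: "0 < r" using t1 by (simp add: r_def)
    have sub: "ball t1 (3 * r) \<subseteq> ball t0 e"
    proof
      fix w assume "w \<in> ball t1 (3 * r)"
      then show "w \<in> ball t0 e" using dist_triangle [of t0 w t1] by (simp add: r_def)
    qed
    define C where "C = 9 * (2 * K / r^2) * 12 + 9 * (K / r) * (K * 12)"
    have C: "0 \<le> C" using K r by (simp add: C_def)
    define R where "R t w = Phi w t - Phi w t1 - mat_scale (t - t1) (D w t1 ** Phi w t1)" for t w
    define S where "S t w = (A w t - A w t1 - mat_scale (t - t1) (At w t1)) ** Phi w t1
       + mat_scale (t - t1) ((A w t - A w t1) ** (D w t1 ** Phi w t1))" for t w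
    have Rbound: "mnorm (R t z) \<le> 2 * (mnorm (R t z0) + 9 * e * (C * norm (t - t1)^2))" if t:
        "t \<in> cball t1 r" for t
    proof (rule linear_ode_bound [OF _ _ _ e2 z])
      have t': "t \<in> ball t1 (3 * r)" using t r by auto
      then have te: "t \<in> ball t0 e" using sub by blast
      fix w assume w: "w \<in> ball z0 e"
      show "mnorm (A w t) \<le> K" by (rule A [OF w te])
      have hol: "(\<lambda>t. A w t $ j $ k) holomorphic_on ball t1 (3 * r)" for j k
        by (rule holomorphic_on_subset [OF hmd_holomorphic [OF dA [OF w]] sub])
      have bd: "norm (A w t $ j $ k) \<le> K" if "t \<in> ball t1 (3 * r)" for t j k
        by (rule order_trans [OF norm_entry_le A [OF w]]) (use that sub in blast)
      have deriv: "deriv (\<lambda>t. A w t $ j $ k) t1 = At w t1 $ j $ k" for j k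
        by (rule DERIV_imp_deriv [OF hmd_entry [OF dA [OF w t1]]])
      have 1: "mnorm (A w t - A w t1) \<le> 9 * (K / r * norm (t - t1))"
        by (rule mnorm_le) (use taylor_bounds(1) [OF hol r bd t] in simp)
      have 2: "mnorm (A w t - A w t1 - mat_scale (t - t1) (At w t1)) \<le> 9 * (2 * K / r^2 * norm (t - t1)^2)"
        by (rule mnorm_le) (use taylor_bounds(2) [OF hol r bd t] in \<open>simp add: deriv
            mat_scale_def\<close>)
      have "mnorm (S t w) \<le> 9 * (2 * K / r^2 * norm (t - t1)^2) * 12
         + norm (t - t1) * (9 * (K / r * norm (t - t1)) * (K * 12))"
        unfolding S_def
      proof (rule order_trans [OF mnorm_add], rule add_mono)
        show "mnorm ((A w t - A w t1 - mat_scale (t - t1) (At w t1)) ** Phi w t1)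
           \<le> 9 * (2 * K / r^2 * norm (t - t1)^2) * 12"
          by (rule order_trans [OF mnorm_mult], rule mult_mono [OF 2 Phibound [OF w t1]])
            (use K r in auto)
        have "mnorm (D w t1 ** Phi w t1) \<le> K * 12"
          by (rule order_trans [OF mnorm_mult mult_mono [OF D [OF w t1] Phibound [OF w t1] K mnorm_nonneg]])
        then have "mnorm ((A w t - A w t1) ** (D w t1 ** Phi w t1))
            \<le> 9 * (K / r * norm (t - t1)) * (K * 12)"
          by (intro order_trans [OF mnorm_mult mult_mono [OF 1]]) (use K r in auto)
        then show "mnorm (mat_scale (t - t1) ((A w t - A w t1) ** (D w t1 ** Phi w t1)))
           \<le> norm (t - t1) * (9 * (K / r * norm (t - t1)) * (K * 12))"
          unfolding mnorm_scale by (rule mult_left_mono) simp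
      qed
      also have "\<dots> = C * norm (t - t1)^2"
        by (simp add: C_def power2_eq_square algebra_simps)
      finally show "mnorm (S t w) \<le> C * norm (t - t1)^2" .
      have "has_matrix_derivative (R t) (A w t ** Phi w t - A w t1 ** Phi w t1
         - mat_scale (t - t1) (Dz w t1 ** Phi w t1 + D w t1 ** (A w t1 ** Phi w t1))) w"
        unfolding R_def [abs_def]
        by (intro hmd_diff hmd_scale hmd_mult dPhi dD w te t1)
      also have "A w t ** Phi w t - A w t1 ** Phi w t1
         - mat_scale (t - t1) (Dz w t1 ** Phi w t1 + D w t1 ** (A w t1 ** Phi w t1)) = A w t ** R t w + S t w"
      proof -
        have "Dz w t1 ** Phi w t1 + D w t1 ** (A w t1 ** Phi w t1) = (Dz w t1 + D w t1 ** A w t1) ** Phi w t1"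
          by (simp add: matrix_add_distrib matrix_mul_assoc)
        also have "\<dots> = At w t1 ** Phi w t1 + A w t1 ** (D w t1 ** Phi w t1)"
          by (simp add: flat [OF w t1, symmetric] matrix_add_distrib matrix_mul_assoc)
        finally show ?thesis
          by (simp add: R_def S_def matrix_diff_distrib matrix_add_distrib mat_scale_add mat_scale_mult)
      qed
      finally show "has_matrix_derivative (R t) (A w t ** R t w + S t w) w" .
    qed
    have R0: "((\<lambda>t. mnorm (R t z0) / norm (t - t1)) \<longlongrightarrow> 0) (at t1)"
    proof -
      have "((\<lambda>t. norm (R t z0 $ j $ k) / norm (t - t1)) \<longlongrightarrow> 0) (at t1)" for j k
      proof -
        have "((\<lambda>t. (P t $ j $ k - P t1 $ j $ k) / (t - t1)
            - (D z0 t1 ** P t1) $ j $ k) \<longlongrightarrow> 0) (at t1)"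
          using hmd_entry [OF dP [OF t1], of j k] unfolding has_field_derivative_iff by (rule LIM_zero)
        then have "((\<lambda>t. norm ((P t $ j $ k - P t1 $ j $ k) / (t - t1)
            - (D z0 t1 ** P t1) $ j $ k)) \<longlongrightarrow> 0) (at t1)"
          by (rule tendsto_norm_zero)
        then show ?thesis
        proof (rule Lim_transform_within [OF _ r])
          fix t assume t: "0 < dist t t1" "dist t t1 < r"
          then have te: "t \<in> ball t0 e" using sub r by (intro subsetD [OF sub]) (simp add: dist_commute)
          have "R t z0 $ j $ k = (P t $ j $ k - P t1 $ j $ k) - (t - t1) * (D z0 t1 ** P t1) $ j $ k"
            by (simp add: R_def Phi0 [OF t1] Phi0 [OF te] mat_scale_def)
          also have "\<dots> = (t - t1) * ((P t $ j $ k - P t1 $ j $ k) / (t - t1) - (D z0 t1 ** P t1) $ j $ k)"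
            using t by (simp only: right_diff_distrib) simp
          finally show "norm ((P t $ j $ k - P t1 $ j $ k) / (t - t1) - (D z0 t1 ** P t1) $ j $ k)
             = norm (R t z0 $ j $ k) / norm (t - t1)"
            using t by (simp add: norm_mult)
        qed
      qed
      then have "((\<lambda>t. \<Sum>j\<in>UNIV. \<Sum>k\<in>UNIV. norm (R t z0 $ j $ k) / norm (t
          - t1)) \<longlongrightarrow> (\<Sum>j\<in>(UNIV::3 set). \<Sum>k\<in>(UNIV::3 set). 0)) (at t1)"
        by (intro tendsto_sum)
      then show ?thesis by (simp add: mnorm_def sum_divide_distrib)
    qed
    have lim: "((\<lambda>t. 2 * (mnorm (R t z0) / norm (t - t1)
        + 9 * e * (C * norm (t - t1)))) \<longlongrightarrow> 2 * (0 + 9 * e * (C * norm (t1 - t1)))) (at t1)"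
      by (intro tendsto_intros R0)
    have "((\<lambda>t. (Phi z t $ j $ k - Phi z t1 $ j $ k) / (t - t1)
        - (D z t1 ** Phi z t1) $ j $ k) \<longlongrightarrow> 0) (at t1)"
    proof (rule Lim_null_comparison)
      show "((\<lambda>t. 2 * (mnorm (R t z0) / norm (t - t1)
          + 9 * e * (C * norm (t - t1)))) \<longlongrightarrow> 0) (at t1)"
        using lim by simp
      show "\<forall>\<^sub>F t in at t1. norm ((Phi z t $ j $ k - Phi z t1 $ j $ k) / (t - t1)
          - (D z t1 ** Phi z t1) $ j $ k)
         \<le> 2 * (mnorm (R t z0) / norm (t - t1) + 9 * e * (C * norm (t - t1)))"
        unfolding eventually_at
      proof (intro exI [of _ r] conjI r ballI impI)
        fix t assume t: "t \<noteq> t1 \<and> dist t t1 < r"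
        then have nz: "t - t1 \<noteq> 0" by simp
        have "(Phi z t $ j $ k - Phi z t1 $ j $ k) / (t - t1) - (D z t1 ** Phi z t1) $ j $ k
            = R t z $ j $ k / (t - t1)"
          using nz by (simp add: R_def mat_scale_def diff_divide_distrib)
        then have "norm ((Phi z t $ j $ k - Phi z t1 $ j $ k) / (t - t1) - (D z t1 ** Phi z t1) $ j $ k)
           = norm (R t z $ j $ k) / norm (t - t1)" by (simp add: norm_divide)
        also have "\<dots> \<le> 2 * (mnorm (R t z0) + 9 * e * (C * norm (t - t1)^2)) / norm (t - t1)"
          by (rule divide_right_mono [OF order_trans [OF norm_entry_le Rbound]])
            (use t in \<open>auto simp: dist_commute\<close>)
        also have "\<dots> = 2 * (mnorm (R t z0) / norm (t - t1) + 9 * e * (C * norm (t - t1)))"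
          using nz by (simp add: add_divide_distrib power2_eq_square algebra_simps)
        finally show "norm ((Phi z t $ j $ k - Phi z t1 $ j $ k) / (t - t1) - (D z t1 ** Phi z t1) $ j $ k)
         \<le> 2 * (mnorm (R t z0) / norm (t - t1) + 9 * e * (C * norm (t - t1)))" .
      qed
    qed
    then show "((\<lambda>t. Phi z t $ j $ k) has_field_derivative (D z t1 ** Phi z t1) $ j $ k) (at t1)"
      unfolding has_field_derivative_iff by (rule LIM_zero_cancel)
  qed
  show ?thesis
    by (rule exI [of _ Phi]) (use inv dPhi dt P0 Phi0 t0 in auto)
qed

section \<open>Flat sections and parallel transport\<close>

lemma matrix_inv_cancel:
  assumes "invertible M"
  shows "matrix_inv M ** M = mat 1" "M ** matrix_inv M = mat 1"
  using someI_ex [OF assms [unfolded invertible_def]] by (simp_all add: matrix_inv_def)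

lemma matrix_inv_eq:
  fixes M :: "complex^3^3"
  assumes "M ** N = mat 1"
  shows "matrix_inv M = N" "invertible M"
proof -
  have NM: "N ** M = mat 1" using assms matrix_left_right_inverse by blast
  then show inv: "invertible M" using assms by (auto simp: invertible_def)
  have "matrix_inv M = N ** M ** matrix_inv M" by (simp add: NM)
  then show "matrix_inv M = N" by (simp add: matrix_mul_assoc [symmetric] matrix_inv_cancel [OF inv])
qed

lemma matrix_inv_mult:
  fixes M N :: "complex^3^3"
  assumes "invertible M" "invertible N"
  shows "matrix_inv (M ** N) = matrix_inv N ** matrix_inv M" "invertible (M ** N)"
proof -
  have "M ** N ** (matrix_inv N ** matrix_inv M) = M ** (N ** matrix_inv N) ** matrix_inv M"
    by (simp only: matrix_mul_assoc)
  then have "M ** N ** (matrix_inv N ** matrix_inv M) = mat 1"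
    by (simp add: matrix_inv_cancel assms)
  then show "matrix_inv (M ** N) = matrix_inv N ** matrix_inv M" "invertible (M ** N)"
    by (rule matrix_inv_eq)+
qed

lemma invertible_matrix_inv:
  fixes M :: "complex^3^3"
  shows "invertible M \<Longrightarrow> invertible (matrix_inv M)"
  using matrix_inv_cancel unfolding invertible_def by blast

definition flat_frame ::
  "(complex \<Rightarrow> complex \<Rightarrow> complex^3^3) \<Rightarrow>
      (complex \<Rightarrow> complex \<Rightarrow> complex^3^3) \<Rightarrow>
     complex set \<Rightarrow> complex set \<Rightarrow>
         (complex \<Rightarrow> complex \<Rightarrow> complex^3^3) \<Rightarrow> bool" where
  "flat_frame A D N M Phi \<longleftrightarrow> (\<forall>z\<in>N. \<forall>t\<in>M. invertible (Phi z t) \<and>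
     has_matrix_derivative (\<lambda>z. Phi z t) (A z t ** Phi z t) z \<and>
     has_matrix_derivative (\<lambda>t. Phi z t) (D z t ** Phi z t) t)"

text \<open>A continuation of flat frames along a map H from a parameter space: locally it is the
  pullback of a flat frame. The parameter space will be an interval or a square.\<close>

definition flat_section ::
  "(complex \<Rightarrow> complex \<Rightarrow> complex^3^3) \<Rightarrow>
      (complex \<Rightarrow> complex \<Rightarrow> complex^3^3) \<Rightarrow>
     ('p::topological_space \<Rightarrow> complex \<times> complex) \<Rightarrow> 'p set \<Rightarrow>
         ('p \<Rightarrow> complex^3^3) \<Rightarrow> bool" where
  "flat_section A D H S Y \<longleftrightarrow> (\<forall>q\<in>S. \<exists>T N M Phi. open T \<and>
      q \<in> T \<and> open N \<and> open M \<and>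
     flat_frame A D N M Phi \<and>
     (\<forall>p\<in>S \<inter> T. fst (H p) \<in> N \<and> snd (H p) \<in> M \<and>
         Y p = Phi (fst (H p)) (snd (H p))))"

lemma flat_frame_subset:
  "flat_frame A D N M Phi \<Longrightarrow> N' \<subseteq> N \<Longrightarrow>
      M' \<subseteq> M \<Longrightarrow> flat_frame A D N' M' Phi"
  unfolding flat_frame_def by blast

lemma flat_frame_mult:
  assumes "flat_frame A D N M Phi" "invertible C"
  shows "flat_frame A D N M (\<lambda>z t. Phi z t ** C)"
  using assms unfolding flat_frame_def matrix_mul_assoc by (simp add: matrix_inv_mult(2) hmd_mult_const)

lemma flat_sectionE:
  assumes "flat_section A D H S Y" "q \<in> S"
  obtains T N M Phi where "open T" "q \<in> T" "open N" "open M" "flat_frame A D N M Phi"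
    "\<forall>p\<in>S \<inter> T. fst (H p) \<in> N \<and> snd (H p) \<in> M \<and>
        Y p = Phi (fst (H p)) (snd (H p))"
  using bspec [OF assms(1) [unfolded flat_section_def] assms(2)] by (elim exE conjE) (rule that)

lemma flat_section_subset:
  assumes "flat_section A D H S Y" "S' \<subseteq> S"
  shows "flat_section A D H S' Y"
  unfolding flat_section_def
proof
  fix q assume "q \<in> S'"
  then have "q \<in> S" using assms(2) by auto
  with assms(1) obtain T N M Phi where *: "open T" "q \<in> T" "open N" "open M" "flat_frame A D N M Phi"
    "\<forall>p\<in>S \<inter> T. fst (H p) \<in> N \<and> snd (H p) \<in> M \<and>
        Y p = Phi (fst (H p)) (snd (H p))"
    by (rule flat_sectionE)
  then show "\<exists>T N M Phi. open T \<and> q \<in> T \<and> open N \<and> open M \<and>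
      flat_frame A D N M Phi \<and>
     (\<forall>p\<in>S' \<inter> T. fst (H p) \<in> N \<and> snd (H p) \<in> M \<and>
         Y p = Phi (fst (H p)) (snd (H p)))"
    by (intro exI [of _ T] exI [of _ N] exI [of _ M] exI [of _ Phi] conjI * ballI)
      (use *(6) assms(2) in auto)
qed

lemma flat_section_invertible:
  assumes "flat_section A D H S Y" "q \<in> S"
  shows "invertible (Y q)"
proof -
  obtain T N M Phi where "q \<in> T" "flat_frame A D N M Phi"
    "\<forall>p\<in>S \<inter> T. fst (H p) \<in> N \<and> snd (H p) \<in> M \<and>
        Y p = Phi (fst (H p)) (snd (H p))"
    by (rule flat_sectionE [OF assms])
  with assms(2) show ?thesis by (simp add: flat_frame_def)
qed

lemma flat_section_mult:
  assumes "flat_section A D H S Y" "invertible C"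
  shows "flat_section A D H S (\<lambda>q. Y q ** C)"
  unfolding flat_section_def
proof
  fix q assume "q \<in> S"
  with assms(1) obtain T N M Phi where *: "open T" "q \<in> T" "open N" "open M" "flat_frame A D N M Phi"
    "\<forall>p\<in>S \<inter> T. fst (H p) \<in> N \<and> snd (H p) \<in> M \<and>
        Y p = Phi (fst (H p)) (snd (H p))"
    by (rule flat_sectionE)
  show "\<exists>T N M Phi. open T \<and> q \<in> T \<and> open N \<and> open M \<and>
      flat_frame A D N M Phi \<and>
     (\<forall>p\<in>S \<inter> T. fst (H p) \<in> N \<and> snd (H p) \<in> M \<and>
         Y p ** C = Phi (fst (H p)) (snd (H p)))"
    by (rule exI [of _ T], rule exI [of _ N], rule exI [of _ M], rule exI [of _ "\<lambda>z t. Phi z t ** C"])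
      (use * flat_frame_mult [OF *(5) assms(2)] in auto)
qed

lemma flat_section_compose:
  assumes Y: "flat_section A D H S Y" and f: "continuous_on S' f" "f ` S' \<subseteq> S"
    and H': "\<And>p. p \<in> S' \<Longrightarrow> H (f p) = H' p"
  shows "flat_section A D H' S' (\<lambda>p. Y (f p))"
  unfolding flat_section_def
proof
  fix q assume q: "q \<in> S'"
  then have "f q \<in> S" using f by auto
  with Y obtain T N M Phi where *: "open T" "f q \<in> T" "open N" "open M" "flat_frame A D N M Phi"
    "\<forall>p\<in>S \<inter> T. fst (H p) \<in> N \<and> snd (H p) \<in> M \<and>
        Y p = Phi (fst (H p)) (snd (H p))"
    by (rule flat_sectionE)
  obtain T' where T': "open T'" "T' \<inter> S' = f -` T \<inter> S'"
    using f(1) *(1) unfolding continuous_on_open_invariant by blast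
  show "\<exists>T N M Phi. open T \<and> q \<in> T \<and> open N \<and> open M \<and>
      flat_frame A D N M Phi \<and>
     (\<forall>p\<in>S' \<inter> T. fst (H' p) \<in> N \<and> snd (H' p) \<in> M \<and>
         Y (f p) = Phi (fst (H' p)) (snd (H' p)))"
  proof (rule exI [of _ T'], rule exI [of _ N], rule exI [of _ M], rule exI [of _ Phi], intro conjI ballI)
    show "q \<in> T'" using T' q *(2) by blast
    fix p assume "p \<in> S' \<inter> T'"
    then have "p \<in> S'" "f p \<in> S" "f p \<in> T" using T' f by blast+
    then show "fst (H' p) \<in> N" "snd (H' p) \<in> M" "Y (f p) = Phi (fst (H' p)) (snd (H' p))"
      using bspec [OF *(6), of "f p"] H' [of p] by auto
  qed (use T' * in auto)
qed

locale flat_connection =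
  fixes A D :: "complex \<Rightarrow> complex \<Rightarrow> complex^3^3" and X ::
      "(complex \<times> complex) set"
  assumes locally_bounded: "(z0, t0) \<in> X \<Longrightarrow>
      \<exists>e>0. \<exists>K. \<forall>z\<in>ball z0 e. \<forall>t\<in>ball t0 e. mnorm (A z t)
          \<le> K \<and> mnorm (D z t) \<le> K"
    and local_frame: "(z0, t0) \<in> X \<Longrightarrow> \<exists>e>0. \<exists>Phi. flat_frame A D
        (ball z0 e) (ball t0 e) Phi"
begin

text \<open>The difference of the two frames solves linear equations with initial value 0, first in t
  and then in z.\<close>

lemma frame_unique:
  assumes X: "(z0, t0) \<in> X"
    and N: "open N" "z0 \<in> N" and M: "open M" "t0 \<in> M"
    and Phi: "flat_frame A D N M Phi" and Psi: "flat_frame A D N M Psi" and eq: "Phi z0 t0 = Psi z0 t0"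
  shows "\<exists>e>0. ball z0 e \<subseteq> N \<and> ball t0 e \<subseteq> M \<and>
      (\<forall>z\<in>ball z0 e. \<forall>t\<in>ball t0 e. Phi z t = Psi z t)"
proof -
  obtain e0 K where e0: "e0 > 0"
    "\<And>z t. z \<in> ball z0 e0 \<Longrightarrow> t \<in> ball t0 e0 \<Longrightarrow> mnorm (A z t) \<le> K"
    "\<And>z t. z \<in> ball z0 e0 \<Longrightarrow> t \<in> ball t0 e0 \<Longrightarrow> mnorm (D z t) \<le> K"
    using locally_bounded [OF X] by blast
  obtain e1 where e1: "e1 > 0" "ball z0 e1 \<subseteq> N" using N open_contains_ball by blast
  obtain e2 where e2: "e2 > 0" "ball t0 e2 \<subseteq> M" using M open_contains_ball by blast
  have K: "0 \<le> K" by (rule order_trans [OF mnorm_nonneg e0(2) [of z0 t0]]) (use e0 in auto)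
  \<comment> \<open>the last entry makes 9 K e at most 1/2, as required for the bound on linear
    equations\<close>
  define e where "e = Min {e0, e1, e2, 1 / (18 * (K + 1))}"
  have e: "e > 0" "e \<le> e0" "e \<le> e1" "e \<le> e2" "e \<le> 1 / (18 * (K + 1))"
    using e0 e1 e2 K by (simp_all add: e_def)
  have "K * e \<le> (K + 1) * (1 / (18 * (K + 1)))"
    using e K by (intro mult_mono) auto
  also have "\<dots> = 1 / 18" using K by (simp add: field_simps)
  finally have Ke: "9 * K * e \<le> 1 / 2" by simp
  have sub: "ball z0 e \<subseteq> N" "ball t0 e \<subseteq> M" "ball z0 e \<subseteq> ball z0 e0"
      "ball t0 e \<subseteq> ball t0 e0"
    using e e1 e2 by (meson subset_ball subset_trans)+
  have z0: "z0 \<in> ball z0 e" and t0: "t0 \<in> ball t0 e" using e by auto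
  note F = Phi [unfolded flat_frame_def, rule_format] Psi [unfolded flat_frame_def, rule_format]
  have 1: "Phi z0 t = Psi z0 t" if t: "t \<in> ball t0 e" for t
  proof -
    have "mnorm (Phi z0 t - Psi z0 t) \<le> 2 * (mnorm (Phi z0 t0 - Psi z0 t0) + 9 * e * 0)"
    proof (rule linear_ode_bound [where R = "\<lambda>t. Phi z0 t - Psi z0 t" and A = "D z0" and S =
        "\<lambda>_. 0", OF _ _ _ Ke t])
      fix s assume s: "s \<in> ball t0 e"
      show "mnorm (D z0 s) \<le> K" using e0(3) [of z0 s] s z0 sub by blast
      show "has_matrix_derivative (\<lambda>t. Phi z0 t - Psi z0 t) (D z0 s ** (Phi z0 s - Psi z0 s) + 0) s"
        unfolding matrix_diff_distrib add_0_right
        using F [of z0 s] z0 s sub by (intro hmd_diff) blast+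
    qed simp
    then have "mnorm (Phi z0 t - Psi z0 t) = 0" by (simp add: eq order_antisym)
    then show ?thesis using mnorm_eq_0 by fastforce
  qed
  have "Phi z t = Psi z t" if z: "z \<in> ball z0 e" and t: "t \<in> ball t0 e" for z t
  proof -
    have "mnorm (Phi z t - Psi z t) \<le> 2 * (mnorm (Phi z0 t - Psi z0 t) + 9 * e * 0)"
    proof (rule linear_ode_bound [where R = "\<lambda>z. Phi z t - Psi z t" and A =
        "\<lambda>z. A z t" and S = "\<lambda>_. 0", OF _ _ _ Ke z])
      fix s assume s: "s \<in> ball z0 e"
      show "mnorm (A s t) \<le> K" using e0(2) [of s t] s t sub by blast
      show "has_matrix_derivative (\<lambda>z. Phi z t - Psi z t) (A s t ** (Phi s t - Psi s t) + 0) s"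
        unfolding matrix_diff_distrib add_0_right
        using F [of s t] t s sub by (intro hmd_diff) blast+
    qed simp
    then have "mnorm (Phi z t - Psi z t) = 0" by (simp add: 1 [OF t] order_antisym)
    then show ?thesis using mnorm_eq_0 by fastforce
  qed
  then show ?thesis using e(1) sub by blast
qed

text \<open>Near a parameter where they are related by C, both sections are pullbacks of one
  frame.\<close>

lemma sections_locally_equal:
  assumes H: "continuous_on S H" "H ` S \<subseteq> X" and S1: "flat_section A D H S1 Y1" "S1 \<subseteq> S"
    and S2: "flat_section A D H S2 Y2" "S2 \<subseteq> S"
    and q: "q \<in> S1" "q \<in> S2" and C: "invertible C" "Y1 q = Y2 q ** C"
  obtains T N M Phi where "open T" "q \<in> T" "open N" "open M" "flat_frame A D N M Phi"
    "\<forall>p\<in>S \<inter> T. fst (H p) \<in> N \<and> snd (H p) \<in> M \<and>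
      (p \<in> S1 \<longrightarrow> Y1 p = Phi (fst (H p)) (snd (H p))) \<and>
      (p \<in> S2 \<longrightarrow> Y2 p ** C = Phi (fst (H p)) (snd (H p)))"
proof -
  obtain T1 N1 M1 Phi where 1: "open T1" "q \<in> T1" "open N1" "open M1" "flat_frame A D N1 M1 Phi"
    "\<forall>p\<in>S1 \<inter> T1. fst (H p) \<in> N1 \<and> snd (H p) \<in> M1 \<and>
        Y1 p = Phi (fst (H p)) (snd (H p))"
    by (rule flat_sectionE [OF S1(1) q(1)])
  obtain T2 N2 M2 Psi where 2: "open T2" "q \<in> T2" "open N2" "open M2" "flat_frame A D N2 M2 Psi"
    "\<forall>p\<in>S2 \<inter> T2. fst (H p) \<in> N2 \<and> snd (H p) \<in> M2 \<and>
        Y2 p ** C = Psi (fst (H p)) (snd (H p))"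
    by (rule flat_sectionE [OF flat_section_mult [OF S2(1) C(1)] q(2)])
  obtain z0 t0 where Hq: "H q = (z0, t0)" by fastforce
  have X: "(z0, t0) \<in> X" using H(2) q(1) S1(2) Hq by force
  have "\<exists>e>0. ball z0 e \<subseteq> N1 \<inter> N2 \<and>
      ball t0 e \<subseteq> M1 \<inter> M2 \<and> (\<forall>z\<in>ball z0 e. \<forall>t\<in>ball t0 e. Phi
      z t = Psi z t)"
  proof (rule frame_unique [OF X])
    show "z0 \<in> N1 \<inter> N2" "t0 \<in> M1 \<inter> M2" "Phi z0 t0 = Psi z0 t0"
      using bspec [OF 1(6), of q] bspec [OF 2(6), of q] 1(2) 2(2) q C(2) Hq by auto
    show "flat_frame A D (N1 \<inter> N2) (M1 \<inter> M2) Phi" by (rule flat_frame_subset [OF 1(5)]) auto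
    show "flat_frame A D (N1 \<inter> N2) (M1 \<inter> M2) Psi" by (rule flat_frame_subset [OF 2(5)]) auto
  qed (intro open_Int 1 2)+
  then obtain e where e: "e > 0" "ball z0 e \<subseteq> N1 \<inter> N2" "ball t0 e \<subseteq> M1 \<inter> M2"
    "\<And>z t. z \<in> ball z0 e \<Longrightarrow> t \<in> ball t0 e \<Longrightarrow>
        Phi z t = Psi z t" by blast
  have "open (ball z0 e \<times> ball t0 e)" by (simp add: open_Times)
  then obtain T where T: "open T" "T \<inter> S = H -` (ball z0 e \<times> ball t0 e) \<inter> S"
    using H(1) unfolding continuous_on_open_invariant by blast
  have HT: "fst (H p) \<in> ball z0 e" "snd (H p) \<in> ball t0 e" if "p \<in> S" "p \<in> T" for p
  proof -
    have "H p \<in> ball z0 e \<times> ball t0 e" using that T by blast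
    then show "fst (H p) \<in> ball z0 e" "snd (H p) \<in> ball t0 e" by (auto simp: mem_Times_iff)
  qed
  show ?thesis
  proof (rule that)
    show "open (T \<inter> (T1 \<inter> T2))" by (intro open_Int T(1) 1(1) 2(1))
    have "q \<in> T" using T(2) q S1(2) Hq e(1) by auto
    then show "q \<in> T \<inter> (T1 \<inter> T2)" using 1(2) 2(2) by blast
    show "flat_frame A D (ball z0 e) (ball t0 e) Phi"
      by (rule flat_frame_subset [OF 1(5)]) (use e in auto)
    show "\<forall>p\<in>S \<inter> (T \<inter> (T1 \<inter> T2)). fst (H p) \<in> ball z0 e \<and>
        snd (H p) \<in> ball t0 e \<and>
      (p \<in> S1 \<longrightarrow> Y1 p = Phi (fst (H p)) (snd (H p))) \<and>
      (p \<in> S2 \<longrightarrow> Y2 p ** C = Phi (fst (H p)) (snd (H p)))"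
    proof (intro ballI conjI impI)
      fix p assume p: "p \<in> S \<inter> (T \<inter> (T1 \<inter> T2))"
      then show Hp: "fst (H p) \<in> ball z0 e" "snd (H p) \<in> ball t0 e" using HT by blast+
      show "Y1 p = Phi (fst (H p)) (snd (H p))" if "p \<in> S1" using 1(6) that p by blast
      show "Y2 p ** C = Phi (fst (H p)) (snd (H p))" if "p \<in> S2"
        using bspec [OF 2(6), of p] that p e(4) [OF Hp] by auto
    qed
  qed (rule open_ball)+
qed

text \<open>The quotient of two sections is locally constant.\<close>

lemma section_ratio_constant:
  assumes H: "continuous_on S H" "H ` S \<subseteq> X" and S: "connected S"
    and Y: "flat_section A D H S Y" and Y': "flat_section A D H S Y'" and q: "q0 \<in> S" "q \<in> S"
  shows "Y q = Y' q ** (matrix_inv (Y' q0) ** Y q0)"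
proof -
  note inv = flat_section_invertible [OF Y] flat_section_invertible [OF Y']
  have "matrix_inv (Y' q0) ** Y q0 = matrix_inv (Y' q) ** Y q"
  proof (rule connected_local_const [OF S q], intro ballI)
    fix r assume r: "r \<in> S"
    let ?C = "matrix_inv (Y' r) ** Y r"
    have C: "invertible ?C" by (intro matrix_inv_mult(2) invertible_matrix_inv inv r)
    have eq: "Y r = Y' r ** ?C" by (simp add: matrix_mul_assoc matrix_inv_cancel [OF inv(2) [OF r]])
    obtain T N M Phi where T: "open T" "r \<in> T" and "open N" "open M" "flat_frame A D N M Phi"
      and *: "\<forall>p\<in>S \<inter> T. fst (H p) \<in> N \<and> snd (H p) \<in> M \<and>
        (p \<in> S \<longrightarrow> Y p = Phi (fst (H p)) (snd (H p))) \<and>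
        (p \<in> S \<longrightarrow> Y' p ** ?C = Phi (fst (H p)) (snd (H p)))"
      by (rule sections_locally_equal [OF H Y order_refl Y' order_refl r r C eq])
    have "?C = matrix_inv (Y' p) ** Y p" if "p \<in> S \<inter> T" for p
    proof -
      have "Y p = Y' p ** ?C" using bspec [OF * that] that by simp
      then show ?thesis
        using that by (simp add: matrix_mul_assoc matrix_inv_cancel [OF inv(2)])
    qed
    then show "\<forall>\<^sub>F p in at r within S. ?C = matrix_inv (Y' p) ** Y p"
      unfolding eventually_at_topological using T by blast
  qed
  then show ?thesis
    using q by (simp add: matrix_mul_assoc matrix_inv_cancel [OF inv(2)])
qed

lemma sections_glue:
  assumes H: "continuous_on (S1 \<union> S2) H" "H ` (S1 \<union> S2) \<subseteq> X" and closed: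
      "closed S1" "closed S2"
    and Y1: "flat_section A D H S1 Y1" and Y2: "flat_section A D H S2 Y2"
    and eq: "\<And>q. q \<in> S1 \<inter> S2 \<Longrightarrow> Y1 q = Y2 q"
  shows "flat_section A D H (S1 \<union> S2) (\<lambda>q. if q \<in> S1 then Y1 q else Y2 q)"
  unfolding flat_section_def
proof
  let ?Y = "\<lambda>q. if q \<in> S1 then Y1 q else Y2 q"
  fix q assume q: "q \<in> S1 \<union> S2"
  have one: "invertible (mat 1 :: complex^3^3)" by (rule matrix_inv_eq(2) [of _ "mat 1"]) simp
  consider "q \<in> S1 \<inter> S2" | "q \<in> S1 - S2" | "q \<in> S2 - S1" using q by blast
  then show "\<exists>T N M Phi. open T \<and> q \<in> T \<and> open N \<and> open M \<and>
      flat_frame A D N M Phi \<and>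
     (\<forall>p\<in>(S1 \<union> S2) \<inter> T. fst (H p) \<in> N \<and> snd (H p) \<in> M \<and>
         ?Y p = Phi (fst (H p)) (snd (H p)))"
  proof cases
    case 1
    then have q: "q \<in> S1" "q \<in> S2" by auto
    have eq1: "Y1 q = Y2 q ** mat 1" using eq [OF 1] by simp
    obtain T N M Phi where *: "open T" "q \<in> T" "open N" "open M" "flat_frame A D N M Phi"
      "\<forall>p\<in>(S1 \<union> S2) \<inter> T. fst (H p) \<in> N \<and> snd (H p) \<in> M \<and>
      (p \<in> S1 \<longrightarrow> Y1 p = Phi (fst (H p)) (snd (H p))) \<and>
      (p \<in> S2 \<longrightarrow> Y2 p ** mat 1 = Phi (fst (H p)) (snd (H p)))"
      by (rule sections_locally_equal [OF H Y1 Un_upper1 Y2 Un_upper2 q one eq1])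
    show ?thesis
      by (intro exI [of _ T] exI [of _ N] exI [of _ M] exI [of _ Phi] conjI *(1-5))
        (use *(6) in auto)
  next
    case 2
    then have "q \<in> S1" by auto
    with Y1 obtain T N M Phi where *: "open T" "q \<in> T" "open N" "open M" "flat_frame A D N M Phi"
      "\<forall>p\<in>S1 \<inter> T. fst (H p) \<in> N \<and> snd (H p) \<in> M \<and>
          Y1 p = Phi (fst (H p)) (snd (H p))"
      by (rule flat_sectionE)
    have "open (T \<inter> - S2)" "q \<in> T \<inter> - S2" using * 2 closed by auto
    moreover have "\<forall>p\<in>(S1 \<union> S2) \<inter> (T \<inter> - S2). fst (H p) \<in> N \<and>
        snd (H p) \<in> M \<and> ?Y p = Phi (fst (H p)) (snd (H p))"
      using *(6) by auto
    ultimately show ?thesis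
      using *(3,4,5) by (intro exI [of _ "T \<inter> - S2"] exI [of _ N] exI [of _ M] exI [of _ Phi] conjI)
  next
    case 3
    then have "q \<in> S2" by auto
    with Y2 obtain T N M Phi where *: "open T" "q \<in> T" "open N" "open M" "flat_frame A D N M Phi"
      "\<forall>p\<in>S2 \<inter> T. fst (H p) \<in> N \<and> snd (H p) \<in> M \<and>
          Y2 p = Phi (fst (H p)) (snd (H p))"
      by (rule flat_sectionE)
    have "open (T \<inter> - S1)" "q \<in> T \<inter> - S1" using * 3 closed by auto
    moreover have "\<forall>p\<in>(S1 \<union> S2) \<inter> (T \<inter> - S1). fst (H p) \<in> N \<and>
        snd (H p) \<in> M \<and> ?Y p = Phi (fst (H p)) (snd (H p))"
      using *(6) by auto
    ultimately show ?thesis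
      using *(3,4,5) by (intro exI [of _ "T \<inter> - S1"] exI [of _ N] exI [of _ M] exI [of _ Phi] conjI)
  qed
qed

text \<open>A constant factor makes the sections agree at one point of the intersection, hence on all of
  it as it is connected.\<close>

lemma sections_join:
  assumes H: "continuous_on (S1 \<union> S2) H" "H ` (S1 \<union> S2) \<subseteq> X" and closed:
      "closed S1" "closed S2"
    and Y1: "flat_section A D H S1 Y1" and Y2: "flat_section A D H S2 Y2"
    and con: "connected (S1 \<inter> S2)" and q0: "q0 \<in> S1 \<inter> S2"
  shows "\<exists>Y. flat_section A D H (S1 \<union> S2) Y"
proof -
  let ?C = "matrix_inv (Y2 q0) ** Y1 q0"
  have C: "invertible ?C"
    using q0 by (intro matrix_inv_mult(2) invertible_matrix_inv flat_section_invertible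
        [OF Y2] flat_section_invertible [OF Y1]) auto
  have "Y1 q = Y2 q ** ?C" if "q \<in> S1 \<inter> S2" for q
  proof (rule section_ratio_constant [OF _ _ con])
    show "continuous_on (S1 \<inter> S2) H" using H(1) by (rule continuous_on_subset) blast
    show "H ` (S1 \<inter> S2) \<subseteq> X" using H(2) by blast
  qed (use that q0 Y1 Y2 flat_section_subset in blast)+
  then show ?thesis
    using sections_glue [OF H closed Y1 flat_section_mult [OF Y2 C]] by blast
qed

lemma local_section:
  assumes H: "continuous_on S H" "H ` S \<subseteq> X" and q: "q \<in> S"
  shows "\<exists>T Y. open T \<and> q \<in> T \<and> flat_section A D H (S \<inter> T) Y"
proof -
  obtain z0 t0 where Hq: "H q = (z0, t0)" by fastforce
  then have "(z0, t0) \<in> X" using H(2) q by force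
  then obtain e Phi where e: "e > 0" and Phi: "flat_frame A D (ball z0 e) (ball t0 e) Phi"
    using local_frame by blast
  have "open (ball z0 e \<times> ball t0 e)" by (simp add: open_Times)
  then obtain T where T: "open T" "T \<inter> S = H -` (ball z0 e \<times> ball t0 e) \<inter> S"
    using H(1) unfolding continuous_on_open_invariant by blast
  have HT: "fst (H p) \<in> ball z0 e \<and> snd (H p) \<in> ball t0 e" if "p \<in> S \<inter> T" for p
  proof -
    have "H p \<in> ball z0 e \<times> ball t0 e" using that T by blast
    then show ?thesis by (auto simp: mem_Times_iff)
  qed
  have "flat_section A D H (S \<inter> T) (\<lambda>p. Phi (fst (H p)) (snd (H p)))"
    unfolding flat_section_def
    by (intro ballI exI [of _ T] exI [of _ "ball z0 e"] exI [of _
        "ball t0 e"] exI [of _ Phi] conjI T(1) open_ball Phi)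
      (use HT in auto)
  moreover have "q \<in> T" using T(2) q Hq e by auto
  ultimately show ?thesis using T(1) by blast
qed

text \<open>Small rectangles are stacked to a strip around each segment {s} x [0,1], and the strips are
  joined to the square; both times the compactness of the interval enters as the Bolzano
  principle.\<close>

lemma section_on_square:
  fixes H :: "real \<times> real \<Rightarrow> complex \<times> complex"
  assumes H: "continuous_on ({0..1} \<times> {0..1}) H" "H ` ({0..1} \<times> {0..1}) \<subseteq> X"
  shows "\<exists>Y. flat_section A D H ({0..1} \<times> {0..1}) Y"
proof -
  have Hsub: "continuous_on S H" "H ` S \<subseteq> X" if "S \<subseteq> {0..1} \<times> {0..1}" for S
    using H that continuous_on_subset by blast+
  define J where "J s d = {max 0 (s - d)..min 1 (s + d)}" for s d :: real
  have strip: "\<exists>d>0. \<exists>Y. flat_section A D H (J s d \<times> {0..1}) Y" if s: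
      "s \<in> {0..1}" for s
  proof -
    define Q where "Q a b \<longleftrightarrow> (0 \<le> a \<and> b \<le> 1 \<longrightarrow>
        (\<exists>d>0. \<exists>Y. flat_section A D H (J s d \<times> {a..b}) Y))" for a b
    have "Q 0 1"
    proof (rule Bolzano)
      fix a b c assume trans: "Q a b" "Q b c" "a \<le> b" "b \<le> c"
      show "Q a c" unfolding Q_def
      proof
        assume ac: "0 \<le> a \<and> c \<le> 1"
        with trans [unfolded Q_def] obtain d1 Y1 d2 Y2 where d: "d1 > 0" "d2 > 0"
          "flat_section A D H (J s d1 \<times> {a..b}) Y1"
              "flat_section A D H (J s d2 \<times> {b..c}) Y2" by force
        define d where "d = min d1 d2"
        have dpos: "d > 0" using d by (simp add: d_def)
        have sub: "J s d \<times> {a..b} \<subseteq> J s d1 \<times> {a..b}"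
            "J s d \<times> {b..c} \<subseteq> J s d2 \<times> {b..c}"
          by (auto simp: J_def d_def)
        have un: "J s d \<times> {a..b} \<union> J s d \<times> {b..c} = J s d \<times> {a..c}"
            using trans by auto
        have int: "J s d \<times> {a..b} \<inter> J s d \<times> {b..c} = J s d \<times> {b}"
            using trans by auto
        have sq: "J s d \<times> {a..c} \<subseteq> {0..1} \<times> {0..1}" using ac by (auto simp: J_def)
        have "\<exists>Y. flat_section A D H (J s d \<times> {a..b} \<union> J s d \<times> {b..c}) Y"
        proof (rule sections_join)
          show "connected (J s d \<times> {a..b} \<inter> J s d \<times> {b..c})"
            unfolding int by (intro convex_connected convex_Times) (auto simp: J_def)
          show "(s, b) \<in> J s d \<times> {a..b} \<inter> J s d \<times> {b..c}"
            unfolding int using s dpos by (auto simp: J_def)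
          show "closed (J s d \<times> {a..b})" "closed (J s d \<times> {b..c})"
            by (simp_all add: J_def closed_Times)
        qed (use Hsub [OF sq] un d flat_section_subset [OF d(3) sub(1)] flat_section_subset
            [OF d(4) sub(2)] in auto)
        then show "\<exists>d>0. \<exists>Y. flat_section A D H (J s d \<times> {a..c}) Y"
          using dpos un by auto
      qed
    next
      fix x :: real assume "0 \<le> x" "x \<le> 1"
      then have q: "(s, x) \<in> {0..1} \<times> {0..1}" using s by auto
      obtain T Y where T: "open T" "(s, x) \<in> T" and Y:
          "flat_section A D H ({0..1} \<times> {0..1} \<inter> T) Y"
        using local_section [OF H q] by blast
      obtain e where e: "e > 0" "ball (s, x) e \<subseteq> T" using T open_contains_ball by blast
      have "flat_section A D H (J s (e / 3) \<times> {a..b}) Y" if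
          "a \<le> x \<and> x \<le> b \<and> b - a < e / 3" "0 \<le> a \<and> b \<le> 1" for a b
      proof (rule flat_section_subset [OF Y], rule subsetI)
        fix p assume p: "p \<in> J s (e / 3) \<times> {a..b}"
        then obtain u v where uv: "p = (u, v)" "u \<in> J s (e / 3)" "v \<in> {a..b}" by auto
        have "dist (s, x) (u, v) \<le> dist s u + dist x v"
          unfolding dist_prod_def using sqrt_sum_squares_le_sum [of "dist s u" "dist x v"] by simp
        moreover have "dist s u \<le> e / 3"
          using uv(2) unfolding J_def dist_real_def abs_le_iff by auto
        moreover have "dist x v < e / 3"
          using uv(3) that(1) unfolding dist_real_def abs_less_iff atLeastAtMost_iff by linarith
        ultimately have "dist (s, x) (u, v) < e" using e(1) by linarith
        then have "p \<in> T" using e(2) uv(1) by auto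
        then show "p \<in> {0..1} \<times> {0..1} \<inter> T" using uv that by (auto simp: J_def)
      qed
      moreover have "e / 3 > 0" using e(1) by simp
      ultimately have "Q a b" if "a \<le> x \<and> x \<le> b \<and> b - a < e / 3" for a b
        unfolding Q_def using that by blast
      then show "\<exists>d>0. \<forall>a b. a \<le> x \<and> x \<le> b \<and> b - a < d \<longrightarrow>
          Q a b"
        using \<open>e / 3 > 0\<close> by blast
    qed simp
    then show ?thesis by (simp add: Q_def)
  qed
  define Q where "Q a b \<longleftrightarrow> (0 \<le> a \<and> b \<le> 1 \<longrightarrow>
      (\<exists>Y. flat_section A D H ({a..b} \<times> {0..1}) Y))" for a b
  have "Q 0 1"
  proof (rule Bolzano)
    fix a b c assume trans: "Q a b" "Q b c" "a \<le> b" "b \<le> c"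
    show "Q a c" unfolding Q_def
    proof
      assume ac: "0 \<le> a \<and> c \<le> 1"
      with trans [unfolded Q_def] obtain Y1 Y2 where Y: "flat_section A D H ({a..b} \<times> {0..1}) Y1"
          "flat_section A D H ({b..c} \<times> {0..1}) Y2"
        by force
      have un: "{a..b} \<times> {0..1} \<union> {b..c} \<times> {0..1}
          = {a..c} \<times> {0..1::real}" using trans by auto
      have int: "{a..b} \<times> {0..1} \<inter> {b..c} \<times> {0..1} = {b} \<times> {0..1::real}"
          using trans by auto
      have sq: "{a..c} \<times> {0..1} \<subseteq> {0..1} \<times> {0..1::real}" using ac by auto
      have "\<exists>Y. flat_section A D H ({a..b} \<times> {0..1} \<union> {b..c} \<times> {0..1}) Y"
      proof (rule sections_join)
        show "connected ({a..b} \<times> {0..1} \<inter> {b..c} \<times> {0..1::real})"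
          unfolding int by (intro convex_connected convex_Times) auto
        show "(b, 0) \<in> {a..b} \<times> {0..1} \<inter> {b..c} \<times> {0..1::real}" unfolding int by auto
        show "closed ({a..b} \<times> {0..1::real})" "closed ({b..c} \<times> {0..1::real})"
          by (simp_all add: closed_Times)
      qed (use Hsub [OF sq] un Y in auto)
      then show "\<exists>Y. flat_section A D H ({a..c} \<times> {0..1}) Y" by (simp only: un)
    qed
  next
    fix x :: real assume "0 \<le> x" "x \<le> 1"
    then obtain d Y where d: "d > 0" "flat_section A D H (J x d \<times> {0..1}) Y" using strip [of x] by auto
    have "flat_section A D H ({a..b} \<times> {0..1}) Y" if "a \<le> x \<and> x \<le> b \<and> b - a < d"
        "0 \<le> a \<and> b \<le> 1" for a b
      by (rule flat_section_subset [OF d(2)]) (use that in \<open>auto simp: J_def\<close>)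
    then have "Q a b" if "a \<le> x \<and> x \<le> b \<and> b - a < d" for a b
      unfolding Q_def using that by blast
    then show "\<exists>d>0. \<forall>a b. a \<le> x \<and> x \<le> b \<and> b - a < d \<longrightarrow> Q a b"
      using d(1) by blast
  qed simp
  then show ?thesis by (simp add: Q_def)
qed

lemma has_monodromy_of_section:
  assumes Y: "flat_section A D (\<lambda>r. (g r, t)) {0..1} Y" and g: "continuous_on {0..1} g"
  shows "has_monodromy (\<lambda>z. A z t) g (Y 1 ** matrix_inv (Y 0))"
proof -
  let ?C = "matrix_inv (Y 0)"
  have inv: "invertible (Y 0)" using flat_section_invertible [OF Y] by simp
  have "continuation_along (\<lambda>z. A z t) g (\<lambda>r. Y r ** ?C)"
    unfolding continuation_along_def
  proof
    fix s :: real assume s: "s \<in> {0..1}"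
    obtain T N M Phi where *: "open T" "s \<in> T" "open N" "open M" "flat_frame A D N M Phi"
      "\<forall>r\<in>{0..1} \<inter> T. fst (g r, t) \<in> N \<and> snd (g r, t) \<in> M \<and>
          Y r = Phi (fst (g r, t)) (snd (g r, t))"
      by (rule flat_sectionE [OF Y s])
    have gs: "g s \<in> N" "t \<in> M" using bspec [OF *(6), of s] s *(2) by auto
    obtain e where e: "e > 0" "ball (g s) e \<subseteq> N" using *(3) gs open_contains_ball by blast
    obtain d1 where d1: "d1 > 0" "ball s d1 \<subseteq> T" using * open_contains_ball by blast
    obtain d2 where d2: "d2 > 0" "\<And>r. r \<in> {0..1} \<Longrightarrow> dist r s < d2 \<Longrightarrow>
        dist (g r) (g s) < e"
      using g s e(1) unfolding continuous_on_iff by metis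
    have "horizontal_on (\<lambda>z. A z t) (ball (g s) e) (\<lambda>z. Phi z t ** ?C)"
      unfolding horizontal_on_def matrix_mul_assoc
    proof
      fix z assume "z \<in> ball (g s) e"
      then have "has_matrix_derivative (\<lambda>z. Phi z t) (A z t ** Phi z t) z"
        using *(5) e gs unfolding flat_frame_def by blast
      then show "has_matrix_derivative (\<lambda>z. Phi z t ** ?C) (A z t ** Phi z t ** ?C) z"
        by (rule hmd_mult_const)
    qed
    moreover have "g r \<in> ball (g s) e \<and> Y r ** ?C = Phi (g r) t ** ?C" if "r \<in> {0..1}"
        "\<bar>r - s\<bar> < min d1 d2" for r
    proof -
      have "r \<in> T" using d1 that by (auto simp: dist_real_def subset_iff abs_minus_commute)
      moreover have "dist (g r) (g s) < e" using d2(2) [OF that(1)] that(2) by (simp add: dist_real_def)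
      ultimately show ?thesis using bspec [OF *(6), of r] that(1) by (simp add: dist_commute)
    qed
    ultimately show "\<exists>e>0. \<exists>Phi. horizontal_on (\<lambda>z. A z t) (ball (g s) e) Phi \<and>
       (\<exists>d>0. \<forall>r\<in>{0..1}. \<bar>r - s\<bar> < d \<longrightarrow>
           g r \<in> ball (g s) e \<and> Y r ** ?C = Phi (g r))"
      using e(1) d1(1) d2(1) by (intro exI [of _ e] exI [of _ "\<lambda>z. Phi z t ** ?C"] exI [of _
          "min d1 d2"] conjI) auto
  qed
  then show ?thesis
    unfolding has_monodromy_def using matrix_inv_cancel(2) [OF inv] by blast
qed

text \<open>Continue a frame over the whole square of loops. Its two sides lie over the same path of
  base points and are therefore transported by the same matrix P, which does not depend on the
  square.\<close>

lemma monodromy_conjugate: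
  assumes X: "\<And>s z. s \<in> {0..1} \<Longrightarrow> z \<notin> {0, tau s, 1} \<Longrightarrow>
      (z, tau s) \<in> X"
    and tau: "path tau" and b: "path b" "\<And>s. s \<in> {0..1} \<Longrightarrow> b s \<notin> {0, tau s, 1}"
  shows "\<exists>P. invertible P \<and> (\<forall>g g'. identified_loops tau b g g' \<longrightarrow>
    (\<exists>M. has_monodromy (\<lambda>z. A z (tau 0)) g M \<and>
         has_monodromy (\<lambda>z. A z (tau 1)) g' (conj_by P M)))"
proof -
  have ct: "continuous_on ({0..1} \<times> {0..1}) (\<lambda>q::real \<times> real. tau (fst q))"
    and cb: "continuous_on ({0..1} \<times> {0..1}) (\<lambda>q::real \<times> real. b (fst q))"
    using tau b(1) unfolding path_def
    by (auto intro!: continuous_on_compose2 [OF _ continuous_on_fst [OF continuous_on_id]])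
  have bt: "continuous_on {0..1} (\<lambda>s. (b s, tau s))"
    using tau b(1) unfolding path_def by (rule continuous_on_Pair [rotated])
  have btX: "(\<lambda>s. (b s, tau s)) ` {0..1} \<subseteq> X" using X b(2) by auto
  have "\<exists>Y. flat_section A D (\<lambda>q::real \<times> real. (b (fst q), tau (fst q)))
      ({0..1} \<times> {0..1}) Y"
    by (rule section_on_square) (use ct cb X b(2) in \<open>auto intro: continuous_on_Pair\<close>)
  then obtain Y' where Y': "flat_section A D (\<lambda>q::real \<times> real. (b (fst q), tau (fst q)))
      ({0..1} \<times> {0..1}) Y'" by blast
  define Z where "Z s = Y' (s, 0)" for s :: real
  have Z: "flat_section A D (\<lambda>s. (b s, tau s)) {0..1} Z"
    unfolding Z_def [abs_def] by (rule flat_section_compose [OF Y']) (auto intro!: continuous_intros)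
  define P where "P = Z 1 ** matrix_inv (Z 0)"
  have Zinv: "invertible (Z 0)" "invertible (Z 1)" using flat_section_invertible [OF Z] by auto
  have P: "invertible P" unfolding P_def by (intro matrix_inv_mult invertible_matrix_inv Zinv)
  have transport: "W 1 = P ** W 0" if "flat_section A D (\<lambda>s. (b s, tau s)) {0..1} W" for W
    using section_ratio_constant [OF bt btX _ that Z, of 0 1]
    by (simp add: P_def matrix_mul_assoc)
  have "\<exists>M. has_monodromy (\<lambda>z. A z (tau 0)) g M \<and>
      has_monodromy (\<lambda>z. A z (tau 1)) g' (conj_by P M)"
    if "identified_loops tau b g g'" for g g'
  proof -
    from that obtain h where h: "continuous_on ({0..1} \<times> {0..1}) h"
      "\<And>s r. s \<in> {0..1} \<Longrightarrow> r \<in> {0..1} \<Longrightarrow>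
          h (s, r) \<notin> {0, tau s, 1}"
      "\<And>s. s \<in> {0..1} \<Longrightarrow> h (s, 0) = b s \<and> h (s, 1) = b s"
      "\<And>r. r \<in> {0..1} \<Longrightarrow> h (0, r) = g r \<and> h (1, r) = g' r"
      unfolding identified_loops_def by blast
    have "\<exists>Y. flat_section A D (\<lambda>q. (h q, tau (fst q))) ({0..1} \<times> {0..1}) Y"
      by (rule section_on_square) (use h ct X in \<open>auto intro: continuous_on_Pair\<close>)
    then obtain Y where Y: "flat_section A D (\<lambda>q. (h q, tau (fst q)))
        ({0..1} \<times> {0..1}) Y" by blast
    have sides: "flat_section A D (\<lambda>s. (b s, tau s)) {0..1} (\<lambda>s. Y (s, 0))"
      "flat_section A D (\<lambda>s. (b s, tau s)) {0..1} (\<lambda>s. Y (s, 1))"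
      by (rule flat_section_compose [OF Y]; use h(3) in \<open>auto intro!: continuous_intros\<close>)+
    have ends: "flat_section A D (\<lambda>r. (g r, tau 0)) {0..1} (\<lambda>r. Y (0, r))"
      "flat_section A D (\<lambda>r. (g' r, tau 1)) {0..1} (\<lambda>r. Y (1, r))"
      by (rule flat_section_compose [OF Y]; use h(4) in \<open>auto intro!: continuous_intros\<close>)+
    have c: "continuous_on {0..1} (\<lambda>r. h (0, r))" "continuous_on {0..1} (\<lambda>r. h (1, r))"
      by (rule continuous_on_compose2 [OF h(1)]; auto intro!: continuous_intros)+
    have cg: "continuous_on {0..1} g" "continuous_on {0..1} g'"
      by (rule continuous_on_eq [OF c(1)], use h(4) in blast, rule continuous_on_eq
          [OF c(2)], use h(4) in blast)
    let ?M = "Y (0, 1) ** matrix_inv (Y (0, 0))"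
    have inv: "invertible (Y (0, 0))" using flat_section_invertible [OF Y] by auto
    have "has_monodromy (\<lambda>z. A z (tau 0)) g ?M"
      by (rule has_monodromy_of_section [OF ends(1) cg(1)])
    moreover have "Y (1, 1) ** matrix_inv (Y (1, 0)) = conj_by P ?M"
      using transport [OF sides(1)] transport [OF sides(2)]
      by (simp add: matrix_inv_mult(1) [OF P inv] conj_by_def matrix_mul_assoc)
    then have "has_monodromy (\<lambda>z. A z (tau 1)) g' (conj_by P ?M)"
      using has_monodromy_of_section [OF ends(2) cg(2)] by simp
    ultimately show ?thesis by blast
  qed
  then show ?thesis using P by blast
qed

end

section \<open>Schlesinger's equations imply isomonodromy\<close>

lemma B_hat_3:
  "B_hat t B z = mat_scale (1 / z) (B 1) + mat_scale (1 / (z - t)) (B 2) + mat_scale (1 / (z - 1)) (B 3)"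
  by (simp add: B_hat_def sum_3 pole_def)

lemma mat_scale_entry: "mat_scale c M $ j $ k = c * M $ j $ k"
  by (simp add: mat_scale_def)

text \<open>The curvature is a combination of the commutators of C_2 with C_1 and C_3, with coefficients
  that vanish by the partial fraction expansions of 1/(z(z - t)) and 1/((z - 1)(z - t)).\<close>

lemma schlesinger_flat_connection:
  assumes U: "open U" "U \<subseteq> - {0, 1}" and C: "solves_Schlesinger U C"
  shows "flat_connection (\<lambda>z t. B_hat t (\<lambda>i. C i t) z) (\<lambda>z t. mat_scale (- 1 / (z
      - t)) (C 2 t))
    {(z, t). t \<in> U \<and> z \<notin> {0, t, 1}}"
proof -
  let ?A = "\<lambda>z t. B_hat t (\<lambda>i. C i t) z" let ?D =
      "\<lambda>z t. mat_scale (- 1 / (z - t)) (C 2 t)"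
  let ?X = "{(z, t). t \<in> U \<and> z \<notin> {0, t, 1}}"
  define C' where "C' i t = (if i = 1 then mat_scale (1 / t) (commutator (C 2 t) (C 1 t))
     else if i = 2 then mat_scale (1 / t) (commutator (C 1 t) (C 2 t))
          + mat_scale (1 / (t - 1)) (commutator (C 3 t) (C 2 t))
     else mat_scale (1 / (t - 1)) (commutator (C 2 t) (C 3 t)))" for i :: 3 and t
  have dC: "has_matrix_derivative (C i) (C' i t) t" if "t \<in> U" for i t
    using C that exhaust_3 [of i] unfolding solves_Schlesinger_def C'_def by auto
  define At where "At z t = mat_scale (1 / z) (C' 1 t)
     + (mat_scale (1 / (z - t)^2) (C 2 t) + mat_scale (1 / (z - t)) (C' 2 t))
         + mat_scale (1 / (z - 1)) (C' 3 t)" for z t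
  define Dz where "Dz z t = mat_scale (1 / (z - t)^2) (C 2 t)" for z t
  have dinv: "((\<lambda>s. 1 / (z - s)) has_field_derivative 1 / (z - t)^2) (at t)"
     "((\<lambda>s. - 1 / (s - t)) has_field_derivative 1 / (z - t)^2) (at z)"
     "((\<lambda>s. - 1 / (z - s)) has_field_derivative - (1 / (z - t)^2)) (at t)"
     "((\<lambda>s. 1 / (s - t)) has_field_derivative - (1 / (z - t)^2)) (at z)" if
         "z \<noteq> t" for z t :: complex
    by (rule derivative_eq_intros refl | use that in \<open>simp add: power2_eq_square\<close>)+
  have dAt: "has_matrix_derivative (\<lambda>t. ?A z t) (At z t) t" if "(z, t) \<in> ?X" for z t
    unfolding B_hat_3 At_def using that
    by (intro hmd_add hmd_scale hmd_scale_fun dC dinv) auto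
  have dDz: "has_matrix_derivative (\<lambda>z. ?D z t) (Dz z t) z" if "(z, t) \<in> ?X" for z t
    unfolding has_matrix_derivative_def mat_scale_entry Dz_def
    using that by (intro allI DERIV_cmult_right dinv) auto
  have dAz: "\<exists>A'. has_matrix_derivative (\<lambda>z. ?A z t) A' z" if "(z, t) \<in> ?X" for z t
  proof -
    have "((\<lambda>s. 1 / s) has_field_derivative - (1 / z^2)) (at z)"
        "((\<lambda>s. 1 / (s - 1)) has_field_derivative - (1 / (z - 1)^2)) (at z)"
      "((\<lambda>s. 1 / (s - t)) has_field_derivative - (1 / (z - t)^2)) (at z)"
      using dinv(4) [of z 0] dinv(4) [of z 1] dinv(4) [of z t] that by auto
    note d = this [THEN hmd_scale_fun, OF hmd_const]
    show ?thesis
      unfolding B_hat_3 by (rule exI, rule hmd_add [OF hmd_add [OF d(1) d(3)] d(2)])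
  qed
  have dDt: "\<exists>D'. has_matrix_derivative (\<lambda>t. ?D z t) D' t" if "(z, t) \<in> ?X" for z t
  proof -
    have "t \<in> U" "z \<noteq> t" using that by auto
    then show ?thesis by (intro exI) (rule hmd_scale_fun [OF dinv(3) dC])
  qed
  have flat: "At z t + ?A z t ** ?D z t = Dz z t + ?D z t ** ?A z t" if X: "(z, t) \<in> ?X" for z t
  proof -
    have nz: "t \<noteq> 0" "t - 1 \<noteq> 0" "z \<noteq> 0" "z - t \<noteq> 0"
        "z - 1 \<noteq> 0" using X U(2) by auto
    define a b c u v where "a = 1 / z" and "b = 1 / (z - t)" and "c = 1 / (z - 1)" and "u = 1 / t" and
        "v = 1 / (t - 1)"
    have ab: "u * (b - a) = a * b" "v * (c - b) = - (c * b)"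
      unfolding a_def b_def c_def u_def v_def using nz by (simp_all add: divide_simps)
    have AD: "?A z t ** ?D z t = mat_scale (- (a * b)) (C 1 t ** C 2 t)
       + mat_scale (- (b * b)) (C 2 t ** C 2 t) + mat_scale (- (c * b)) (C 3 t ** C 2 t)"
      "?D z t ** ?A z t = mat_scale (- (a * b)) (C 2 t ** C 1 t)
       + mat_scale (- (b * b)) (C 2 t ** C 2 t) + mat_scale (- (c * b)) (C 2 t ** C 3 t)"
      unfolding B_hat_3 matrix_add_distrib mat_scale_mult a_def b_def c_def
      by (simp_all add: vec_eq_iff mat_scale_def add_divide_distrib diff_divide_distrib mult_ac)
    have C': "C' 1 t = mat_scale u (C 2 t ** C 1 t - C 1 t ** C 2 t)"
      "C' 2 t = mat_scale u (C 1 t ** C 2 t - C 2 t ** C 1 t) + mat_scale v (C 3 t ** C 2 t - C 2 t ** C 3 t)"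
      "C' 3 t = mat_scale v (C 2 t ** C 3 t - C 3 t ** C 2 t)"
      by (simp_all add: C'_def commutator_def u_def v_def)
    have scalar: "a * (u * (m21 - m12)) + (s + b * (u * (m12 - m21) + v * (m32 - m23))) + c * (v * (m23 - m32))
        + (- (a * b) * m12 + - (b * b) * m22 + - (c * b) * m32)
      = s + (- (a * b) * m21 + - (b * b) * m22 + - (c * b) * m23)" for m12 m21 m32 m23 m22 s
      using ab by algebra
    show ?thesis
      unfolding AD At_def Dz_def C' a_def [symmetric] b_def [symmetric] c_def [symmetric]
        vec_eq_iff vector_add_component vector_minus_component mat_scale_entry
      by (intro allI scalar)
  qed
  have openX: "open ?X"
  proof -
    have "open ((UNIV \<times> U) \<inter> {p. fst p \<noteq> 0} \<inter> {p. fst p \<noteq> snd p}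
        \<inter> {p. fst p \<noteq> (1::complex)})"
      using U(1) by (intro open_Int open_Times open_UNIV open_Collect_neq continuous_intros)
    also have "(UNIV \<times> U) \<inter> {p. fst p \<noteq> 0} \<inter> {p. fst p \<noteq> snd p} \<inter>
        {p. fst p \<noteq> (1::complex)} = ?X" by auto
    finally show ?thesis .
  qed
  have polydisc: "\<exists>e>0. cball z0 e \<times> cball t0 e \<subseteq> ?X" if X:
      "(z0, t0) \<in> ?X" for z0 t0
  proof -
    obtain A B where AB: "open A" "open B" "(z0, t0) \<in> A \<times> B" "A \<times> B \<subseteq> ?X"
      by (rule open_prod_elim [OF openX X])
    obtain e1 where e1: "e1 > 0" "cball z0 e1 \<subseteq> A"
      using AB(1,3) unfolding open_contains_cball by blast
    obtain e2 where e2: "e2 > 0" "cball t0 e2 \<subseteq> B"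
      using AB(2,3) unfolding open_contains_cball by blast
    have "cball z0 (min e1 e2) \<subseteq> cball z0 e1" "cball t0 (min e1 e2) \<subseteq> cball t0 e2"
      by (intro subset_cball min.cobounded1, intro subset_cball min.cobounded2)
    then have "cball z0 (min e1 e2) \<times> cball t0 (min e1 e2) \<subseteq> ?X"
      using e1(2) e2(2) AB(4) by blast
    then show ?thesis using e1(1) e2(1) by (intro exI [of _ "min e1 e2"] conjI) simp
  qed
  have bounded: "\<exists>K. \<forall>z\<in>cball z0 e. \<forall>t\<in>cball t0 e. mnorm (?A z t)
      \<le> K \<and> mnorm (?D z t) \<le> K"
    if sub: "cball z0 e \<times> cball t0 e \<subseteq> ?X" for z0 t0 e
  proof -
    let ?S = "cball z0 e \<times> cball t0 e"
    have cC: "continuous_on ?S (\<lambda>p. C i (snd p) $ j $ k)" for i j k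
    proof (rule continuous_on_compose2 [of U "\<lambda>t. C i t $ j $ k"])
      show "continuous_on U (\<lambda>t. C i t $ j $ k)"
        by (intro continuous_at_imp_continuous_on ballI DERIV_isCont [OF hmd_entry [OF dC]])
      show "continuous_on ?S snd" by (rule continuous_on_snd [OF continuous_on_id])
      show "snd ` ?S \<subseteq> U" using sub by fastforce
    qed
    have nz: "fst p \<noteq> 0" "fst p - snd p \<noteq> 0" "fst p - 1 \<noteq> 0" if "p \<in> ?S" for p
      using subsetD [OF sub that] by auto
    have "continuous_on ?S (\<lambda>p. mnorm (?A (fst p) (snd p)) + mnorm (?D (fst p) (snd p)))"
      unfolding mnorm_def B_hat_3 vector_add_component mat_scale_entry
      by (intro continuous_intros cC) (use nz in auto)
    then have "bounded ((\<lambda>p. mnorm (?A (fst p) (snd p)) + mnorm (?D (fst p) (snd p))) ` ?S)"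
      by (intro compact_imp_bounded compact_continuous_image compact_Times compact_cball)
    then obtain K where K: "\<And>p. p \<in> ?S \<Longrightarrow> norm (mnorm (?A (fst p) (snd p))
        + mnorm (?D (fst p) (snd p))) \<le> K"
      unfolding bounded_iff by blast
    have "mnorm (?A z t) \<le> K \<and> mnorm (?D z t) \<le> K" if "z \<in> cball z0 e"
        "t \<in> cball t0 e" for z t
    proof -
      have "norm (mnorm (?A z t) + mnorm (?D z t)) \<le> K" using K [of
          "(z, t)"] that by (simp only: fst_conv snd_conv mem_Times_iff)
      then have "mnorm (?A z t) + mnorm (?D z t) \<le> K" unfolding real_norm_def by (rule abs_le_D1)
      then show ?thesis
        using mnorm_nonneg [of "?A z t"] mnorm_nonneg [of "?D z t"] by (intro conjI) linarith+
    qed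
    then show ?thesis by blast
  qed
  show ?thesis
  proof
    fix z0 t0 assume X: "(z0, t0) \<in> ?X"
    obtain e where e: "e > 0" "cball z0 e \<times> cball t0 e \<subseteq> ?X" using polydisc [OF X] by blast
    obtain K where K: "\<And>z t. z \<in> cball z0 e \<Longrightarrow> t \<in> cball t0 e \<Longrightarrow>
        mnorm (?A z t) \<le> K \<and> mnorm (?D z t) \<le> K"
      using bounded [OF e(2)] by blast
    show "\<exists>e>0. \<exists>K. \<forall>z\<in>ball z0 e. \<forall>t\<in>ball t0 e. mnorm
        (?A z t) \<le> K \<and> mnorm (?D z t) \<le> K"
      by (intro exI [of _ e] exI [of _ K] conjI e(1)) (use K in auto)
    have K0: "0 \<le> K" using K [of z0 t0] e(1) order_trans [OF mnorm_nonneg] by auto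
    \<comment> \<open>so that 9 K d is at most 1/20, as required for the existence of flat
      frames\<close>
    define d where "d = min e (1 / (180 * (K + 1)))"
    have d: "d > 0" "d \<le> e" "d \<le> 1 / (180 * (K + 1))" using e(1) K0 by (simp_all add: d_def)
    have "K * d \<le> (K + 1) * (1 / (180 * (K + 1)))" using d K0 by (intro mult_mono) auto
    also have "\<dots> = 1 / 180" using K0 by (simp add: field_simps)
    finally have Kd: "9 * K * d \<le> 1 / 20" by simp
    have inX: "(z, t) \<in> ?X" if "z \<in> ball z0 d" "t \<in> ball t0 d" for z t
      using that d(2) by (intro subsetD [OF e(2)]) auto
    have inK: "mnorm (?A z t) \<le> K" "mnorm (?D z t) \<le> K" if "z \<in> ball z0 d"
        "t \<in> ball t0 d" for z t
      using K [of z t] that d(2) by auto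
    have z0: "z0 \<in> ball z0 d" using d by simp
    have hol: "(\<lambda>z. ?A z t $ j $ k) holomorphic_on ball z0 d" if "t \<in> ball t0 d" for t j k
      unfolding holomorphic_on_open [OF open_ball] using dAz [OF inX [OF _ that]] hmd_entry by blast
    have holD: "(\<lambda>t. ?D z0 t $ j $ k) holomorphic_on ball t0 d" for j k
      unfolding holomorphic_on_open [OF open_ball] using dDt [OF inX [OF z0]] hmd_entry by blast
    have "\<exists>Phi. Phi z0 t0 = mat 1 \<and> (\<forall>z\<in>ball z0 d. \<forall>t\<in>ball t0 d.
        invertible (Phi z t) \<and>
       has_matrix_derivative (\<lambda>z. Phi z t) (?A z t ** Phi z t) z \<and>
       has_matrix_derivative (\<lambda>t. Phi z t) (?D z t ** Phi z t) t)"
      by (rule flat_frame_exists [OF d(1) Kd inK(1) inK(2) hol dAt dDz holD flat]) (use inX in blast)+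
    then show "\<exists>e>0. \<exists>Phi. flat_frame ?A ?D (ball z0 e) (ball t0 e) Phi"
      unfolding flat_frame_def using d(1) by blast
  qed
qed

text \<open>A gauge transformation that is constant in z conjugates frames and monodromy.\<close>

lemma has_monodromy_gauge:
  assumes M: "has_monodromy A g M" and Q: "invertible Q" and A': "\<And>z. A' z = conj_by Q (A z)"
  shows "has_monodromy A' g (conj_by Q M)"
proof -
  obtain Y where Y: "continuation_along A g Y" "Y 0 = mat 1" "Y 1 = M"
    using M by (auto simp: has_monodromy_def)
  have hor: "horizontal_on A' S (\<lambda>z. conj_by Q (Phi z))" if "horizontal_on A S Phi" for S Phi
    unfolding horizontal_on_def
  proof
    fix z assume "z \<in> S"
    then have "has_matrix_derivative Phi (A z ** Phi z) z" using that by (simp add: horizontal_on_def)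
    then have "has_matrix_derivative (\<lambda>z. Q ** Phi z ** matrix_inv Q) (Q **
        (A z ** Phi z) ** matrix_inv Q) z"
      using hmd_mult [OF hmd_const [of Q]] by (intro hmd_mult_const)
          (simp add: vec_eq_iff matrix_matrix_mult_def [of 0])
    moreover have "conj_by Q (A z) ** conj_by Q (Phi z)
        = Q ** A z ** (matrix_inv Q ** Q) ** Phi z ** matrix_inv Q"
      unfolding conj_by_def by (simp only: matrix_mul_assoc)
    then have "A' z ** conj_by Q (Phi z) = Q ** (A z ** Phi z) ** matrix_inv Q"
      by (simp add: A' matrix_inv_cancel [OF Q] matrix_mul_assoc)
    ultimately show "has_matrix_derivative (\<lambda>z. conj_by Q (Phi z)) (A' z ** conj_by Q (Phi z)) z"
      by (simp add: conj_by_def [of Q])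
  qed
  have "continuation_along A' g (\<lambda>r. conj_by Q (Y r))"
    unfolding continuation_along_def
  proof
    fix s :: real assume "s \<in> {0..1}"
    then obtain e Phi d where "e > 0" "horizontal_on A (ball (g s) e) Phi" "d > 0"
      "\<forall>r\<in>{0..1}. \<bar>r - s\<bar> < d \<longrightarrow> g r \<in> ball (g s) e \<and>
          Y r = Phi (g r)"
      using Y(1) unfolding continuation_along_def by blast
    then show "\<exists>e>0. \<exists>Phi. horizontal_on A' (ball (g s) e) Phi \<and>
       (\<exists>d>0. \<forall>r\<in>{0..1}. \<bar>r - s\<bar> < d \<longrightarrow>
           g r \<in> ball (g s) e \<and> conj_by Q (Y r) = Phi (g r))"
      by (intro exI [of _ e] exI [of _ "\<lambda>z. conj_by Q (Phi z)"] exI [of _ d] conjI hor) auto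
  qed
  moreover have "conj_by Q (Y 0) = mat 1" by (simp add: Y(2) conj_by_def matrix_inv_cancel [OF Q])
  ultimately show ?thesis unfolding has_monodromy_def using Y(3) by blast
qed

lemma conj_by_inverse:
  assumes "invertible Q"
  shows "conj_by (matrix_inv Q) (conj_by Q M) = M" "conj_by Q (conj_by (matrix_inv Q) M) = M"
proof -
  have inv: "matrix_inv (matrix_inv Q) = Q"
    by (rule matrix_inv_eq(1) [OF matrix_inv_cancel(1) [OF assms]])
  have "conj_by (matrix_inv Q) (conj_by Q M) = (matrix_inv Q ** Q) ** M ** (matrix_inv Q ** Q)"
    "conj_by Q (conj_by (matrix_inv Q) M) = (Q ** matrix_inv Q) ** M ** (Q ** matrix_inv Q)"
    unfolding conj_by_def inv by (simp_all only: matrix_mul_assoc)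
  then show "conj_by (matrix_inv Q) (conj_by Q M) = M" "conj_by Q (conj_by (matrix_inv Q) M) = M"
    by (simp_all add: matrix_inv_cancel [OF assms])
qed

lemma conj_by_mult:
  assumes "invertible P" "invertible Q"
  shows "conj_by (P ** Q) M = conj_by P (conj_by Q M)"
  unfolding conj_by_def matrix_inv_mult(1) [OF assms] by (simp only: matrix_mul_assoc)

lemma B_hat_conj: "B_hat t (\<lambda>i. conj_by Q (B i)) z = conj_by Q (B_hat t B z)"
  unfolding B_hat_3 conj_by_def matrix_add_distrib mat_scale_mult ..

text \<open>The gauge transformation may depend on t and only has to exist over disks, since
  isomonodromy is tested over disks; its values at the ends of the path enter the conjugating
  matrix.\<close>

lemma isomonodromic_if_schlesinger:
  assumes U: "U \<subseteq> - {0, 1}"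
    and gauge: "\<And>t0 r. ball t0 r \<subseteq> U \<Longrightarrow> ball t0 r \<noteq> {} \<Longrightarrow>
      \<exists>h. (\<forall>t\<in>ball t0 r. invertible (h t)) \<and>
          solves_Schlesinger (ball t0 r) (\<lambda>i t. conj_by (h t) (B t i))"
  shows "isomonodromic U (\<lambda>t. B_hat t (B t))"
  unfolding isomonodromic_def
proof (intro allI impI, elim conjE)
  fix t0 :: complex and r and tau b :: "real \<Rightarrow> complex"
  assume ball: "ball t0 r \<subseteq> U" and tau: "path tau" "path_image tau \<subseteq> ball t0 r"
    and b: "path b" "\<forall>s\<in>{0..1}. b s \<notin> {0, tau s, 1}"
  have tau_in: "tau s \<in> ball t0 r" if "s \<in> {0..1}" for s
    using tau(2) that unfolding path_image_def by blast
  then have "ball t0 r \<noteq> {}" by force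
  then obtain h where h: "\<And>t. t \<in> ball t0 r \<Longrightarrow> invertible (h t)"
    and C: "solves_Schlesinger (ball t0 r) (\<lambda>i t. conj_by (h t) (B t i))"
    using gauge [OF ball] by blast
  interpret flat_connection "\<lambda>z t. B_hat t (\<lambda>i. conj_by (h t) (B t i)) z"
    "\<lambda>z t. mat_scale (- 1 / (z - t)) (conj_by (h t) (B t 2))"
        "{(z, t). t \<in> ball t0 r \<and> z \<notin> {0, t, 1}}"
    by (rule schlesinger_flat_connection [OF open_ball _ C]) (use ball U in auto)
  obtain P where P: "invertible P" and conj: "\<And>g g'. identified_loops tau b g g' \<Longrightarrow>
    \<exists>M. has_monodromy (\<lambda>z. B_hat (tau 0) (\<lambda>i. conj_by (h (tau 0)) (B
        (tau 0) i)) z) g M \<and>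
         has_monodromy (\<lambda>z. B_hat (tau 1) (\<lambda>i. conj_by (h (tau 1)) (B (tau 1) i)) z) g'
             (conj_by P M)"
    using monodromy_conjugate [of tau b] tau_in tau(1) b
        by (metis (mono_tags, lifting) case_prodI mem_Collect_eq)
  let ?Q = "\<lambda>s. matrix_inv (h (tau s))"
  have h0: "invertible (h (tau 0))" "invertible (h (tau 1))" using h tau_in by auto
  note Q = invertible_matrix_inv [OF h0(1)] invertible_matrix_inv [OF h0(2)]
  let ?P = "?Q 1 ** P ** h (tau 0)"
  have "invertible ?P" by (intro matrix_inv_mult(2) Q P h0)
  moreover have "\<exists>M. has_monodromy (B_hat (tau 0) (B (tau 0))) g M \<and>
      has_monodromy (B_hat (tau 1) (B (tau 1))) g' (conj_by ?P M)"
    if loops: "identified_loops tau b g g'" for g g'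
  proof -
    obtain M where M: "has_monodromy (\<lambda>z. B_hat (tau 0) (\<lambda>i. conj_by (h (tau 0)) (B
        (tau 0) i)) z) g M"
         "has_monodromy (\<lambda>z. B_hat (tau 1) (\<lambda>i. conj_by (h (tau 1)) (B (tau 1) i)) z) g'
             (conj_by P M)"
      using conj [OF loops] by blast
    have "has_monodromy (B_hat (tau 0) (B (tau 0))) g (conj_by (?Q 0) M)"
      by (rule has_monodromy_gauge [OF M(1) Q(1)]) (simp add: B_hat_conj conj_by_inverse h0)
    moreover have "has_monodromy (B_hat (tau 1) (B (tau 1))) g' (conj_by (?Q 1) (conj_by P M))"
      by (rule has_monodromy_gauge [OF M(2) Q(2)]) (simp add: B_hat_conj conj_by_inverse h0)
    moreover have "conj_by ?P (conj_by (?Q 0) M) = conj_by (?Q 1) (conj_by P M)"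
      by (simp add: conj_by_mult matrix_inv_mult(2) Q P h0 conj_by_inverse)
    ultimately show ?thesis by metis
  qed
  ultimately show "\<exists>P. invertible P \<and> (\<forall>g g'. identified_loops tau b g g' \<longrightarrow>
      (\<exists>M. has_monodromy (B_hat (tau 0) (B (tau 0))) g M \<and>
          has_monodromy (B_hat (tau 1) (B (tau 1))) g' (conj_by P M)))"
    by blast
qed

section \<open>The flow of the rows of F\<close>

text \<open>The vector v K as a function of v, where K is the tridiagonal matrix with vanishing column
  sums and off-diagonal entries N_12/t, N_21/t, N_23/(t - 1) and N_32/(t - 1).\<close>

definition flow :: "complex \<Rightarrow> (3 \<Rightarrow> 3 \<Rightarrow> complex) \<Rightarrow>
    (3 \<Rightarrow> complex) \<Rightarrow> 3 \<Rightarrow> complex" where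
  "flow t N v i = vector
     [(N 2 1 * v 2 - N 1 2 * v 1) / t,
      (N 1 2 * v 1 - N 2 1 * v 2) / t + (N 3 2 * v 3 - N 2 3 * v 2) / (t - 1),
      (N 2 3 * v 2 - N 3 2 * v 3) / (t - 1)] $ i"

lemma flow_simps:
  "flow t N v 1 = (N 2 1 * v 2 - N 1 2 * v 1) / t"
  "flow t N v 2 = (N 1 2 * v 1 - N 2 1 * v 2) / t + (N 3 2 * v 3 - N 2 3 * v 2) / (t - 1)"
  "flow t N v 3 = (N 2 3 * v 2 - N 3 2 * v 3) / (t - 1)"
  by (simp_all add: flow_def)

lemma sum_flow: "(\<Sum>i\<in>UNIV. flow t N v i) = 0"
  by (simp add: sum_3 flow_simps diff_divide_distrib)

text \<open>The derivative of the sum of the w_i vanishes along the flow of z and p.\<close>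

lemma flow_quadratic:
  fixes z p r th :: "3 \<Rightarrow> complex"
  assumes t: "t \<noteq> 0" "t - 1 \<noteq> 0" and p: "\<And>i. p i \<noteq> 0"
    and N: "\<And>i j. N i j = r i * p j - z j" and th: "\<And>i. th i = r i * p i - z i"
  shows "(\<Sum>i\<in>UNIV. (2 * z i + th i) * flow t N z i / p i)
      = (\<Sum>i\<in>UNIV. z i * r i * flow t N p i / p i)"
  unfolding sum_3 flow_simps N th using t p [of 1] p [of 2] p [of 3]
  by (simp add: divide_simps) algebra

text \<open>The rows r and q stay orthogonal along the flow: the left hand side is the derivative of r
  applied to q.\<close>

lemma flow_dual:
  fixes z p r q :: "3 \<Rightarrow> complex"
  assumes t: "t \<noteq> 0" "t - 1 \<noteq> 0" and p: "\<And>i. p i \<noteq> 0"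
    and N: "\<And>i j. N i j = r i * p j - z j"
  shows "(\<Sum>i\<in>UNIV. (flow t N z i - r i * flow t N p i) / p i * q i)
      = - (\<Sum>i\<in>UNIV. r i * flow t N q i)"
  unfolding sum_3 flow_simps N using t p [of 1] p [of 2] p [of 3]
  by (simp add: divide_simps) algebra

text \<open>The rate at which the flow changes the normalization of the rows p and q, and hence the
  logarithmic derivative of the factor that restores it.\<close>

lemma flow_normalization:
  fixes z p r q :: "3 \<Rightarrow> complex"
  assumes t: "t \<noteq> 0" "t - 1 \<noteq> 0"
    and N: "\<And>i j. N i j = r i * p j - z j"
    and "(\<Sum>i\<in>UNIV. p i) = 0" "(\<Sum>i\<in>UNIV. q i) = 0" "(\<Sum>i\<in>UNIV. r i * q i) = 0"
    and "(\<Sum>i\<in>UNIV. z i) = - dl"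
  shows "t * flow t N q 1 + (t - 1) * flow t N q 3 = dl * q 2"
proof -
  have "p 1 = - p 2 - p 3" "q 1 = - q 2 - q 3" "z 1 = - dl - z 2 - z 3" "r 1 * q 1 = - r 2 * q 2 - r 3 * q 3"
    using assms(4-7) unfolding sum_3 by algebra+
  moreover have "t * flow t N q 1 + (t - 1) * flow t N q 3 =
     (r 2 * p 1 - z 1) * q 2 - (r 1 * p 2 - z 2) * q 1 + (r 2 * p 3 - z 3) * q 2 - (r 3 * p 2 - z 2) * q 3"
    using t by (simp add: flow_simps N)
  ultimately show ?thesis by algebra
qed

text \<open>In the difference of 1/(y - a_i) for two poles, the factors of p_i in N_ij cancel.\<close>

lemma flow_scalar:
  fixes z r :: "3 \<Rightarrow> complex"
  assumes t: "t \<noteq> 0" "t \<noteq> 1" and y: "\<forall>i. y \<noteq> pole t i"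
    and N: "\<And>i j. N i j = r i * ((y - pole t j) / pole_diff t j) - z j"
  shows "t * (t - 1) * (\<Sum>i\<in>UNIV. flow t N z i / (y - pole t i))
      = (\<Sum>i\<in>UNIV. z i * r i / (y - pole t i))"
proof -
  have "y \<noteq> 0" "y - t \<noteq> 0" "y - 1 \<noteq> 0"
      "t - 1 \<noteq> 0" using y t by (simp_all add: not_pole_iff)
  moreover have "1 - t = - (t - 1)" by simp
  ultimately show ?thesis unfolding sum_3 flow_simps N pole_diff_values pole_values
    using t by (simp add: divide_simps) algebra
qed

context generic_params
begin

text \<open>The matrix G (diag mu) F off the diagonal.\<close>

definition NN :: "complex \<Rightarrow> complex \<Rightarrow> complex \<Rightarrow> 3 \<Rightarrow> 3
    \<Rightarrow> complex" where
  "NN t x y i j = rr t x y i * pr t y j - zz t x y j"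

text \<open>This sum is the determinant of the linear system for c, up to a factor.\<close>

lemma sum_rr_pole_diff:
  assumes t: "t \<noteq> 0" "t \<noteq> 1" and y: "\<forall>i. y \<noteq> pole t i"
  shows "(\<Sum>i\<in>UNIV. rr t x y i / pole_diff t i) = pp t x y"
proof -
  have "rr t x y i / pole_diff t i = zz t x y i / (y - pole t i) + th i / (y - pole t i)" for i
    using pole_diff_nonzero [OF t, of i] by (simp add: rr_def pr_def add_divide_distrib)
  then show ?thesis by (simp add: sum.distrib sum_zz_div [OF t y] pp_def)
qed

text \<open>The derivative of the cubic with respect to y.\<close>

definition cubic_deriv :: "complex \<Rightarrow> complex \<Rightarrow> complex" where
  "cubic_deriv t y = (y - 1) * (y - t) + y * (y - t) + y * (y - 1)"

lemma sum_zz_div_square: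
  assumes t: "t \<noteq> 0" "t \<noteq> 1" and y: "\<forall>i. y \<noteq> pole t i"
  shows "cubic t y * (\<Sum>i\<in>UNIV. zz t x y i / (y - pole t i)^2) = x * cubic_deriv t y + shift t x y"
proof -
  have "zz t x y i / (y - pole t i)^2 = x * cubic t y * (1 / (pole_diff t i * (y - pole t i)^2))
      - dl * (1 / pole_diff t i) + shift t x y * (1 / (pole_diff t i * (y - pole t i)))" for i
  proof -
    define b e where "b = y - pole t i" and "e = pole_diff t i"
    have "b \<noteq> 0" "e \<noteq> 0" using y pole_diff_nonzero [OF t, of i] by (simp_all add: b_def e_def)
    then show ?thesis unfolding zz_def b_def [symmetric] e_def [symmetric]
      by (simp add: field_simps power2_eq_square)
  qed
  then have "(\<Sum>i\<in>UNIV. zz t x y i / (y - pole t i)^2) =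
     x * cubic t y * (\<Sum>i\<in>UNIV. 1 / (pole_diff t i * (y - pole t i)^2))
      - dl * (\<Sum>i\<in>UNIV. 1 / pole_diff t i)
      + shift t x y * (\<Sum>i\<in>UNIV. 1 / (pole_diff t i * (y - pole t i)))"
    by (simp add: sum.distrib sum_subtractf sum_distrib_left)
  also have "\<dots> = (x * cubic_deriv t y + shift t x y) / cubic t y"
    using cubic_nonzero [OF y]
    by (simp add: sum_inverse_pole_diff [OF t] partial_fractions_one [OF t y] partial_fractions_square
        [OF t y] cubic_deriv_def [symmetric])
      (simp add: field_simps power2_eq_square)
  finally show ?thesis using cubic_nonzero [OF y] by simp
qed

lemma sum_zz_rr_div:
  assumes t: "t \<noteq> 0" "t \<noteq> 1" and y: "\<forall>i. y \<noteq> pole t i"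
  shows "(\<Sum>i\<in>UNIV. zz t x y i * rr t x y i / (y - pole t i)) =
    x^2 * cubic_deriv t y + dl^2 + 2 * x * shift t x y
    + x * cubic t y * (\<Sum>i\<in>UNIV. th i / (y - pole t i)^2) - dl * (\<Sum>i\<in>UNIV. th i)
    + shift t x y * (\<Sum>i\<in>UNIV. th i / (y - pole t i))"
proof -
  let ?P = "cubic t y" let ?s = "shift t x y"
  have "zz t x y i * rr t x y i / (y - pole t i) = x^2 * ?P^2 * (1 / (pole_diff t i * (y - pole t i)^2))
      - 2 * x * ?P * dl * (1 / pole_diff t i)
      + dl^2 * ((y - pole t i)^2 / pole_diff t i) + 2 * ?s * x * ?P * (1 / (pole_diff t i * (y - pole t i)))
      - 2 * ?s * dl * ((y - pole t i) / pole_diff t i)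
      + ?s^2 * (1 / pole_diff t i)
      + x * ?P * (th i / (y - pole t i)^2) - dl * th i + ?s * (th i / (y - pole t i))" for i
  proof -
    define b e where "b = y - pole t i" and "e = pole_diff t i"
    have "b \<noteq> 0" "e \<noteq> 0" using y pole_diff_nonzero [OF t, of i] by (simp_all add: b_def e_def)
    then show ?thesis unfolding zz_def rr_def pr_def b_def [symmetric] e_def [symmetric]
      by (simp add: field_simps power2_eq_square power3_eq_cube)
  qed
  then have "(\<Sum>i\<in>UNIV. zz t x y i * rr t x y i / (y - pole t i)) =
      x^2 * ?P^2 * (\<Sum>i\<in>UNIV. 1 / (pole_diff t i * (y - pole t i)^2))
      - 2 * x * ?P * dl * (\<Sum>i\<in>UNIV. 1 / pole_diff t i)
      + dl^2 * (\<Sum>i\<in>UNIV. (y - pole t i)^2 / pole_diff t i)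
      + 2 * ?s * x * ?P * (\<Sum>i\<in>UNIV. 1 / (pole_diff t i * (y - pole t i)))
      - 2 * ?s * dl * (\<Sum>i\<in>UNIV. (y - pole t i) / pole_diff t i)
      + ?s^2 * (\<Sum>i\<in>UNIV. 1 / pole_diff t i)
      + x * ?P * (\<Sum>i\<in>UNIV. th i / (y - pole t i)^2)
      - dl * (\<Sum>i\<in>UNIV. th i) + ?s * (\<Sum>i\<in>UNIV. th i / (y - pole t i))"
    by (simp add: sum.distrib sum_subtractf sum_distrib_left)
  also have "\<dots> = x^2 * cubic_deriv t y + dl^2 + 2 * ?s * x
      + x * ?P * (\<Sum>i\<in>UNIV. th i / (y - pole t i)^2)
      - dl * (\<Sum>i\<in>UNIV. th i) + ?s * (\<Sum>i\<in>UNIV. th i / (y - pole t i))"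
    using cubic_nonzero [OF y]
    by (simp only: sum_inverse_pole_diff [OF t] partial_fractions_one [OF t y] partial_fractions_square [OF t y]
       sum_lin_pole_diff [OF t] sum_square_pole_diff [OF t] cubic_deriv_def [symmetric]) simp
  finally show ?thesis by (simp add: mult_ac)
qed

end

locale painleve_flow = generic_params lam mu for lam mu :: "complex^3" +
  fixes U :: "complex set" and x y :: "complex \<Rightarrow> complex"
  assumes open_U: "open U" and U_sub: "U \<subseteq> - {0, 1}"
    and PVI: "solves_PVI (theta lam mu 1) (theta lam mu 2) (theta lam mu 3) (theta4 mu) U y"
    and x_eq: "t \<in> U \<Longrightarrow> 2 * x t = ((t - 1) * deriv y t - theta lam mu 1) / y t
                       + (deriv y t - 1 - theta lam mu 2) / (y t - t)
                       - (t * deriv y t + theta lam mu 3) / (y t - 1)"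
    and adm: "t \<in> U \<Longrightarrow> admissible lam mu t (x t) (y t)"
begin

lemma U_nz: "t \<in> U \<Longrightarrow> t \<noteq> 0" "t \<in> U \<Longrightarrow> t \<noteq> 1"
  using U_sub by auto

lemma reg: "t \<in> U \<Longrightarrow> regular t (x t) (y t)"
  using adm admissible_iff U_nz by blast

lemma y_hol: "y holomorphic_on U"
  using PVI by (simp add: solves_PVI_def)

lemma y_nz: "t \<in> U \<Longrightarrow> y t \<noteq> 0" "t \<in> U \<Longrightarrow> y t - 1 \<noteq> 0"
    "t \<in> U \<Longrightarrow> y t - t \<noteq> 0"
  using PVI by (auto simp: solves_PVI_def)

lemma y_pole: "t \<in> U \<Longrightarrow> \<forall>i. y t \<noteq> pole t i"
  using y_nz [of t] by (simp add: not_pole_iff)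

lemma y_der: "t \<in> U \<Longrightarrow> (y has_field_derivative deriv y t) (at t)"
  by (rule holomorphic_derivI [OF y_hol open_U])

lemma dy_der: "t \<in> U \<Longrightarrow> (deriv y has_field_derivative deriv (deriv y) t) (at t)"
  by (rule holomorphic_derivI [OF holomorphic_deriv [OF y_hol open_U] open_U])

lemma dy_eq:
  assumes t: "t \<in> U"
  shows "t * (t - 1) * deriv y t =
    cubic t (y t) * (2 * x t + (\<Sum>i\<in>UNIV. th i / (y t - pole t i)) + 1 / (y t - t))"
  using first_derivative_from_momentum [OF U_nz(1) [OF t] U_nz(2) [OF t] _ _ _ x_eq [OF t]] y_nz [OF t]
  by (simp add: sum_3 cubic_def)

text \<open>The derivative of x according to Painleve VI.\<close>

definition dx :: "complex \<Rightarrow> complex" where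
  "dx t = (dl * (th4 - dl - 1) - (x t)^2 * cubic_deriv t (y t)
     + x t * cubic t (y t) * (\<Sum>i\<in>UNIV. th i / (y t - pole t i)^2)
     - x t * cubic_deriv t (y t) * ((\<Sum>i\<in>UNIV. th i / (y t - pole t i)) + 1 / (y t - t))
     + x t * cubic t (y t) / (y t - t)^2) / (t * (t - 1))"

lemma x_der:
  assumes t: "t \<in> U"
  shows "(x has_field_derivative dx t) (at t)"
proof -
  note nz = U_nz [OF t] y_nz [OF t]
  let ?d = "deriv y t" let ?dd = "deriv (deriv y) t"
  define X where "X s = (((s - 1) * deriv y s - th 1) / y s + (deriv y s - 1 - th 2) / (y s - s)
     - (s * deriv y s + th 3) / (y s - 1)) / 2" for s
  define dX where "dX = ((?d + (t - 1) * ?dd) / y t - ((t - 1) * ?d - th 1) * ?d / (y t)^2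
       + ?dd / (y t - t) - (?d - 1 - th 2) * (?d - 1) / (y t - t)^2
       - (?d + t * ?dd) / (y t - 1) + (t * ?d + th 3) * ?d / (y t - 1)^2) / 2"
  have "(X has_field_derivative dX) (at t)"
  proof -
    have quotient: "((\<lambda>s. n s / v s) has_field_derivative n' / v t - n t * v' / (v t)^2) (at t)"
      if "(n has_field_derivative n') (at t)" "(v has_field_derivative v') (at t)"
          "v t \<noteq> 0" for n v n' v'
      using DERIV_divide [OF that] that(3) by (simp add: diff_divide_distrib power2_eq_square)
    note y' = y_der [OF t] dy_der [OF t]
    have "((\<lambda>s. (s - 1) * deriv y s - th 1) has_field_derivative ?d + (t - 1) * ?dd) (at t)"
      "((\<lambda>s. deriv y s - 1 - th 2) has_field_derivative ?dd) (at t)"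
      "((\<lambda>s. s * deriv y s + th 3) has_field_derivative ?d + t * ?dd) (at t)"
      "((\<lambda>s. y s - s) has_field_derivative ?d - 1) (at t)"
      "((\<lambda>s. y s - 1) has_field_derivative ?d) (at t)"
      by (rule derivative_eq_intros y' refl | simp)+
    note parts = quotient [OF this(1) y'(1) nz(3)] quotient [OF this(2,4) nz(5)] quotient [OF this(3,5) nz(4)]
    show ?thesis
      unfolding X_def [abs_def] dX_def
      using DERIV_cdivide [OF DERIV_diff [OF DERIV_add [OF parts(1,2)] parts(3)], of 2]
      by (simp add: algebra_simps)
  qed
  moreover have "X s = x s" if "s \<in> U" for s unfolding X_def x_eq [OF that, symmetric] by simp
  ultimately have X: "(x has_field_derivative dX) (at t)"
    using has_field_derivative_transform_within_open [OF _ open_U t] by blast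
  have "t * (t - 1) * dX = dl * (th4 - dl - 1) - (x t)^2 * ((y t - 1) * (y t - t) + y t * (y t - t)
      + y t * (y t - 1))
     + x t * (y t * (y t - 1) * (y t - t)) * (th 1 / (y t)^2 + th 2 / (y t - t)^2 + th 3 / (y t - 1)^2)
     - x t * ((y t - 1) * (y t - t) + y t * (y t - t) + y t * (y t - 1)) * (th 1 / y t + th 2 / (y t - t)
         + th 3 / (y t - 1) + 1 / (y t - t))
     + x t * (y t * (y t - 1) * (y t - t)) / (y t - t)^2"
  proof (rule second_derivative_identity [OF nz(1) _ nz(3-5), of ?d
      "2 * x t + (\<Sum>i\<in>UNIV. th i / (y t - pole t i)) + 1 / (y t - t)" _ _ _ _ ?dd th4])
    show "t - 1 \<noteq> 0" using nz by simp
    show "?d = y t * (y t - 1) * (y t - t) * (2 * x t + (\<Sum>i\<in>UNIV. th i / (y t - pole t i))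
        + 1 / (y t - t)) / (t * (t - 1))"
      using dy_eq [OF t] nz by (subst nonzero_eq_divide_eq) (auto simp: cubic_def mult.commute)
    show "x t = (2 * x t + (\<Sum>i\<in>UNIV. th i / (y t - pole t i)) + 1 / (y t - t) -
       (th 1 / y t + th 2 / (y t - t) + th 3 / (y t - 1)) - 1 / (y t - t)) / 2"
      by (simp add: sum_3)
    show "2 * dX = (?d + (t - 1) * ?dd) / y t - ((t - 1) * ?d - th 1) * ?d / (y t)^2
       + ?dd / (y t - t) - (?d - 1 - th 2) * (?d - 1) / (y t - t)^2
       - (?d + t * ?dd) / (y t - 1) + (t * ?d + th 3) * ?d / (y t - 1)^2"
    proof -
      have "2 * (w / 2) = w" for w :: complex by simp
      then show ?thesis unfolding dX_def .
    qed
    show "2 * dl = th 1 + th 2 + th 3 + th4" using sum_th by (simp add: sum_3)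
  qed (use PVI t in \<open>simp add: solves_PVI_def\<close>)
  then have "t * (t - 1) * dX = t * (t - 1) * dx t"
    using nz by (simp add: dx_def sum_3 cubic_def cubic_deriv_def)
  then have "dX = dx t" using nz by simp
  then show ?thesis using X by simp
qed

lemma x_hol: "x holomorphic_on U"
  unfolding holomorphic_on_open [OF open_U] using x_der by blast

end

lemma pole_der: "((\<lambda>s. pole s i) has_field_derivative (if i = 2 then 1 else 0)) (at t)"
  using exhaust_3 [of i] by auto

lemma pole_hol: "(\<lambda>s. pole s i) holomorphic_on U"
  using exhaust_3 [of i] by auto

lemma pole_diff_hol: "(\<lambda>s. pole_diff s i) holomorphic_on U"
  using exhaust_3 [of i] by (auto intro!: holomorphic_intros)

lemma derivative_zero_on:
  assumes "(f has_field_derivative d) (at t)" "open U" "t \<in> U"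
      "\<And>s. s \<in> U \<Longrightarrow> f s = c"
  shows "d = (0::complex)"
proof (rule DERIV_unique [OF assms(1)])
  show "(f has_field_derivative 0) (at t)"
    using has_field_derivative_transform_within_open [OF DERIV_const assms(2,3), of c f] assms(4) by simp
qed

context painleve_flow
begin

abbreviation z :: "3 \<Rightarrow> complex \<Rightarrow> complex" where "z i s \<equiv> zz s (x s) (y s) i"
abbreviation p :: "3 \<Rightarrow> complex \<Rightarrow> complex" where "p i s \<equiv> pr s (y s) i"
abbreviation q :: "3 \<Rightarrow> complex \<Rightarrow> complex" where "q i s \<equiv> qq s (x s) (y s) i"
abbreviation r :: "3 \<Rightarrow> complex \<Rightarrow> complex" where "r i s \<equiv> rr s (x s) (y s) i"
abbreviation N :: "complex \<Rightarrow> 3 \<Rightarrow> 3 \<Rightarrow> complex" where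
    "N s \<equiv> NN s (x s) (y s)"

lemma p_nz: "t \<in> U \<Longrightarrow> p i t \<noteq> 0"
  using pr_nonzero U_nz y_pole by blast

lemma pp_nz: "t \<in> U \<Longrightarrow> pp t (x t) (y t) \<noteq> 0"
  using reg by (simp add: regular_def)

lemma pole_diff_nz: "t \<in> U \<Longrightarrow> pole_diff t i \<noteq> 0"
  using pole_diff_nonzero U_nz by blast

lemma b_nz: "t \<in> U \<Longrightarrow> y t - pole t i \<noteq> 0"
  using y_pole by simp

lemma rp: "t \<in> U \<Longrightarrow> r i t * p i t = z i t + th i"
  using p_nz [of t i] by (simp add: rr_def)

lemma p_hol: "(\<lambda>s. p i s) holomorphic_on U"
  unfolding pr_def by (intro holomorphic_intros y_hol pole_hol pole_diff_hol pole_diff_nz)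

lemma z_hol: "(\<lambda>s. z i s) holomorphic_on U"
  unfolding zz_def shift_def cubic_def
  by (intro holomorphic_intros x_hol y_hol pole_hol pole_diff_hol pole_diff_nz b_nz th4_nonzero)

lemma r_hol: "(\<lambda>s. r i s) holomorphic_on U"
  unfolding rr_def by (intro holomorphic_intros z_hol p_hol p_nz)

lemma pp_hol: "(\<lambda>s. pp s (x s) (y s)) holomorphic_on U"
  unfolding pp_def by (intro holomorphic_intros x_hol y_hol pole_hol b_nz)

lemma q_hol: "(\<lambda>s. q i s) holomorphic_on U"
  unfolding qq_def yy_def by (intro holomorphic_intros x_hol y_hol pole_hol pole_diff_hol pole_diff_nz
      pp_hol pp_nz)

lemma g1_hol: "(\<lambda>s. g1 s (x s) (y s) i) holomorphic_on U"
  unfolding g1_def cubic_def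
  by (intro holomorphic_intros x_hol y_hol pole_hol pp_hol b_nz mu21_nonzero dl_nonzero)

text \<open>This is the definition of x in terms of y', and it determines the logarithmic derivative of
  k. In the antisymmetric expressions p_i z_2 - p_2 z_i the coordinate of z on its line drops
  out.\<close>

lemma p_der:
  assumes t: "t \<in> U"
  shows "((\<lambda>s. p i s) has_field_derivative
     flow t (N t) (\<lambda>i. p i t) i - (th4 - 1) * p 2 t * p i t) (at t)"
proof -
  note nz = U_nz [OF t] y_nz [OF t]
  have t1: "t - 1 \<noteq> 0" using nz by simp
  let ?d = "deriv y t"
  define pd where "pd i = deriv (\<lambda>s. p i s) t" for i
  have pd: "((\<lambda>s. p i s) has_field_derivative pd i) (at t)" for i
    unfolding pd_def by (rule holomorphic_derivI [OF p_hol open_U t])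
  have "(\<Sum>i\<in>UNIV. pd i) = 0"
    by (rule derivative_zero_on [OF DERIV_sum [where f = "\<lambda>s i. p i s", OF pd] open_U t, where c = "0"])
      (use sum_pr U_nz in blast)
  have dy: "t * (t - 1) * ?d = 2 * x t * cubic t (y t) + (th 1 * ((y t - t) * (y t - 1))
      + th 2 * (y t * (y t - 1)) + th 3 * (y t * (y t - t))) + y t * (y t - 1)"
    unfolding dy_eq [OF t] distrib_left cubic_th_sum [OF y_pole [OF t]]
    using nz by (simp add: cubic_def)
  have sum_th': "th4 = 2 * dl - (th 1 + th 2 + th 3)" using sum_th by (simp add: sum_3)
  have N: "N t 2 1 * p 2 t - N t 1 2 * p 1 t = p 1 t * (2 * z 2 t + th 2) - p 2 t * (2 * z 1 t + th 1)"
    "N t 2 3 * p 2 t - N t 3 2 * p 3 t = p 3 t * (2 * z 2 t + th 2) - p 2 t * (2 * z 3 t + th 3)"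
    using rp [OF t, of 1] rp [OF t, of 2] rp [OF t, of 3] unfolding NN_def by algebra+
  have "((\<lambda>s. y s / s) has_field_derivative (?d * t - y t) / (t * t)) (at t)"
    by (rule derivative_eq_intros y_der [OF t] refl nz | simp)+
  then have 1: "pd 1 = (?d * t - y t) / (t * t)"
    using pd [of 1] by (auto simp: pr_def intro: DERIV_unique)
  have "((\<lambda>s. (y s - 1) / (1 - s)) has_field_derivative (?d * (1 - t)
      + (y t - 1)) / ((1 - t) * (1 - t))) (at t)"
    by (rule derivative_eq_intros y_der [OF t] refl nz | simp add: nz)+
  then have 3: "pd 3 = (?d * (1 - t) + (y t - 1)) / ((1 - t) * (1 - t))"
    using pd [of 3] by (auto simp: pr_def intro: DERIV_unique)
  have pd1: "pd 1 = flow t (N t) (\<lambda>i. p i t) 1 - (th4 - 1) * p 2 t * p 1 t"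
  proof -
    have "p 1 t * z 2 t - p 2 t * z 1 t = (x t * cubic t (y t) + dl * (y t * (y t - t))) / (t * (t - 1))"
      unfolding pr_def zz_def pole_diff_values pole_values using nz t1 by (simp add: divide_simps) algebra
    then have "flow t (N t) (\<lambda>i. p i t) 1 =
      (2 * ((x t * cubic t (y t) + dl * (y t * (y t - t))) / (t * (t - 1))) + p 1 t * th 2 - p 2 t * th 1) / t"
      unfolding flow_simps N by (simp add: algebra_simps)
    moreover have "?d = (2 * x t * cubic t (y t) + (th 1 * ((y t - t) * (y t - 1))
      + th 2 * (y t * (y t - 1)) + th 3 * (y t * (y t - t))) + y t * (y t - 1)) / (t * (t - 1))"
      using dy nz by (simp add: eq_divide_eq mult_ac)
    ultimately show ?thesis
      unfolding 1 sum_th' pr_def pole_diff_values pole_values using nz t1 by (simp add: divide_simps) algebra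
  qed
  have pd3: "pd 3 = flow t (N t) (\<lambda>i. p i t) 3 - (th4 - 1) * p 2 t * p 3 t"
  proof -
    have m: "1 - t = - (t - 1)" by simp
    have "p 3 t * z 2 t - p 2 t * z 3 t = - (x t * cubic t (y t)
        + dl * ((y t - 1) * (y t - t))) / (t * (t - 1))"
      unfolding pr_def zz_def pole_diff_values pole_values m using nz t1 by (simp add: divide_simps) algebra
    then have "flow t (N t) (\<lambda>i. p i t) 3 =
      (2 * (- (x t * cubic t (y t) + dl * ((y t - 1) * (y t - t))) / (t * (t - 1)))
          + p 3 t * th 2 - p 2 t * th 3) / (t - 1)"
      unfolding flow_simps N by (simp add: algebra_simps)
    moreover have "?d = (2 * x t * cubic t (y t) + (th 1 * ((y t - t) * (y t - 1))
      + th 2 * (y t * (y t - 1)) + th 3 * (y t * (y t - t))) + y t * (y t - 1)) / (t * (t - 1))"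
      using dy nz by (simp add: eq_divide_eq mult_ac)
    ultimately show ?thesis
      unfolding 3 sum_th' pr_def pole_diff_values pole_values m using nz t1 by (simp add: divide_simps) algebra
  qed
  have pd2: "pd 2 = flow t (N t) (\<lambda>i. p i t) 2 - (th4 - 1) * p 2 t * p 2 t"
    using \<open>(\<Sum>i\<in>UNIV. pd i) = 0\<close> sum_flow [of t "N t"
        "\<lambda>i. p i t"] sum_pr [OF nz(1,2), of "y t"] pd1 pd3
    unfolding sum_3 by algebra
  have "pd i = flow t (N t) (\<lambda>i. p i t) i - (th4 - 1) * p 2 t * p i t"
    using pd1 pd2 pd3 exhaust_3 [of i] by auto
  then show ?thesis using pd [of i] by simp
qed

text \<open>Both the derivative of z and its candidate solve the linear system that is obtained by
  differentiating the three equations for z. Its kernel is trivial: on the line spanned by p, the third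
  equation has slope - theta_4. That the candidate solves the second equation is Painleve VI.\<close>

lemma z_der:
  assumes t: "t \<in> U"
  shows "((\<lambda>s. z i s) has_field_derivative flow t (N t) (\<lambda>i. z i t) i) (at t)"
proof -
  note nz = U_nz [OF t] y_nz [OF t] and yp = y_pole [OF t]
  have t1: "t - 1 \<noteq> 0" using nz by simp
  let ?V = "\<lambda>i. flow t (N t) (\<lambda>i. z i t) i" let ?d = "deriv y t"
  define zd where "zd i = deriv (\<lambda>s. z i s) t" for i
  have zd: "((\<lambda>s. z i s) has_field_derivative zd i) (at t)" for i
    unfolding zd_def by (rule holomorphic_derivI [OF z_hol open_U t])
  define pd where "pd i = flow t (N t) (\<lambda>i. p i t) i - (th4 - 1) * p 2 t * p i t" for i
  have pd: "((\<lambda>s. p i s) has_field_derivative pd i) (at t)" for i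
    unfolding pd_def by (rule p_der [OF t])
  have Nij: "N t i j = r i t * p j t - z j t" for i j by (simp add: NN_def)
  have thi: "th i = r i t * p i t - z i t" for i using rp [OF t, of i] by simp

  have s1: "(\<Sum>i\<in>UNIV. zd i) = 0"
    by (rule derivative_zero_on [OF DERIV_sum [where f = "\<lambda>s i. z i s", OF zd] open_U t, where c =
        "- dl"])
      (use sum_zz U_nz y_pole in blast)

  have s2: "(\<Sum>i\<in>UNIV. zd i / (y t - pole t i))
      = dx t + ?d * (\<Sum>i\<in>UNIV. z i t / (y t - pole t i)^2)
      - z 2 t / (y t - pole t 2)^2"
  proof -
    have "((\<lambda>s. z i s / (y s - pole s i)) has_field_derivative
       (zd i * (y t - pole t i) - z i t * (?d - (if i
           = 2 then 1 else 0))) / ((y t - pole t i) * (y t - pole t i))) (at t)" for i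
      by (intro DERIV_divide DERIV_diff zd y_der [OF t] pole_der b_nz [OF t])
    then have "((\<lambda>s. (\<Sum>i\<in>UNIV. z i s / (y s - pole s i)) - x s) has_field_derivative
       (\<Sum>i\<in>UNIV. (zd i * (y t - pole t i) - z i t * (?d - (if i
           = 2 then 1 else 0))) / ((y t - pole t i) * (y t - pole t i))) - dx t) (at t)"
      by (intro DERIV_diff DERIV_sum x_der [OF t])
    then have h0: "(\<Sum>i\<in>UNIV. (zd i * (y t - pole t i) - z i t * (?d - (if i
        = 2 then 1 else 0))) / ((y t - pole t i) * (y t - pole t i))) - dx t = 0"
      by (rule derivative_zero_on [OF _ open_U t, where c = 0]) (use sum_zz_div U_nz y_pole in simp)
    have fraction: "(zd i * (y t - pole t i) - z i t * (?d - c)) / ((y t - pole t i) * (y t - pole t i))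
        = zd i / (y t - pole t i) - ?d * (z i t / (y t - pole t i)^2)
            + c * (z i t / (y t - pole t i)^2)" for i c
    proof -
      have "(A * b - Z * (d - c)) / (b * b) = A / b - d * (Z / b^2) + c * (Z / b^2)" if
          "b \<noteq> 0" for A b Z d :: complex
        using that by (simp add: field_simps power2_eq_square)
      then show ?thesis using b_nz [OF t] by blast
    qed
    have "(\<Sum>i\<in>UNIV. zd i / (y t - pole t i)) - ?d * (\<Sum>i\<in>UNIV. z i t / (y t - pole t i)^2)
        + (\<Sum>i\<in>UNIV. (if i = 2 then 1 else 0) * (z i t / (y t - pole t i)^2)) - dx t = 0"
      using h0 unfolding fraction sum.distrib sum_subtractf sum_distrib_left .
    moreover have "(\<Sum>i\<in>UNIV. (if i = 2 then 1 else 0) * (z i t / (y t - pole t i)^2))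
        = z 2 t / (y t - pole t 2)^2"
      by (simp add: sum_3)
    ultimately show ?thesis by algebra
  qed

  have s3: "(\<Sum>i\<in>UNIV. (2 * z i t + th i) * zd i / p i t)
      = (\<Sum>i\<in>UNIV. z i t * r i t * pd i / p i t)"
  proof -
    have "((\<lambda>s. z i s * ((z i s + th i) / p i s)) has_field_derivative
      (zd i * ((z i t + th i) / p i t) + ((zd i + 0) * p i t - (z i t
          + th i) * pd i) / (p i t * p i t) * z i t)) (at t)" for i
      by (intro DERIV_mult DERIV_divide DERIV_add zd pd DERIV_const p_nz [OF t])
    then have "((\<lambda>s. \<Sum>i\<in>UNIV. z i s * ((z i s + th i) / p i s)) has_field_derivative
      (\<Sum>i\<in>UNIV. zd i * ((z i t + th i) / p i t) + ((zd i + 0) * p i t - (z i t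
          + th i) * pd i) / (p i t * p i t) * z i t)) (at t)"
      by (rule DERIV_sum)
    then have "(\<Sum>i\<in>UNIV. zd i * ((z i t + th i) / p i t) + ((zd i + 0) * p i t - (z i t
        + th i) * pd i) / (p i t * p i t) * z i t) = 0"
      by (rule derivative_zero_on [OF _ open_U t, where c = 0])
        (use sum_zz_rr U_nz y_pole in \<open>simp add: rr_def [symmetric] del: times_divide_eq_right\<close>)
    moreover have "zd i * ((z i t + th i) / p i t) + ((zd i + 0) * p i t - (z i t
        + th i) * pd i) / (p i t * p i t) * z i t
      = (2 * z i t + th i) * zd i / p i t - z i t * r i t * pd i / p i t" for i
      unfolding rr_def using p_nz [OF t, of i] by (simp add: divide_simps) algebra
    ultimately show ?thesis by (simp add: sum_subtractf)
  qed

  have v2: "(\<Sum>i\<in>UNIV. ?V i / (y t - pole t i))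
      = dx t + ?d * (\<Sum>i\<in>UNIV. z i t / (y t - pole t i)^2)
      - z 2 t / (y t - pole t 2)^2"
  proof -
    let ?P = "cubic t (y t)" let ?s = "shift t (x t) (y t)" let ?S = "\<Sum>i\<in>UNIV. th i / (y t - pole t i)"
    let ?Q = "\<Sum>i\<in>UNIV. z i t / (y t - pole t i)^2"
    have "t * (t - 1) * (\<Sum>i\<in>UNIV. ?V i / (y t - pole t i))
        = (\<Sum>i\<in>UNIV. z i t * r i t / (y t - pole t i))"
      by (rule flow_scalar [OF nz(1,2) yp]) (simp add: NN_def pr_def)
    also have "\<dots> = (x t)^2 * cubic_deriv t (y t) + dl^2 + 2 * x t * ?s
      + x t * ?P * (\<Sum>i\<in>UNIV. th i / (y t - pole t i)^2) - dl * (2 * dl - th4) + ?s * ?S"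
      unfolding sum_zz_rr_div [OF nz(1,2) yp] sum_th ..
    finally have 1: "t * (t - 1) * (\<Sum>i\<in>UNIV. ?V i / (y t - pole t i))
        = (x t)^2 * cubic_deriv t (y t) + dl^2 + 2 * x t * ?s
      + x t * ?P * (\<Sum>i\<in>UNIV. th i / (y t - pole t i)^2) - dl * (2 * dl - th4) + ?s * ?S" .
    have "t * (t - 1) * ?d * ?Q = (?P * ?Q) * (2 * x t + ?S + 1 / (y t - t))"
      unfolding dy_eq [OF t] by (simp add: mult_ac)
    then have 2: "t * (t - 1) * ?d * ?Q = (x t * cubic_deriv t (y t) + ?s) * (2 * x t + ?S + 1 / (y t - t))"
      unfolding sum_zz_div_square [OF nz(1,2) yp] .
    have 3: "t * (t - 1) * (z 2 t / (y t - pole t 2)^2) = x t * ?P / (y t - t)^2 - dl + ?s * (1 / (y t - t))"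
      unfolding zz_def pole_diff_values pole_values using nz t1 by (simp add: divide_simps) algebra
    have 4: "t * (t - 1) * dx t = dl * (th4 - dl - 1) - (x t)^2 * cubic_deriv t (y t)
     + x t * ?P * (\<Sum>i\<in>UNIV. th i / (y t - pole t i)^2)
     - x t * cubic_deriv t (y t) * (?S + 1 / (y t - t)) + x t * ?P / (y t - t)^2"
      using nz t1 by (simp add: dx_def)
    have "t * (t - 1) * (\<Sum>i\<in>UNIV. ?V i / (y t - pole t i))
        = t * (t - 1) * (dx t + ?d * ?Q - z 2 t / (y t - pole t 2)^2)"
      unfolding right_diff_distrib [of "t * (t - 1)"] distrib_left [of
          "t * (t - 1)"] 1 mult.assoc [symmetric, of "t * (t - 1)" ?d] 2 3 4
      by algebra
    then show ?thesis using nz t1 by simp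
  qed

  have v3: "(\<Sum>i\<in>UNIV. (2 * z i t + th i) * ?V i / p i t)
      = (\<Sum>i\<in>UNIV. z i t * r i t * pd i / p i t)"
  proof -
    have "(\<Sum>i\<in>UNIV. (2 * z i t + th i) * ?V i / p i t)
        = (\<Sum>i\<in>UNIV. z i t * r i t * flow t (N t) (\<lambda>i. p i t) i / p i t)"
      by (rule flow_quadratic [OF nz(1) t1 p_nz [OF t] Nij thi])
    also have "\<dots> = (\<Sum>i\<in>UNIV. z i t * r i t * pd i / p i t + (th4 - 1) * p 2 t * (z i t * r i t))"
      using p_nz [OF t] by (intro sum.cong refl) (simp add: pd_def field_simps)
    also have "\<dots> = (\<Sum>i\<in>UNIV. z i t * r i t * pd i / p i t)"
      using sum_zz_rr [OF nz(1,2) yp] by (simp add: sum.distrib sum_distrib_left [symmetric])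
    finally show ?thesis .
  qed

  define e where "e i = zd i - ?V i" for i
  have "(\<Sum>i\<in>UNIV. e i) = 0" "(\<Sum>i\<in>UNIV. e i / (y t - pole t i)) = 0"
    unfolding e_def sum_subtractf diff_divide_distrib s1 sum_flow s2 v2 by simp_all
  then obtain c where c: "\<And>i. e i = c * p i t"
    using kernel_line [OF nz(1,2) yp] unfolding pr_def by blast
  have "0 = (\<Sum>i\<in>UNIV. (2 * z i t + th i) * e i / p i t)"
    unfolding e_def right_diff_distrib sum_subtractf diff_divide_distrib s3 v3 by simp
  also have "\<dots> = c * (\<Sum>i\<in>UNIV. 2 * z i t + th i)"
    using p_nz [OF t] by (simp add: c sum_distrib_left mult_ac)
  finally have "c = 0" unfolding sum_zz_th [OF nz(1,2) yp] using th4_nonzero by simp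
  then have "zd i = ?V i" using c [of i] by (simp add: e_def)
  then show ?thesis using zd [of i] by simp
qed

text \<open>As for z: the derivative of q solves the differentiated equations for c, whose determinant
  is p up to a factor.\<close>

lemma q_der:
  assumes t: "t \<in> U"
  shows "((\<lambda>s. q i s) has_field_derivative
     flow t (N t) (\<lambda>i. q i t) i - (dl - 1) * q 2 t * q i t) (at t)"
proof -
  note nz = U_nz [OF t] y_nz [OF t] and yp = y_pole [OF t]
  have t1: "t - 1 \<noteq> 0" using nz by simp
  define V where "V i = flow t (N t) (\<lambda>i. q i t) i" for i
  define zd where "zd i = flow t (N t) (\<lambda>i. z i t) i" for i
  define pd where "pd i = flow t (N t) (\<lambda>i. p i t) i - (th4 - 1) * p 2 t * p i t" for i
  define qd where "qd i = deriv (\<lambda>s. q i s) t" for i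
  have qd: "((\<lambda>s. q i s) has_field_derivative qd i) (at t)" for i
    unfolding qd_def by (rule holomorphic_derivI [OF q_hol open_U t])
  have Nij: "N t i j = r i t * p j t - z j t" for i j by (simp add: NN_def)
  define rd where "rd i = (zd i - r i t * pd i) / p i t" for i
  have rd: "((\<lambda>s. r i s) has_field_derivative rd i) (at t)" for i
  proof -
    have "((\<lambda>s. (z i s + th i) / p i s) has_field_derivative
      ((zd i + 0) * p i t - (z i t + th i) * pd i) / (p i t * p i t)) (at t)"
      unfolding zd_def pd_def
      by (intro DERIV_divide DERIV_add z_der [OF t] p_der [OF t] DERIV_const p_nz [OF t])
    moreover have "((zd i + 0) * p i t - (z i t + th i) * pd i) / (p i t * p i t) = rd i"
      unfolding rd_def rr_def using p_nz [OF t, of i] by (simp add: field_simps)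
    ultimately show ?thesis unfolding rr_def by simp
  qed
  have qsums: "(\<Sum>i\<in>UNIV. q i s) = 0" "(\<Sum>i\<in>UNIV. (s - pole s i) * q i s) = 1"
    "(\<Sum>i\<in>UNIV. r i s * q i s) = 0" if "s \<in> U" for s
  proof -
    note s = U_nz [OF that]
    show "(\<Sum>i\<in>UNIV. q i s) = 0" "(\<Sum>i\<in>UNIV. (s - pole s i) * q i s) = 1"
      using interpolation_line_sums [OF s, of "yy s (x s) (y s)"] by (simp_all add: qq_def)
    have "c_system s (\<chi> i. z i s) (\<chi> i. z i s * r i s) (\<chi> i. q i s / z i s)"
      using c_system_iff [OF s] reg [OF that] unfolding regular_def by blast
    then show "(\<Sum>i\<in>UNIV. r i s * q i s) = 0"
      using reg [OF that] by (simp add: c_system_def regular_def mult.commute)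
  qed
  have s1: "(\<Sum>i\<in>UNIV. qd i) = 0"
    by (rule derivative_zero_on [OF DERIV_sum [where f = "\<lambda>s i. q i s", OF qd] open_U t, where c =
        "0"]) (use qsums in blast)
  have s2: "(\<Sum>i\<in>UNIV. r i t * qd i) = - (\<Sum>i\<in>UNIV. rd i * q i t)"
  proof -
    have "((\<lambda>s. \<Sum>i\<in>UNIV. r i s * q i s) has_field_derivative
        (\<Sum>i\<in>UNIV. rd i * q i t + qd i * r i t)) (at t)"
      by (intro DERIV_sum DERIV_mult rd qd)
    then have "(\<Sum>i\<in>UNIV. rd i * q i t + qd i * r i t) = 0"
      by (rule derivative_zero_on [OF _ open_U t, where c = 0]) (use qsums in blast)
    then show ?thesis by (simp add: sum.distrib mult.commute add_eq_0_iff)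
  qed
  have s3: "t * qd 1 + (t - 1) * qd 3 = q 2 t"
  proof -
    have "((\<lambda>s. \<Sum>i\<in>UNIV. (s - pole s i) * q i s) has_field_derivative
      (\<Sum>i\<in>UNIV. (1 - (if i = 2 then 1 else 0)) * q i t + qd i * (t - pole t i))) (at t)"
      by (intro DERIV_sum DERIV_mult DERIV_diff DERIV_ident pole_der qd)
    then have "(\<Sum>i\<in>UNIV. (1 - (if i = 2 then 1 else 0)) * q i t + qd i * (t - pole t i)) = 0"
      by (rule derivative_zero_on [OF _ open_U t, where c = 1]) (use qsums in blast)
    then show ?thesis using qsums(1) [OF t] unfolding sum_3 by simp algebra
  qed
  have v2: "(\<Sum>i\<in>UNIV. r i t * V i) = - (\<Sum>i\<in>UNIV. rd i * q i t)"
  proof -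
    have "(\<Sum>i\<in>UNIV. rd i * q i t) = (\<Sum>i\<in>UNIV. (flow t (N t) (\<lambda>i. z i t) i
        - r i t * flow t (N t) (\<lambda>i. p i t) i) / p i t * q i t
        + (th4 - 1) * p 2 t * (r i t * q i t))"
      using p_nz [OF t] by (intro sum.cong refl) (simp add: rd_def zd_def pd_def field_simps)
    also have "\<dots> = (\<Sum>i\<in>UNIV. (flow t (N t) (\<lambda>i. z i t) i
        - r i t * flow t (N t) (\<lambda>i. p i t) i) / p i t * q i t)"
      using qsums(3) [OF t] by (simp add: sum.distrib sum_distrib_left [symmetric])
    also have "\<dots> = - (\<Sum>i\<in>UNIV. r i t * V i)"
      unfolding V_def by (rule flow_dual [OF nz(1) t1 p_nz [OF t] Nij])
    finally show ?thesis by simp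
  qed
  have v3: "t * V 1 + (t - 1) * V 3 = dl * q 2 t"
    unfolding V_def by (rule flow_normalization [OF nz(1) t1 Nij])
      (use sum_pr [OF nz(1,2)] sum_zz [OF nz(1,2) yp] qsums [OF t] in auto)
  have q31: "t * q 1 t + (t - 1) * q 3 t = 1"
    using qsums(2) [OF t] by (simp add: sum_3)
  define e where "e i = qd i - (V i - (dl - 1) * q 2 t * q i t)" for i
  have e1: "(\<Sum>i\<in>UNIV. e i) = 0"
    unfolding e_def V_def sum_subtractf s1 sum_flow sum_distrib_left [symmetric] qsums(1) [OF t] by simp
  have "(\<Sum>i\<in>UNIV. r i t * e i) = (\<Sum>i\<in>UNIV. r i t * qd i) - (\<Sum>i\<in>UNIV. r i t * V i)
     + (dl - 1) * q 2 t * (\<Sum>i\<in>UNIV. r i t * q i t)"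
    by (simp add: e_def sum_3 algebra_simps)
  then have e2: "(\<Sum>i\<in>UNIV. r i t * e i) = 0" unfolding s2 v2 qsums(3) [OF t] by simp
  have e3: "t * e 1 + (t - 1) * e 3 = 0"
  proof -
    have "t * e 1 + (t - 1) * e 3 = (t * qd 1 + (t - 1) * qd 3) - (t * V 1 + (t - 1) * V 3)
       + (dl - 1) * q 2 t * (t * q 1 t + (t - 1) * q 3 t)"
      by (simp add: e_def algebra_simps)
    also have "\<dots> = 0" unfolding s3 v3 q31 by (simp add: algebra_simps)
    finally show ?thesis .
  qed
  have "e 2 * pole_diff t 2 = t * e 1 * 1" "e 3 * pole_diff t 3 = t * e 1"
    using e1 e3 unfolding sum_3 pole_diff_values by algebra+
  then have "e i * pole_diff t i = t * e 1" for i using exhaust_3 [of i] by auto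
  then have e: "e i = t * e 1 * (1 / pole_diff t i)"
      for i using pole_diff_nz [OF t, of i] by (simp add: field_simps)
  have "t * e 1 * (\<Sum>i\<in>UNIV. r i t / pole_diff t i) = (\<Sum>i\<in>UNIV. r i t * e i)"
    unfolding sum_distrib_left by (intro sum.cong refl, subst (2) e) simp
  then have "t * e 1 = 0"
    unfolding e2 sum_rr_pole_diff [OF nz(1,2) yp] using pp_nz [OF t] by simp
  then have "e i = 0" using e [of i] by simp
  then show ?thesis using qd [of i] by (simp add: e_def V_def)
qed

end

section \<open>From the flow to Schlesinger's equations\<close>

definition unit_mat :: "3 \<Rightarrow> complex^3^3" where
  "unit_mat i = (\<chi> j k. if j = i \<and> k = i then 1 else 0)"

text \<open>The matrix K that represents the flow by multiplication on the right.\<close>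

definition flow_mat :: "complex \<Rightarrow> (3 \<Rightarrow> 3 \<Rightarrow> complex) \<Rightarrow>
    complex^3^3" where
  "flow_mat t N = (\<chi> a b. flow t N (\<lambda>i. if i = a then 1 else 0) b)"

lemma flow_mat_mult: "(M ** flow_mat t N) $ j $ b = flow t N (\<lambda>i. M $ j $ i) b"
proof -
  have "\<forall>b. (M ** flow_mat t N) $ j $ b = flow t N (\<lambda>i. M $ j $ i) b"
    unfolding forall_3 matrix_matrix_mult_def flow_mat_def vec_lambda_beta sum_3 flow_simps
    by (simp add: add_divide_distrib diff_divide_distrib algebra_simps)
  then show ?thesis by blast
qed

lemma flow_scale: "flow t N (\<lambda>i. c * v i) b = c * flow t N v b"
proof -
  have "\<forall>b. flow t N (\<lambda>i. c * v i) b = c * flow t N v b"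
    unfolding forall_3 flow_simps
    by (simp add: add_divide_distrib diff_divide_distrib algebra_simps)
  then show ?thesis by blast
qed

lemma unit_mat_mult:
  fixes L :: "complex^3^3"
  shows "(L ** unit_mat i) $ a $ b = (if b = i then L $ a $ i else 0)"
    "(unit_mat i ** L) $ a $ b = (if a = i then L $ i $ b else 0)"
proof -
  have *: "unit_mat i = (\<chi> j k. if j = i then (if k = i then 1 else 0) else 0)"
    "unit_mat i = (\<chi> j k. if k = i then (if j = i then 1 else 0) else 0)"
    by (simp_all add: unit_mat_def vec_eq_iff)
  show "(L ** unit_mat i) $ a $ b = (if b = i then L $ a $ i else 0)"
    unfolding *(1) by (simp add: matrix_matrix_mult_def mult_delta_right)
  show "(unit_mat i ** L) $ a $ b = (if a = i then L $ i $ b else 0)"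
    unfolding *(2) by (simp add: matrix_matrix_mult_def mult_delta_left)
qed

text \<open>Entry by entry. The diagonal of K drops out, which leaves the freedom to normalize the
  column sums to 0.\<close>

lemma flow_mat_commutator:
  fixes M :: "complex^3^3"
  assumes M: "\<And>a b. a \<noteq> b \<Longrightarrow> M $ a $ b = N a b"
  shows "flow_mat t N ** unit_mat 1 - unit_mat 1 ** flow_mat t N
      = mat_scale (1 / t) (unit_mat 2 ** M ** unit_mat 1 - unit_mat 1 ** M ** unit_mat 2)"
    "flow_mat t N ** unit_mat 2 - unit_mat 2 ** flow_mat t N
        = mat_scale (1 / t) (unit_mat 1 ** M ** unit_mat 2 - unit_mat 2 ** M ** unit_mat 1)
        + mat_scale (1 / (t - 1)) (unit_mat 3 ** M ** unit_mat 2 - unit_mat 2 ** M ** unit_mat 3)"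
    "flow_mat t N ** unit_mat 3 - unit_mat 3 ** flow_mat t N
        = mat_scale (1 / (t - 1)) (unit_mat 2 ** M ** unit_mat 3 - unit_mat 3 ** M ** unit_mat 2)"
proof -
  have "M $ 1 $ 2 = N 1 2" "M $ 2 $ 1 = N 2 1" "M $ 3 $ 2 = N 3 2" "M $ 2 $ 3 = N 2 3"
    using M by simp_all
  then show "flow_mat t N ** unit_mat 1 - unit_mat 1 ** flow_mat t N
      = mat_scale (1 / t) (unit_mat 2 ** M ** unit_mat 1 - unit_mat 1 ** M ** unit_mat 2)"
    "flow_mat t N ** unit_mat 2 - unit_mat 2 ** flow_mat t N
        = mat_scale (1 / t) (unit_mat 1 ** M ** unit_mat 2 - unit_mat 2 ** M ** unit_mat 1)
        + mat_scale (1 / (t - 1)) (unit_mat 3 ** M ** unit_mat 2 - unit_mat 2 ** M ** unit_mat 3)"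
    "flow_mat t N ** unit_mat 3 - unit_mat 3 ** flow_mat t N
        = mat_scale (1 / (t - 1)) (unit_mat 2 ** M ** unit_mat 3 - unit_mat 3 ** M ** unit_mat 2)"
    unfolding vec_eq_iff forall_3
    by (simp_all add: unit_mat_mult mat_scale_def flow_mat_def flow_simps)
qed

lemma commutator_normal_form:
  fixes F G D :: "complex^3^3"
  shows "commutator (F ** unit_mat i ** G ** D) (F ** unit_mat j ** G ** D) =
    F ** (unit_mat i ** (G ** D ** F) ** unit_mat j - unit_mat j ** (G ** D ** F) ** unit_mat i) ** G ** D"
  unfolding commutator_def matrix_diff_distrib by (simp add: matrix_mul_assoc)

lemma hmd_of_holomorphic:
  assumes "\<And>j k. (\<lambda>s. M s $ j $ k) holomorphic_on U" "open U" "t \<in> U"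
  shows "\<exists>M'. has_matrix_derivative M M' t"
proof
  show "has_matrix_derivative M (\<chi> j k. deriv (\<lambda>s. M s $ j $ k) t) t"
    unfolding has_matrix_derivative_def using holomorphic_derivI [OF assms] by simp
qed

text \<open>Differentiate F G = 1.\<close>

lemma inverse_derivative:
  assumes F: "has_matrix_derivative F (F t ** K) t" and G: "has_matrix_derivative G G' t"
    and U: "open U" "t \<in> U" and inv: "\<And>s. s \<in> U \<Longrightarrow> F s ** G s = mat 1"
  shows "G' = - (K ** G t)"
proof -
  have "has_matrix_derivative (\<lambda>s. F s ** G s) (F t ** K ** G t + F t ** G') t"
    by (rule hmd_mult [OF F G])
  moreover have "has_matrix_derivative (\<lambda>s. F s ** G s) 0 t"
    by (rule hmd_cong [OF hmd_const U]) (simp add: inv)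
  ultimately have "F t ** K ** G t + F t ** G' = 0" by (rule hmd_unique)
  then have "F t ** (K ** G t + G') = 0"
    by (simp add: matrix_add_distrib matrix_mul_assoc)
  moreover have "G t ** 0 = (0 :: complex^3^3)" by (simp add: vec_eq_iff matrix_matrix_mult_def)
  ultimately have "G t ** F t ** (K ** G t + G') = 0"
    by (simp only: matrix_mul_assoc [symmetric])
  moreover have "G t ** F t = mat 1" using inv [OF U(2)] matrix_left_right_inverse by blast
  ultimately have "K ** G t + G' = 0" by simp
  then show ?thesis by (simp add: add_eq_0_iff)
qed

context painleve_flow
begin

text \<open>The entries off the diagonal of G F = 1 eliminate the first column of G.\<close>

lemma Nmat_entry:
  assumes t: "t \<in> U" and ab: "a \<noteq> b"
  shows "(Gmat t (x t) (y t) ** diag mu ** Fmat t (x t) (y t)) $ a $ b = N t a b"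
proof -
  let ?G = "Gmat t (x t) (y t)" let ?F = "Fmat t (x t) (y t)"
  have 1: "?G $ a $ 1 * ?F $ 1 $ b + r a t / (dl - th4) * p b t - z b t / dl = 0"
    using arg_cong [OF Gmat_Fmat [OF U_nz(1) [OF t] U_nz(2) [OF t] reg [OF t]], of "\<lambda>M. M $ a $ b"] ab
    by (simp add: matrix_matrix_mult_def sum_3 mat_def Gmat_def Fmat_def)
  have "(?G ** diag mu ** ?F) $ a $ b = mu $ 1 * (?G $ a $ 1 * ?F $ 1 $ b)
      + mu $ 2 * (r a t / (dl - th4) * p b t)
     - mu $ 3 * (z b t / dl)"
    unfolding matrix_matrix_mult_def [of "?G ** diag mu"]
    by (simp add: sum_3 diag_mult) (simp add: Gmat_def Fmat_def algebra_simps)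
  also have "\<dots> = (mu $ 2 - mu $ 1) * (r a t / (dl - th4) * p b t) - (mu $ 3 - mu $ 1) * (z b t / dl)"
    using 1 by algebra
  also have "\<dots> = N t a b"
    using mu21_nonzero dl_nonzero by (simp add: mu21 [symmetric] dl_eq [symmetric] NN_def)
  finally show ?thesis .
qed

context
  fixes k l :: "complex \<Rightarrow> complex" and pt :: "complex \<Rightarrow> complex"
  assumes kl: "\<And>t. t \<in> U \<Longrightarrow> l t \<noteq> 0"
      "\<And>t. t \<in> U \<Longrightarrow> k t \<noteq> 0"
    and pt: "\<And>t. t \<in> U \<Longrightarrow> pt t
        = x t + (\<Sum>i\<in>UNIV. theta lam mu i / (y t - pole t i))"
    and dk: "\<And>t. t \<in> U \<Longrightarrow> (k has_field_derivative k t * ((theta4 mu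
        - 1) / (t * (t - 1)) * (y t - t))) (at t)"
    and dl: "\<And>t. t \<in> U \<Longrightarrow> (l has_field_derivative
             l t * ((delta lam mu - 1) / (t * (t - 1)) *
                    (y t - t - (delta lam mu - theta4 mu) / pt t))) (at t)"
begin

text \<open>The diagonal of h.\<close>

definition hvec :: "complex \<Rightarrow> complex^3" where "hvec s = vector [l s, k s, 1]"
text \<open>The matrix h F.\<close>

definition Ft :: "complex \<Rightarrow> complex^3^3" where "Ft s = diag (hvec s) ** Fmat s (x s) (y s)"
text \<open>The inverse of h F.\<close>

definition Gt :: "complex \<Rightarrow> complex^3^3" where
    "Gt s = Gmat s (x s) (y s) ** diag (\<chi> i. 1 / hvec s $ i)"

lemma hvec_nz: "s \<in> U \<Longrightarrow> hvec s $ i \<noteq> 0"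
  using exhaust_3 [of i] kl by (auto simp: hvec_def)

lemma Ft_Gt: "s \<in> U \<Longrightarrow> Ft s ** Gt s = mat 1"
proof -
  assume s: "s \<in> U"
  have "Ft s ** Gt s = diag (hvec s) ** (Fmat s (x s) (y s) ** Gmat s (x s) (y s)) ** diag
      (\<chi> i. 1 / hvec s $ i)"
    by (simp only: Ft_def Gt_def matrix_mul_assoc)
  then have *: "Ft s ** Gt s = diag (hvec s) ** diag (\<chi> i. 1 / hvec s $ i)"
    by (simp add: Fmat_Gmat [OF U_nz(1) [OF s] U_nz(2) [OF s] reg [OF s]])
  show ?thesis unfolding * using hvec_nz [OF s]
    by (simp add: vec_eq_iff diag_mult) (simp add: diag_def mat_def)
qed

lemma Ft_der:
  assumes t: "t \<in> U"
  shows "has_matrix_derivative Ft (Ft t ** flow_mat t (N t)) t"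
  unfolding has_matrix_derivative_def flow_mat_mult
proof (intro allI)
  fix j i
  have p2: "(y t - t) / (t * (t - 1)) = p 2 t" by (simp add: pr_def)
  \<comment> \<open>the logarithmic derivatives of k and l are (theta_4 - 1) p_2 and (delta - 1)
    q_2\<close>
  have q2: "(y t - t - (dl - th4) / pt t) / (t * (t - 1)) = q 2 t"
    by (simp add: qq_def yy_def pp_def pt [OF t])
  have dk': "(k has_field_derivative k t * ((th4 - 1) * p 2 t)) (at t)"
    using dk [OF t] unfolding p2 [symmetric] by simp
  have dl': "(l has_field_derivative l t * ((dl - 1) * q 2 t)) (at t)"
    using dl [OF t] unfolding q2 [symmetric] by simp
  have 1: "((\<lambda>s. l s * q i s) has_field_derivative l t * flow t (N t) (\<lambda>i. q i t) i) (at t)"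
    using DERIV_mult [OF dl' q_der [OF t, of i]] by (simp add: algebra_simps)
  have 2: "((\<lambda>s. k s * p i s) has_field_derivative k t * flow t (N t) (\<lambda>i. p i t) i) (at t)"
    using DERIV_mult [OF dk' p_der [OF t, of i]] by (simp add: algebra_simps)
  have F: "Ft s $ 1 $ i = l s * q i s" "Ft s $ 2 $ i = k s * p i s" "Ft s $ 3 $ i = z i s" for s i
    by (simp_all add: Ft_def diag_mult hvec_def Fmat_def)
  have "\<forall>j. ((\<lambda>s. Ft s $ j $ i) has_field_derivative flow t (N t)
      (\<lambda>i. Ft t $ j $ i) i) (at t)"
    unfolding forall_3 F flow_scale using 1 2 z_der [OF t, of i] by blast
  then show "((\<lambda>s. Ft s $ j $ i) has_field_derivative flow t (N t) (\<lambda>i. Ft t $ j $ i) i) (at t)"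
    by blast
qed

lemma Gt_der:
  assumes t: "t \<in> U"
  shows "has_matrix_derivative Gt (- (flow_mat t (N t) ** Gt t)) t"
proof -
  have "l holomorphic_on U" "k holomorphic_on U"
    unfolding holomorphic_on_open [OF open_U] using dl dk by blast+
  then have "(\<lambda>s. hvec s $ j) holomorphic_on U" for j
    using exhaust_3 [of j] by (auto simp: hvec_def)
  moreover have "\<forall>j. (\<lambda>s. Gmat s (x s) (y s) $ i $ j) holomorphic_on U" for i
    unfolding forall_3 Gmat_def
    by (simp add: g1_hol) (intro conjI holomorphic_intros r_hol mu21_nonzero)
  ultimately have "(\<lambda>s. Gt s $ i $ j) holomorphic_on U" for i j
    unfolding Gt_def diag_mult vec_lambda_beta using hvec_nz by (intro holomorphic_intros) auto
  then obtain G' where G': "has_matrix_derivative Gt G' t"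
    using hmd_of_holomorphic open_U t by blast
  have "G' = - (flow_mat t (N t) ** Gt t)"
    by (rule inverse_derivative [OF Ft_der [OF t] G' open_U t Ft_Gt])
  then show ?thesis using G' by simp
qed

lemma conj_B_eq:
  assumes t: "t \<in> U"
  shows "conj_by (diag (hvec t)) (B_mat lam mu t (x t) (y t) i) = Ft t ** unit_mat i ** Gt t ** diag mu"
proof -
  have "(Ft t ** unit_mat i ** Gt t) $ a $ b = Ft t $ a $ i * Gt t $ i $ b" for a b
    unfolding matrix_matrix_mult_def [of "Ft t ** unit_mat i"]
    by (simp add: unit_mat_mult mult_delta_left)
  then show ?thesis
    using hvec_nz [OF t]
    by (simp add: vec_eq_iff conj_by_diag diag_mult B_entry [OF U_nz(1) [OF t] U_nz(2) [OF t] reg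
        [OF t]] Ft_def Gt_def)
qed

lemma schlesinger:
  "solves_Schlesinger U (\<lambda>i t. conj_by (diag (vector [l t, k t, 1])) (B_mat lam mu t (x t) (y t) i))"
  unfolding solves_Schlesinger_def hvec_def [symmetric]
proof (intro ballI)
  fix t assume t: "t \<in> U"
  let ?C = "\<lambda>i t. conj_by (diag (hvec t)) (B_mat lam mu t (x t) (y t) i)"
  let ?K = "flow_mat t (N t)" let ?M = "Gt t ** diag mu ** Ft t"
  have M: "?M $ a $ b = N t a b" if "a \<noteq> b" for a b
  proof -
    have "diag (\<chi> i. 1 / hvec t $ i) ** diag mu ** diag (hvec t) = diag mu"
      using hvec_nz [OF t] by (simp add: vec_eq_iff diag_mult) (simp add: diag_def)
    moreover have "?M = Gmat t (x t) (y t) ** (diag (\<chi> i. 1 / hvec t $ i) ** diag mu ** diag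
        (hvec t)) ** Fmat t (x t) (y t)"
      by (simp only: Gt_def Ft_def matrix_mul_assoc)
    ultimately show ?thesis using Nmat_entry [OF t that] by simp
  qed
  have der: "has_matrix_derivative (?C i) (Ft t ** (?K ** unit_mat i
      - unit_mat i ** ?K) ** Gt t ** diag mu) t" for i
  proof (rule hmd_cong [OF _ open_U t])
    have "has_matrix_derivative (\<lambda>s. Ft s ** unit_mat i ** Gt s ** diag mu)
      ((Ft t ** ?K ** unit_mat i ** Gt t + Ft t ** unit_mat i ** (- (?K ** Gt t))) ** diag mu) t"
      by (intro hmd_mult_const hmd_mult Ft_der Gt_der t)
    moreover have "(Ft t ** ?K ** unit_mat i ** Gt t + Ft t ** unit_mat i ** (- (?K ** Gt t))) ** diag mu
      = Ft t ** (?K ** unit_mat i - unit_mat i ** ?K) ** Gt t ** diag mu"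
    proof -
      have "X ** (- Y) = - (X ** Y)" for X Y :: "complex^3^3"
        by (simp add: vec_eq_iff matrix_matrix_mult_def sum_negf)
      then show ?thesis by (simp add: matrix_diff_distrib matrix_add_distrib matrix_mul_assoc)
    qed
    ultimately show "has_matrix_derivative (\<lambda>s. Ft s ** unit_mat i ** Gt s ** diag mu)
      (Ft t ** (?K ** unit_mat i - unit_mat i ** ?K) ** Gt t ** diag mu) t" by simp
  qed (simp add: conj_B_eq)
  have scale: "Ft t ** mat_scale c W ** Gt t ** diag mu = mat_scale c (Ft t ** W ** Gt t ** diag mu)"
    "Ft t ** (W + W') ** Gt t ** diag mu = Ft t ** W ** Gt t ** diag mu
        + Ft t ** W' ** Gt t ** diag mu" for c W W'
    by (simp_all add: mat_scale_mult matrix_add_distrib)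
  have comm: "?K ** unit_mat 1 - unit_mat 1 ** ?K
      = mat_scale (1 / t) (unit_mat 2 ** ?M ** unit_mat 1 - unit_mat 1 ** ?M ** unit_mat 2)"
    "?K ** unit_mat 2 - unit_mat 2 ** ?K = mat_scale (1 / t) (unit_mat 1 ** ?M ** unit_mat 2
        - unit_mat 2 ** ?M ** unit_mat 1) + mat_scale (1 / (t - 1)) (unit_mat 3 ** ?M ** unit_mat 2
        - unit_mat 2 ** ?M ** unit_mat 3)"
    "?K ** unit_mat 3 - unit_mat 3 ** ?K = mat_scale (1 / (t - 1)) (unit_mat 2 ** ?M ** unit_mat 3
        - unit_mat 3 ** ?M ** unit_mat 2)"
    by (rule flow_mat_commutator, erule M)+
  show "has_matrix_derivative (?C 1) (mat_scale (1 / t) (commutator (?C 2 t) (?C 1 t))) t \<and>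
       has_matrix_derivative (?C 2)
         (mat_scale (1 / t) (commutator (?C 1 t) (?C 2 t))
          + mat_scale (1 / (t - 1)) (commutator (?C 3 t) (?C 2 t))) t \<and>
       has_matrix_derivative (?C 3) (mat_scale (1 / (t - 1)) (commutator (?C 2 t) (?C 3 t))) t"
    unfolding conj_B_eq [OF t] commutator_normal_form scale [symmetric] comm [symmetric]
    using der [of 1] der [of 2] der [of 3] by (intro conjI)
qed

end

end

section \<open>The theorem\<close>

context painleve_flow
begin

text \<open>On a disk the logarithmic derivatives of k and l have primitives.\<close>

lemma gauge_exists:
  assumes ball: "ball t0 e \<subseteq> U"
  shows "\<exists>h. (\<forall>t\<in>ball t0 e. invertible (h t)) \<and>
    solves_Schlesinger (ball t0 e) (\<lambda>i t. conj_by (h t) (B_mat lam mu t (x t) (y t) i))"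
proof -
  let ?p = "\<lambda>s. pp s (x s) (y s)"
  let ?a = "\<lambda>t. (th4 - 1) / (t * (t - 1)) * (y t - t)"
  let ?b = "\<lambda>t. (dl - 1) / (t * (t - 1)) * (y t - t - (dl - th4) / ?p t)"
  have nz: "t * (t - 1) \<noteq> 0" if "t \<in> U" for t using U_nz [OF that] by simp
  have "?a holomorphic_on U" "?b holomorphic_on U"
    by (intro holomorphic_intros y_hol pp_hol nz pp_nz; assumption?)+
  then have hol: "?a holomorphic_on ball t0 e" "?b holomorphic_on ball t0 e"
    using ball holomorphic_on_subset by blast+
  obtain a where a: "\<And>t. t \<in> ball t0 e \<Longrightarrow> (a has_field_derivative ?a t) (at t)"
    using holomorphic_convex_primitive' [OF convex_ball open_ball hol(1)] by (metis at_within_open open_ball)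
  obtain b where b: "\<And>t. t \<in> ball t0 e \<Longrightarrow> (b has_field_derivative ?b t) (at t)"
    using holomorphic_convex_primitive' [OF convex_ball open_ball hol(2)] by (metis at_within_open open_ball)
  define k l where "k t = exp (a t)" and "l t = exp (b t)" for t
  have dk: "(k has_field_derivative k t * ?a t) (at t)" if "t \<in> ball t0 e" for t
    unfolding k_def [abs_def] using DERIV_chain2 [OF DERIV_exp a [OF that]] .
  have dl: "(l has_field_derivative l t * ?b t) (at t)" if "t \<in> ball t0 e" for t
    unfolding l_def [abs_def] using DERIV_chain2 [OF DERIV_exp b [OF that]] .
  interpret b: painleve_flow lam mu "ball t0 e" x y
    by unfold_locales (use ball U_sub PVI x_eq adm holomorphic_on_subset in \<open>auto simp:
        solves_PVI_def\<close>)
  let ?h = "\<lambda>t. diag (vector [l t, k t, 1])"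
  have "solves_Schlesinger (ball t0 e) (\<lambda>i t. conj_by (?h t) (B_mat lam mu t (x t) (y t) i))"
    by (rule b.schlesinger [where pt = ?p])
      (simp add: l_def, simp add: k_def, rule pp_def, erule dk, erule dl)
  moreover have "invertible (?h t)" for t
  proof (rule matrix_inv_eq(2))
    show "?h t ** diag (vector [1 / l t, 1 / k t, 1]) = mat 1"
      by (simp add: vec_eq_iff diag_mult forall_3) (simp add: diag_def mat_def k_def l_def)
  qed
  ultimately show ?thesis by (intro exI [of _ ?h] conjI ballI)
qed

lemma isomonodromic_B: "isomonodromic U (\<lambda>t. B_hat t (B_mat lam mu t (x t) (y t)))"
  by (rule isomonodromic_if_schlesinger [OF U_sub gauge_exists])

lemma dynamics_statement:
  shows "isomonodromic U (\<lambda>t. B_hat t (B_mat lam mu t (x t) (y t))) \<and>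
    (\<forall>l k p.
      (\<forall>t\<in>U. l t \<noteq> 0 \<and> k t \<noteq> 0 \<and>
        p t = x t + (\<Sum>i\<in>UNIV. theta lam mu i / (y t - pole t i)) \<and>
        (k has_field_derivative
           k t * ((theta4 mu - 1) / (t * (t - 1)) * (y t - t))) (at t) \<and>
        (l has_field_derivative
           l t * ((delta lam mu - 1) / (t * (t - 1)) *
                  (y t - t - (delta lam mu - theta4 mu) / p t))) (at t)) \<longrightarrow>
      solves_Schlesinger U
        (\<lambda>i t. conj_by (diag (vector [l t, k t, 1])) (B_mat lam mu t (x t) (y t) i)))"
proof (intro conjI isomonodromic_B allI impI)
  fix l k p
  assume "\<forall>t\<in>U. l t \<noteq> 0 \<and> k t \<noteq> 0 \<and>
          p t = x t + (\<Sum>i\<in>UNIV. theta lam mu i / (y t - pole t i)) \<and>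
          (k has_field_derivative
             k t * ((theta4 mu - 1) / (t * (t - 1)) * (y t - t))) (at t) \<and>
          (l has_field_derivative
             l t * ((delta lam mu - 1) / (t * (t - 1)) *
                    (y t - t - (delta lam mu - theta4 mu) / p t))) (at t)"
  then show "solves_Schlesinger U
          (\<lambda>i t. conj_by (diag (vector [l t, k t, 1])) (B_mat lam mu t (x t) (y t) i))"
    by (intro schlesinger [where pt = p and l = l and k = k]) blast+
qed

end

context generic_params
begin

lemma plane_statement:
  assumes t: "t \<noteq> 0" "t \<noteq> 1"
  shows "generic_in plane_coords UNIV (\<lambda>(x, y).
        let B = B_mat lam mu t x y; dl = delta lam mu in
        admissible lam mu t x y \<and>
        (\<forall>i. rank (B i) = 1 \<and> trace (B i) = lam $ i) \<and>
        (\<Sum>i\<in>UNIV. B i) = diag mu \<and>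
        x \<noteq> 0 \<and>
        (\<forall>z. B_tilde t B z $ 2 $ 3 = 0 \<longleftrightarrow> z = y) \<and>
        (\<forall>z. B_tilde t B z $ 2 $ 1 = 0 \<longleftrightarrow> z = y + (mu $ 3 - mu $ 1) / x) \<and>
        mu $ 1 \<noteq> 0 \<and> mu $ 3 \<noteq> 0 \<and>
        (\<forall>i. y \<noteq> pole t i \<and> y + dl / x \<noteq> pole t i) \<and>
        x = (mu $ 1 - mu $ 3) / mu $ 3 * B_hat t B y $ 3 $ 3 \<and>
        x = (mu $ 3 - mu $ 1) / mu $ 1 * B_hat t B (y + dl / x) $ 1 $ 1)"
proof -
  obtain x0 y0 where xy0: "plane_poly t (x0, y0) \<noteq> 0" using plane_poly_nontrivial [OF t] by blast
  show ?thesis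
  proof (rule generic_inI [OF plane_poly_polynomial UNIV_I xy0], goal_cases)
    case (1 P)
    obtain x y where P: "P = (x, y)" by fastforce
    have "plane_poly t (x, y) \<noteq> 0" using 1 P by simp
    then have reg: "regular t x y" and x: "x \<noteq> 0" and y21: "\<And>i. y + dl / x \<noteq> pole t i"
      unfolding plane_poly_nonzero_iff [OF t] by blast+
    note y = y_not_pole [OF t reg] and BB = t reg
    have k: "- (mu $ 3 / dl) \<noteq> 0" using mu_nonzero dl_nonzero by simp
    have k': "- (mu $ 1 * cubic t y * pp t x y * x / (dl * (dl - th4))) \<noteq> 0"
      using mu_nonzero dl_nonzero mu21_nonzero cubic_nonzero [OF y] pp_nonzero [OF t reg] x by simp
    have 23: "B_tilde t (B_mat lam mu t x y) z $ 2 $ 3 = 0 \<longleftrightarrow> z = y" for z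
      unfolding B_tilde_23 [OF BB] mult_eq_0_iff using k by auto
    have 21: "B_tilde t (B_mat lam mu t x y) z $ 2 $ 1 = 0 \<longleftrightarrow> z
        = y + (mu $ 3 - mu $ 1) / x" for z
      unfolding B_tilde_21 [OF BB x] mult_eq_0_iff dl_eq [symmetric] using k' by auto
    have 33: "x = (mu $ 1 - mu $ 3) / mu $ 3 * B_hat t (B_mat lam mu t x y) y $ 3 $ 3"
    proof -
      have "(mu $ 1 - mu $ 3) = - dl" by (simp add: dl_eq)
      then show ?thesis unfolding B_hat_33 [OF BB x] using mu_nonzero dl_nonzero by simp
    qed
    have 11: "x = (mu $ 3 - mu $ 1) / mu $ 1 * B_hat t (B_mat lam mu t x y) (y + dl / x) $ 1 $ 1"
      unfolding B_hat_11 [OF BB x y21] dl_eq [symmetric] using mu_nonzero dl_nonzero by simp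
    show ?case
      unfolding P prod.case Let_def
      by (intro conjI allI regular_imp_admissible [OF t reg] B_rank [OF BB] B_trace [OF BB] B_sum [OF BB]
          x 23 21 mu_nonzero y [rule_format] y21 33 11)
  qed
qed

lemma triple_statement:
  assumes t: "t \<noteq> 0" "t \<noteq> 1"
  shows "generic_in triple_coords (rank_one_triples lam mu) (\<lambda>A.
        \<exists>x y d. admissible lam mu t x y \<and> (\<forall>i. d $ i \<noteq> 0) \<and>
          (\<forall>i. A i = conj_by (diag d) (B_mat lam mu t x y i)))"
proof -
  obtain x0 y0 where "plane_poly t (x0, y0) \<noteq> 0" using plane_poly_nontrivial [OF t] by blast
  then have reg: "regular t x0 y0" unfolding plane_poly_nonzero_iff [OF t] by blast
  have "B_mat lam mu t x0 y0 \<in> rank_one_triples lam mu"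
    unfolding rank_one_triples_def by (simp add: B_rank [OF t reg] B_trace [OF t reg] B_sum [OF t reg])
  then show ?thesis
  proof (rule generic_inI [where f = "triple_poly t", OF triple_poly_polynomial _ triple_poly_B [OF t reg]])
    fix A assume "A \<in> rank_one_triples lam mu" "triple_poly t A \<noteq> 0"
    then show "\<exists>x y d. admissible lam mu t x y \<and> (\<forall>i. d $ i \<noteq> 0) \<and>
          (\<forall>i. A i = conj_by (diag d) (B_mat lam mu t x y i))"
      using triple_normal_form [OF t] admissible_iff [OF t] by metis
  qed
qed

end

theorem mainTheorem2:
  shows "generic_in param_coords param_space (\<lambda>(lam, mu).
    (\<forall>t. t \<noteq> 0 \<and> t \<noteq> 1 \<longrightarrow>
      generic_in plane_coords UNIV (\<lambda>(x, y).
        let B = B_mat lam mu t x y; dl = delta lam mu in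
        admissible lam mu t x y \<and>
        (\<forall>i. rank (B i) = 1 \<and> trace (B i) = lam $ i) \<and>
        (\<Sum>i\<in>UNIV. B i) = diag mu \<and>
        x \<noteq> 0 \<and>
        (\<forall>z. B_tilde t B z $ 2 $ 3 = 0 \<longleftrightarrow> z = y) \<and>
        (\<forall>z. B_tilde t B z $ 2 $ 1 = 0 \<longleftrightarrow> z = y + (mu $ 3 - mu $ 1) / x) \<and>
        mu $ 1 \<noteq> 0 \<and> mu $ 3 \<noteq> 0 \<and>
        (\<forall>i. y \<noteq> pole t i \<and> y + dl / x \<noteq> pole t i) \<and>
        x = (mu $ 1 - mu $ 3) / mu $ 3 * B_hat t B y $ 3 $ 3 \<and>
        x = (mu $ 3 - mu $ 1) / mu $ 1 * B_hat t B (y + dl / x) $ 1 $ 1) \<and>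
      generic_in triple_coords (rank_one_triples lam mu) (\<lambda>A.
        \<exists>x y d. admissible lam mu t x y \<and> (\<forall>i. d $ i \<noteq> 0) \<and>
          (\<forall>i. A i = conj_by (diag d) (B_mat lam mu t x y i)))) \<and>
    (\<forall>U y x. open U \<and> U \<subseteq> - {0, 1} \<and>
      solves_PVI (theta lam mu 1) (theta lam mu 2) (theta lam mu 3) (theta4 mu) U y \<and>
      (\<forall>t\<in>U. 2 * x t = ((t - 1) * deriv y t - theta lam mu 1) / y t
                       + (deriv y t - 1 - theta lam mu 2) / (y t - t)
                       - (t * deriv y t + theta lam mu 3) / (y t - 1)) \<and>
      (\<forall>t\<in>U. admissible lam mu t (x t) (y t)) \<longrightarrow>
      isomonodromic U (\<lambda>t. B_hat t (B_mat lam mu t (x t) (y t))) \<and>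
      (\<forall>l k p.
        (\<forall>t\<in>U. l t \<noteq> 0 \<and> k t \<noteq> 0 \<and>
          p t = x t + (\<Sum>i\<in>UNIV. theta lam mu i / (y t - pole t i)) \<and>
          (k has_field_derivative
             k t * ((theta4 mu - 1) / (t * (t - 1)) * (y t - t))) (at t) \<and>
          (l has_field_derivative
             l t * ((delta lam mu - 1) / (t * (t - 1)) *
                    (y t - t - (delta lam mu - theta4 mu) / p t))) (at t)) \<longrightarrow>
        solves_Schlesinger U
          (\<lambda>i t. conj_by (diag (vector [l t, k t, 1])) (B_mat lam mu t (x t) (y t) i)))))"
proof -
  define disc :: "(complex^3) \<times> (complex^3) \<Rightarrow> complex" where
    "disc = (\<lambda>P. (snd P $ 1 * (snd P $ 2 * snd P $ 3)) *
      ((snd P $ 1 - snd P $ 2) * ((snd P $ 1 - snd P $ 3) * (snd P $ 2 - snd P $ 3))))"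
  have coord: "(\<lambda>P. snd P $ i) \<in> polynomial_functions param_coords" for i
    by (rule polynomial_functions.coord) (auto simp: param_coords_def case_prod_unfold)
  have disc: "disc \<in> polynomial_functions param_coords"
    unfolding disc_def by (intro polynomial_intros coord)
  let ?v = "vector [1, 2, 3] :: complex^3"
  have v: "(?v, ?v) \<in> param_space" "disc (?v, ?v) \<noteq> 0"
    by (simp_all add: param_space_def disc_def)
  show ?thesis
  proof (rule generic_inI [OF disc v], goal_cases)
    case (1 P)
    obtain lam mu where P: "P = (lam, mu)" by fastforce
    interpret generic_params lam mu
      by unfold_locales (use 1 P in \<open>auto simp: disc_def\<close>)
    have dynamics: "painleve_flow lam mu U x y" if "open U \<and> U \<subseteq> - {0, 1} \<and>
        solves_PVI (th 1) (th 2) (th 3) th4 U y \<and>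
        (\<forall>t\<in>U. 2 * x t = ((t - 1) * deriv y t - th 1) / y t
                       + (deriv y t - 1 - th 2) / (y t - t)
                       - (t * deriv y t + th 3) / (y t - 1)) \<and>
        (\<forall>t\<in>U. admissible lam mu t (x t) (y t))" for U y x
      by unfold_locales (use that in blast)+
    show ?case
      unfolding P prod.case
      by (rule conjI, (intro allI impI, erule conjE, rule conjI, erule (1) plane_statement, erule (1) triple_statement),
        intro allI impI, erule painleve_flow.dynamics_statement [OF dynamics])
  qed
qed

end
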